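(* Let $\mathbf M$ be a finite algebra and let $\mathbb M_1=\langle M;H_1,R_1,\mathcal T\rangle$ and $\mathbb M_2=\langle M;H_2,R_2,\mathcal T\rangle$ be alter egos of $\mathbf M$. Assume that: (hm) every hom-minimal relation on $\mathbf M$ belongs to $\mathrm{Rel}_{\mathrm{ca}}(\mathbb M_2)$; (op) $\mathbb M_2$ is operationally rich at each relation in $R_2\cup\{\mathrm{dom}(h)\mid h\in H_2\}$; (ax) $\Sigma_1$ is a basis for the universal Horn theory $\mathrm{Th_{uH}}(\mathbb M_1)$ consisting of pure uH-sentences such that, for each $\varphi\in\Sigma_1$, if the conclusion of $\varphi$ is not in the language of $\mathbb M_2$, then $\mathbb M_2$ is operationally rich at the relation $\mathrm{pr}_{\mathbb M_2}(\varphi^\natural)$. Then: (1) If $\mathbb M_1$ fully dualises $\mathbf M$ at the finite level, then so does $\mathbb M_2$. (2) If $\mathbb M_1$ is standard and fully dualises $\mathbf M$, then $\mathbb M_2$ is standard and fully dualises $\mathbf M$.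
   Context: All algebras are non-empty (so "subalgebra" means non-empty subalgebra). $\mathbf M=\langle M;\Sigma\rangle$ is a finite algebra and $\mathcal A:=\mathsf{ISP}(\mathbf M)$ is the class of isomorphic copies of subalgebras of arbitrary (possibly zero) powers of $\mathbf M$. Compatibility: an $n$-ary relation $r\subseteq M^n$ ($n\ge 0$) is compatible with $\mathbf M$ if it is the underlying set of a subalgebra $\mathbf r$ of $\mathbf M^n$; an $n$-ary partial operation $h$ on $M$ is compatible with $\mathbf M$ if $\mathrm{graph}(h)=\{(\vec a,h(\vec a))\mid \vec a\in\mathrm{dom}(h)\}$ is a compatible relation. An alter ego of $\mathbf M$ is $\mathbb M=\langle M;H,R,\mathcal T\rangle$ with $H$ a set of compatible partial operations (total and nullary operations allowed), $R$ a set of compatible relations and $\mathcal T$ the discrete topology. Elements of $H$ and $R$ are used as their own symbols; all symbols in $H$ are logically treated as partial operations. The top alter ego $\mathbb M_\Omega=\langle M;H_\Omega,R_\Omega,\mathcal T\rangle$ has all compatible partial operations and all compatible relations. Logic: a term takes a value at a tuple iff all its subterms are defined there. An atomic formula is $s=t$ (true iff both sides are defined and equal) or $\rho(t_1,\dots,t_n)$ with $\rho\in R$ (true iff all $t_i$ are defined and the tuple is in $\rho$). A conjunct-atomic formula is a finite (possibly empty) conjunction of atomic formulas. A uH-sentence is $\forall\vec v\,[(\bigwedge_{i=1}^\nu\alpha_i(\vec v))\to\gamma(\vec v)]$, $\nu\ge0$, with premises $\alpha_i$ atomic and conclusion $\gamma$ atomic or $\bot$. $\mathrm{Th_{uH}}(\mathbb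 M)$ is the set of uH-sentences true in $\mathbb M$; a basis is a set of uH-sentences true in $\mathbb M$ that implies all of $\mathrm{Th_{uH}}(\mathbb M)$. A uH-sentence is pure if each $\alpha_i$ has the form $r(v_{i_1},\dots,v_{i_n})$ or $h(v_{i_1},\dots,v_{i_n})=v_{i_0}$, and $\gamma$ has the form $r(v_{i_1},\dots,v_{i_n})$, or $h(v_{i_1},\dots,v_{i_n})=h(v_{i_1},\dots,v_{i_n})$, or $u=v$, or $\bot$, where all arguments are (not necessarily distinct) variables. A conclusion is in the language of $\mathbb M_2$ if every relation or partial-operation symbol in it belongs to $R_2\cup H_2$. $\mathrm{Clo}_{\mathrm{ep}}(\mathbb M)$ is the smallest set of non-empty partial operations on $M$ containing $H$ and all projections $M^n\to M$ ($n\ge1$) and closed under composition when the composite has non-empty domain (i.e. the non-empty partial operations given by terms). $\mathrm{Rel}_{\mathrm{ca}}(\mathbb M)$ is the set of non-empty relations on $M$ defined in $\mathbb M$ by conjunct-atomic formulas. A compatible relation $r$ is hom-minimal if every homomorphism $\mathbf r\to\mathbf M$ is a projection. $\mathbb M$ is operationally rich at $r$ if every compatible partial operation on $\mathbf M$ with domain $r$ has an extension in $\mathrm{Clo}_{\mathrm{ep}}(\mathbb M)$ (vacuous if $r=\emptyset$). The sentence $\varphi^\natural$ (under (hm)): for each $n$-ary compatible relation $r$ fix an enumeration $f_1,\dots,f_m$ of $\hom_{\mathcal A}(\mathbf r,\mathbf M)$ and put $\widehat r=\{(\vec a,f_1(\vec a),\dots,f_m(\vec a))\mid\vec a\in r\}$,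 which is hom-minimal; fix a conjunct-atomic formula $\widehat\beta_r(\vec v,\vec w)$ in the language of $\mathbb M_2$ defining $\widehat r$ in $\mathbb M_2$, and let $\beta_r(\vec v):=\exists\vec w\,\widehat\beta_r(\vec v,\vec w)$. For a pure uH-sentence $\varphi$ in the language of $\mathbb M_\Omega$, $\varphi^\natural$ is obtained by replacing each $r(v_{i_1},\dots,v_{i_n})$ by $\beta_r(v_{i_1},\dots,v_{i_n})$, each $h(v_{i_1},\dots,v_{i_n})=v_{i_0}$ by $\beta_{\mathrm{graph}(h)}(v_{i_1},\dots,v_{i_n},v_{i_0})$, and a conclusion $h(v_{i_1},\dots,v_{i_n})=h(v_{i_1},\dots,v_{i_n})$ by $\beta_{\mathrm{dom}(h)}(v_{i_1},\dots,v_{i_n})$, and then moving the existential quantifiers in the premise out to the front as universal quantifiers (over new variables $\vec w_1,\dots,\vec w_\nu$, one tuple per premise conjunct). For a sentence $\sigma=\forall\vec v\,[\psi(\vec v)\to\gamma(\vec v)]$, $\mathrm{pr}_{\mathbb X}(\sigma)$ is the relation on $X$ defined in $\mathbb X$ by the premise $\psi$. Dual categories: for an alter ego $\mathbb M$, $\mathcal Z$ is the category of Boolean structures of signature $(H,R)$: (possibly empty) compact Hausdorff totally disconnected spaces with continuous partial operations on closed domains and closed relations; morphisms are continuous maps preserving relations and the domains and graphs of partial operations. An induced substructure of $\mathbb Y$ is a subset closed under the partial operations (where defined), with subspace topology and restricted relations, domains and graphs. $\mathcal X:=\mathsf{IS_cP}^{+}(\mathbb M)$ consists of isomorphic copies of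 topologically closed induced substructures of powers $\mathbb M^S$, $S\neq\emptyset$ (the empty structure is included iff $H$ has no nullary operations). $D(\mathbf A)$ is the induced substructure of $\mathbb M^A$ on $\hom_{\mathcal A}(\mathbf A,\mathbf M)$, and $E(\mathbb Z)$ is the subalgebra of $\mathbf M^Z$ on $\hom_{\mathcal Z}(\mathbb Z,\mathbb M)$; $\eta_{\mathbf A}\colon\mathbf A\to ED(\mathbf A)$ and $\varepsilon_{\mathbb X}\colon\mathbb X\to DE(\mathbb X)$ are the evaluation maps $\eta_{\mathbf A}(a)(x)=x(a)$, $\varepsilon_{\mathbb X}(x)(u)=u(x)$. $\mathbb M$ fully dualises $\mathbf M$ [at the finite level] if $\eta_{\mathbf A}$ is an isomorphism for each [finite] $\mathbf A\in\mathcal A$ and $\varepsilon_{\mathbb X}$ is an isomorphism for each [finite] $\mathbb X\in\mathcal X$. $\mathbb M$ is standard if $\mathcal X=\{\mathbb Y\in\mathcal Z\mid\mathbb Y\models\mathrm{Th_{uH}}(\mathbb M)\}$. *)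

theory Defs
  imports "HOL-Analysis.Analysis"
begin

section \<open>Algebras\<close>

text \<open>
  A signature is a partial map from operation symbols to arities. Tuples are lists, and the finite
  power of arity \<open>n\<close> of an algebra consists of lists of length \<open>n\<close>; the power by an arbitrary index
  set \<open>S\<close> consists of extensional functions on \<open>S\<close> (for \<open>S = {}\<close> it has exactly one element).
\<close>

definition tuples :: "nat \<Rightarrow> 'a set \<Rightarrow> 'a list set" where
  "tuples n A = {as. length as = n \<and> set as \<subseteq> A}"

record ('f, 'a) alg =
  carr :: "'a set"
  fop :: "'f \<Rightarrow> 'a list \<Rightarrow> 'a"

type_synonym 'f signature = "'f \<Rightarrow> nat option"

definition is_alg :: "'f signature \<Rightarrow> ('f, 'a) alg \<Rightarrow> bool" where
  "is_alg sig A \<longleftrightarrow> carr A \<noteq> {} \<and>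
     (\<forall>f n as. sig f = Some n \<longrightarrow> as \<in> tuples n (carr A) \<longrightarrow> fop A f as \<in> carr A)"

definition subuniverse :: "'f signature \<Rightarrow> ('f, 'a) alg \<Rightarrow> 'a set \<Rightarrow> bool" where
  "subuniverse sig A B \<longleftrightarrow> B \<noteq> {} \<and> B \<subseteq> carr A \<and>
     (\<forall>f n as. sig f = Some n \<longrightarrow> as \<in> tuples n B \<longrightarrow> fop A f as \<in> B)"

definition subalg :: "('f, 'a) alg \<Rightarrow> 'a set \<Rightarrow> ('f, 'a) alg" where
  "subalg A B = A\<lparr>carr := B\<rparr>"

definition alg_power :: "('f, 'a) alg \<Rightarrow> 's set \<Rightarrow> ('f, 's \<Rightarrow> 'a) alg" where
  "alg_power A S = \<lparr>carr = S \<rightarrow>\<^sub>E carr A, fop = (\<lambda>f xs. \<lambda>s\<in>S. fop A f (map (\<lambda>x. x s) xs))\<rparr>"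

definition tuple_power :: "('f, 'a) alg \<Rightarrow> nat \<Rightarrow> ('f, 'a list) alg" where
  "tuple_power A n =
     \<lparr>carr = tuples n (carr A), fop = (\<lambda>f xs. map (\<lambda>i. fop A f (map (\<lambda>x. x ! i) xs)) [0..<n])\<rparr>"

definition alg_hom :: "'f signature \<Rightarrow> ('f, 'a) alg \<Rightarrow> ('f, 'b) alg \<Rightarrow> ('a \<Rightarrow> 'b) set" where
  "alg_hom sig A B = {g \<in> carr A \<rightarrow>\<^sub>E carr B.
     \<forall>f n as. sig f = Some n \<longrightarrow> as \<in> tuples n (carr A) \<longrightarrow> g (fop A f as) = fop B f (map g as)}"

definition alg_iso :: "'f signature \<Rightarrow> ('f, 'a) alg \<Rightarrow> ('f, 'b) alg \<Rightarrow> ('a \<Rightarrow> 'b) \<Rightarrow> bool" where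
  "alg_iso sig A B g \<longleftrightarrow> g \<in> alg_hom sig A B \<and> bij_betw g (carr A) (carr B)"

text \<open>
  Membership in \<open>\<A> = ISP(M)\<close>. Index sets are taken to be sets of functions \<open>'a \<Rightarrow> 'm\<close>; this is no
  restriction, see lemma \<open>in_ISP_I\<close> at the end of this theory.
\<close>

definition in_ISP :: "'f signature \<Rightarrow> ('f, 'm) alg \<Rightarrow> ('f, 'a) alg \<Rightarrow> bool" where
  "in_ISP sig M A \<longleftrightarrow> is_alg sig A \<and>
     (\<exists>(S :: ('a \<Rightarrow> 'm) set) B g. subuniverse sig (alg_power M S) B \<and>
        alg_iso sig A (subalg (alg_power M S) B) g)"


section \<open>Compatible relations and partial operations, alter egos\<close>

type_synonym 'a partop = "'a list \<Rightarrow> 'a option"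
type_synonym 'a frel = "'a list set"

definition op_graph :: "'a partop \<Rightarrow> 'a frel" where
  "op_graph h = {as @ [b] | as b. h as = Some b}"

text \<open>
  Compatible relations are non-empty because subuniverses are. Hence the arity of a compatible
  relation or partial operation can be read off from its elements or arguments.
\<close>

definition compatible_rel :: "'f signature \<Rightarrow> ('f, 'm) alg \<Rightarrow> nat \<Rightarrow> 'm frel \<Rightarrow> bool" where
  "compatible_rel sig M n r \<longleftrightarrow> subuniverse sig (tuple_power M n) r"

definition compatible_op :: "'f signature \<Rightarrow> ('f, 'm) alg \<Rightarrow> nat \<Rightarrow> 'm partop \<Rightarrow> bool" where
  "compatible_op sig M n h \<longleftrightarrow> compatible_rel sig M (Suc n) (op_graph h)"

definition rel_arity :: "'m frel \<Rightarrow> nat" where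
  "rel_arity r = (THE n. \<forall>as\<in>r. length as = n)"

definition op_arity :: "'m partop \<Rightarrow> nat" where
  "op_arity h = rel_arity (dom h)"

record 'm alter_ego =
  eops :: "'m partop set"
  erels :: "'m frel set"

definition is_alter_ego :: "'f signature \<Rightarrow> ('f, 'm) alg \<Rightarrow> 'm alter_ego \<Rightarrow> bool" where
  "is_alter_ego sig M E \<longleftrightarrow>
     (\<forall>h\<in>eops E. \<exists>n. compatible_op sig M n h) \<and> (\<forall>r\<in>erels E. \<exists>n. compatible_rel sig M n r)"

definition rel_alg :: "('f, 'm) alg \<Rightarrow> nat \<Rightarrow> 'm frel \<Rightarrow> ('f, 'm list) alg" where
  "rel_alg M n r = subalg (tuple_power M n) r"

definition hom_minimal :: "'f signature \<Rightarrow> ('f, 'm) alg \<Rightarrow> nat \<Rightarrow> 'm frel \<Rightarrow> bool" where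
  "hom_minimal sig M n r \<longleftrightarrow> compatible_rel sig M n r \<and>
     (\<forall>g\<in>alg_hom sig (rel_alg M n r) M. \<exists>i<n. \<forall>as\<in>r. g as = as ! i)"


section \<open>Structures with partial operations and relations\<close>

text \<open>
  The elements of an alter ego on \<open>M\<close> are used as their own symbols, so a structure interprets
  partial operations and relations on \<open>'m\<close>. An alter ego \<open>E\<close> serves as the signature; the
  interpretation of symbols outside \<open>E\<close> is irrelevant. The carrier is the space of \<open>ptop\<close>.
\<close>

record ('m, 'x) pstruct =
  ptop :: "'x topology"
  pfun :: "'m partop \<Rightarrow> 'x partop"
  prel :: "'m frel \<Rightarrow> 'x frel"

abbreviation points :: "('m, 'x) pstruct \<Rightarrow> 'x set" where
  "points X \<equiv> topspace (ptop X)"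

definition is_pstruct :: "'m alter_ego \<Rightarrow> ('m, 'x) pstruct \<Rightarrow> bool" where
  "is_pstruct E X \<longleftrightarrow>
     (\<forall>h\<in>eops E. dom (pfun X h) \<subseteq> tuples (op_arity h) (points X) \<and> ran (pfun X h) \<subseteq> points X) \<and>
     (\<forall>r\<in>erels E. prel X r \<subseteq> tuples (rel_arity r) (points X))"

text \<open>The structure \<open>\<langle>M; H, R, \<T>\<rangle>\<close>; every symbol denotes itself, whatever \<open>H\<close> and \<open>R\<close> are.\<close>

definition ego_struct :: "('f, 'm) alg \<Rightarrow> ('m, 'm) pstruct" where
  "ego_struct M = \<lparr>ptop = discrete_topology (carr M), pfun = (\<lambda>h. h), prel = (\<lambda>r. r)\<rparr>"

definition tuple_topology :: "'x topology \<Rightarrow> nat \<Rightarrow> 'x list topology" where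
  "tuple_topology T n =
     pullback_topology (tuples n (topspace T)) (\<lambda>xs. \<lambda>i\<in>{..<n}. xs ! i) (product_topology (\<lambda>_. T) {..<n})"

definition totally_disconnected_space :: "'x topology \<Rightarrow> bool" where
  "totally_disconnected_space T \<longleftrightarrow> (\<forall>S. connectedin T S \<longrightarrow> (\<exists>a. S \<subseteq> {a}))"

definition boolean_struct :: "'m alter_ego \<Rightarrow> ('m, 'x) pstruct \<Rightarrow> bool" where
  "boolean_struct E X \<longleftrightarrow> is_pstruct E X \<and>
     compact_space (ptop X) \<and> Hausdorff_space (ptop X) \<and> totally_disconnected_space (ptop X) \<and>
     (\<forall>h\<in>eops E. closedin (tuple_topology (ptop X) (op_arity h)) (dom (pfun X h)) \<and>
        continuous_map (subtopology (tuple_topology (ptop X) (op_arity h)) (dom (pfun X h))) (ptop X)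
          (\<lambda>xs. the (pfun X h xs))) \<and>
     (\<forall>r\<in>erels E. closedin (tuple_topology (ptop X) (rel_arity r)) (prel X r))"

definition zhom :: "'m alter_ego \<Rightarrow> ('m, 'x) pstruct \<Rightarrow> ('m, 'y) pstruct \<Rightarrow> ('x \<Rightarrow> 'y) set" where
  "zhom E X Y = {g \<in> points X \<rightarrow>\<^sub>E points Y. continuous_map (ptop X) (ptop Y) g \<and>
     (\<forall>r\<in>erels E. \<forall>xs\<in>prel X r. map g xs \<in> prel Y r) \<and>
     (\<forall>h\<in>eops E. \<forall>xs b. pfun X h xs = Some b \<longrightarrow> pfun Y h (map g xs) = Some (g b))}"

definition ziso :: "'m alter_ego \<Rightarrow> ('m, 'x) pstruct \<Rightarrow> ('m, 'y) pstruct \<Rightarrow> ('x \<Rightarrow> 'y) \<Rightarrow> bool" where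
  "ziso E X Y g \<longleftrightarrow> g \<in> zhom E X Y \<and>
     (\<exists>k\<in>zhom E Y X. (\<forall>x\<in>points X. k (g x) = x) \<and> (\<forall>y\<in>points Y. g (k y) = y))"

definition closed_under_ops :: "'m alter_ego \<Rightarrow> ('m, 'x) pstruct \<Rightarrow> 'x set \<Rightarrow> bool" where
  "closed_under_ops E X Y \<longleftrightarrow>
     Y \<subseteq> points X \<and> (\<forall>h\<in>eops E. \<forall>xs b. set xs \<subseteq> Y \<longrightarrow> pfun X h xs = Some b \<longrightarrow> b \<in> Y)"

definition substruct :: "('m, 'x) pstruct \<Rightarrow> 'x set \<Rightarrow> ('m, 'x) pstruct" where
  "substruct X Y = \<lparr>ptop = subtopology (ptop X) Y,
     pfun = (\<lambda>h xs. if set xs \<subseteq> Y then pfun X h xs else None),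
     prel = (\<lambda>r. {xs \<in> prel X r. set xs \<subseteq> Y})\<rparr>"

text \<open>Powers are only used for \<open>S \<noteq> {}\<close>.\<close>

definition struct_power :: "('m, 'x) pstruct \<Rightarrow> 's set \<Rightarrow> ('m, 's \<Rightarrow> 'x) pstruct" where
  "struct_power X S = \<lparr>ptop = product_topology (\<lambda>_. ptop X) S,
     pfun = (\<lambda>h xs. if set xs \<subseteq> (S \<rightarrow>\<^sub>E points X) \<and> (\<forall>s\<in>S. map (\<lambda>x. x s) xs \<in> dom (pfun X h))
              then Some (\<lambda>s\<in>S. the (pfun X h (map (\<lambda>x. x s) xs))) else None),
     prel = (\<lambda>r. {xs. set xs \<subseteq> (S \<rightarrow>\<^sub>E points X) \<and> (\<forall>s\<in>S. map (\<lambda>x. x s) xs \<in> prel X r)})\<rparr>"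

text \<open>
  Membership in \<open>\<X> = IS\<^sub>cP\<^sup>+(M)\<close>. Index sets are taken to be sets of functions \<open>'x \<Rightarrow> 'm\<close>; this is no
  restriction, see lemma \<open>in_IScP_I\<close> at the end of this theory.
\<close>

definition in_IScP :: "('f, 'm) alg \<Rightarrow> 'm alter_ego \<Rightarrow> ('m, 'x) pstruct \<Rightarrow> bool" where
  "in_IScP M E X \<longleftrightarrow> boolean_struct E X \<and>
     (\<exists>(S :: ('x \<Rightarrow> 'm) set) Y g. S \<noteq> {} \<and>
        closedin (ptop (struct_power (ego_struct M) S)) Y \<and>
        closed_under_ops E (struct_power (ego_struct M) S) Y \<and>
        ziso E X (substruct (struct_power (ego_struct M) S) Y) g)"


section \<open>The dual adjunction, full duality\<close>

definition dual_D :: "'f signature \<Rightarrow> ('f, 'm) alg \<Rightarrow> ('f, 'a) alg \<Rightarrow> ('m, 'a \<Rightarrow> 'm) pstruct" where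
  "dual_D sig M A = substruct (struct_power (ego_struct M) (carr A)) (alg_hom sig A M)"

definition dual_E :: "('f, 'm) alg \<Rightarrow> 'm alter_ego \<Rightarrow> ('m, 'x) pstruct \<Rightarrow> ('f, 'x \<Rightarrow> 'm) alg" where
  "dual_E M E Z = subalg (alg_power M (points Z)) (zhom E Z (ego_struct M))"

definition eta :: "'f signature \<Rightarrow> ('f, 'm) alg \<Rightarrow> ('f, 'a) alg \<Rightarrow> 'a \<Rightarrow> ('a \<Rightarrow> 'm) \<Rightarrow> 'm" where
  "eta sig M A = (\<lambda>a\<in>carr A. \<lambda>x\<in>alg_hom sig A M. x a)"

definition epsilon :: "('f, 'm) alg \<Rightarrow> 'm alter_ego \<Rightarrow> ('m, 'x) pstruct \<Rightarrow> 'x \<Rightarrow> ('x \<Rightarrow> 'm) \<Rightarrow> 'm" where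
  "epsilon M E X = (\<lambda>x\<in>points X. \<lambda>u\<in>zhom E X (ego_struct M). u x)"

definition eta_iso :: "'f signature \<Rightarrow> ('f, 'm) alg \<Rightarrow> 'm alter_ego \<Rightarrow> ('f, 'a) alg \<Rightarrow> bool" where
  "eta_iso sig M E A \<longleftrightarrow> alg_iso sig A (dual_E M E (dual_D sig M A)) (eta sig M A)"

definition epsilon_iso :: "'f signature \<Rightarrow> ('f, 'm) alg \<Rightarrow> 'm alter_ego \<Rightarrow> ('m, 'x) pstruct \<Rightarrow> bool" where
  "epsilon_iso sig M E X \<longleftrightarrow> ziso E X (dual_D sig M (dual_E M E X)) (epsilon M E X)"

text \<open>
  The type arguments are the universes over which the proper classes \<open>\<A>\<close> and \<open>\<X>\<close> range: all
  algebras carried by a subset of \<open>'a\<close> and all structures carried by a subset of \<open>'x\<close>.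
  Infinite universes contain a copy of every finite algebra and structure; the unrestricted notions
  amount to the ones given here for all \<open>'a\<close> and \<open>'x\<close>.
\<close>

definition fully_dualises ::
    "'a itself \<Rightarrow> 'x itself \<Rightarrow> 'f signature \<Rightarrow> ('f, 'm) alg \<Rightarrow> 'm alter_ego \<Rightarrow> bool" where
  "fully_dualises _ _ sig M E \<longleftrightarrow>
     (\<forall>A :: ('f, 'a) alg. in_ISP sig M A \<longrightarrow> eta_iso sig M E A) \<and>
     (\<forall>X :: ('m, 'x) pstruct. in_IScP M E X \<longrightarrow> epsilon_iso sig M E X)"

definition fully_dualises_finite ::
    "'a itself \<Rightarrow> 'x itself \<Rightarrow> 'f signature \<Rightarrow> ('f, 'm) alg \<Rightarrow> 'm alter_ego \<Rightarrow> bool" where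
  "fully_dualises_finite _ _ sig M E \<longleftrightarrow>
     (\<forall>A :: ('f, 'a) alg. in_ISP sig M A \<longrightarrow> finite (carr A) \<longrightarrow> eta_iso sig M E A) \<and>
     (\<forall>X :: ('m, 'x) pstruct. in_IScP M E X \<longrightarrow> finite (points X) \<longrightarrow> epsilon_iso sig M E X)"


section \<open>Terms, formulas and sentences\<close>

datatype 'm trm = Var nat | App "'m partop" "'m trm list"

datatype 'm atomic = Eq "'m trm" "'m trm" | Rel "'m frel" "'m trm list"

text \<open>A tuple \<open>xs\<close> of elements is an assignment of the variables \<open>0, \<dots>, length xs - 1\<close>.\<close>

primrec eval :: "('m, 'x) pstruct \<Rightarrow> 'x list \<Rightarrow> 'm trm \<Rightarrow> 'x option" where
  "eval X xs (Var i) = Some (xs ! i)"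
| "eval X xs (App h ts) =
     (let vs = map (eval X xs) ts in if None \<in> set vs then None else pfun X h (map the vs))"

primrec holds :: "('m, 'x) pstruct \<Rightarrow> 'x list \<Rightarrow> 'm atomic \<Rightarrow> bool" where
  "holds X xs (Eq s t) \<longleftrightarrow> (\<exists>b. eval X xs s = Some b \<and> eval X xs t = Some b)"
| "holds X xs (Rel r ts) \<longleftrightarrow>
     None \<notin> set (map (eval X xs) ts) \<and> map (the \<circ> eval X xs) ts \<in> prel X r"

primrec wf_trm :: "'m alter_ego \<Rightarrow> nat \<Rightarrow> 'm trm \<Rightarrow> bool" where
  "wf_trm E n (Var i) \<longleftrightarrow> i < n"
| "wf_trm E n (App h ts) \<longleftrightarrow> h \<in> eops E \<and> length ts = op_arity h \<and> list_all (wf_trm E n) ts"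

primrec wf_atomic :: "'m alter_ego \<Rightarrow> nat \<Rightarrow> 'm atomic \<Rightarrow> bool" where
  "wf_atomic E n (Eq s t) \<longleftrightarrow> wf_trm E n s \<and> wf_trm E n t"
| "wf_atomic E n (Rel r ts) \<longleftrightarrow> r \<in> erels E \<and> length ts = rel_arity r \<and> list_all (wf_trm E n) ts"

text \<open>
  A conjunct-atomic formula is the list of its conjuncts; it defines a relation once its number of
  variables is fixed.
\<close>

type_synonym 'm ca_formula = "'m atomic list"

definition wf_ca :: "'m alter_ego \<Rightarrow> nat \<Rightarrow> 'm ca_formula \<Rightarrow> bool" where
  "wf_ca E n \<Phi> \<longleftrightarrow> (\<forall>\<alpha>\<in>set \<Phi>. wf_atomic E n \<alpha>)"

definition defined_rel :: "('m, 'x) pstruct \<Rightarrow> nat \<Rightarrow> 'm ca_formula \<Rightarrow> 'x frel" where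
  "defined_rel X n \<Phi> = {xs \<in> tuples n (points X). \<forall>\<alpha>\<in>set \<Phi>. holds X xs \<alpha>}"

text \<open>
  Sentences \<open>\<forall>v\<^sub>0 \<dots> v\<^sub>n\<^sub>-\<^sub>1. \<And>prem \<longrightarrow> concl\<close> with \<open>n = nvars\<close>. The number of variables is part of the
  sentence because structures may be empty.
\<close>

record ('m, 'c) sentence =
  nvars :: nat
  prem :: "'m ca_formula"
  concl :: 'c

definition pr :: "('m, 'x) pstruct \<Rightarrow> ('m, 'c) sentence \<Rightarrow> 'x frel" where
  "pr X \<sigma> = defined_rel X (nvars \<sigma>) (prem \<sigma>)"

datatype 'm uh_concl = Bot | At "'m atomic"

type_synonym 'm uh_sentence = "('m, 'm uh_concl) sentence"

primrec holds_uh_concl :: "('m, 'x) pstruct \<Rightarrow> 'x list \<Rightarrow> 'm uh_concl \<Rightarrow> bool" where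
  "holds_uh_concl X xs Bot \<longleftrightarrow> False"
| "holds_uh_concl X xs (At \<alpha>) \<longleftrightarrow> holds X xs \<alpha>"

primrec wf_uh_concl :: "'m alter_ego \<Rightarrow> nat \<Rightarrow> 'm uh_concl \<Rightarrow> bool" where
  "wf_uh_concl E n Bot \<longleftrightarrow> True"
| "wf_uh_concl E n (At \<alpha>) \<longleftrightarrow> wf_atomic E n \<alpha>"

definition wf_uh :: "'m alter_ego \<Rightarrow> 'm uh_sentence \<Rightarrow> bool" where
  "wf_uh E \<sigma> \<longleftrightarrow> wf_ca E (nvars \<sigma>) (prem \<sigma>) \<and> wf_uh_concl E (nvars \<sigma>) (concl \<sigma>)"

definition sat_uh :: "('m, 'x) pstruct \<Rightarrow> 'm uh_sentence \<Rightarrow> bool" where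
  "sat_uh X \<sigma> \<longleftrightarrow> (\<forall>xs\<in>pr X \<sigma>. holds_uh_concl X xs (concl \<sigma>))"

definition Th_uH :: "('f, 'm) alg \<Rightarrow> 'm alter_ego \<Rightarrow> 'm uh_sentence set" where
  "Th_uH M E = {\<sigma>. wf_uh E \<sigma> \<and> sat_uh (ego_struct M) \<sigma>}"

text \<open>
  Logical consequence is evaluated in the (not necessarily Boolean) structures carried by a subset
  of \<open>'x\<close>; the topology of such a structure plays no role in \<open>is_pstruct\<close> and \<open>sat_uh\<close>.
\<close>

definition uH_basis :: "'x itself \<Rightarrow> ('f, 'm) alg \<Rightarrow> 'm alter_ego \<Rightarrow> 'm uh_sentence set \<Rightarrow> bool" where
  "uH_basis _ M E \<Sigma> \<longleftrightarrow> \<Sigma> \<subseteq> Th_uH M E \<and>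
     (\<forall>X :: ('m, 'x) pstruct. is_pstruct E X \<longrightarrow> (\<forall>\<sigma>\<in>\<Sigma>. sat_uh X \<sigma>) \<longrightarrow> (\<forall>\<sigma>\<in>Th_uH M E. sat_uh X \<sigma>))"

definition standard :: "'x itself \<Rightarrow> ('f, 'm) alg \<Rightarrow> 'm alter_ego \<Rightarrow> bool" where
  "standard _ M E \<longleftrightarrow>
     (\<forall>Y :: ('m, 'x) pstruct.
        in_IScP M E Y \<longleftrightarrow> boolean_struct E Y \<and> (\<forall>\<sigma>\<in>Th_uH M E. sat_uh Y \<sigma>))"

definition pure_prem :: "'m atomic \<Rightarrow> bool" where
  "pure_prem \<alpha> \<longleftrightarrow> (\<exists>r is. \<alpha> = Rel r (map Var is)) \<or> (\<exists>h is i. \<alpha> = Eq (App h (map Var is)) (Var i))"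

definition pure_concl :: "'m uh_concl \<Rightarrow> bool" where
  "pure_concl \<gamma> \<longleftrightarrow> (\<exists>r is. \<gamma> = At (Rel r (map Var is))) \<or>
     (\<exists>h is. \<gamma> = At (Eq (App h (map Var is)) (App h (map Var is)))) \<or>
     (\<exists>i j. \<gamma> = At (Eq (Var i) (Var j))) \<or> \<gamma> = Bot"

definition pure_uh :: "'m uh_sentence \<Rightarrow> bool" where
  "pure_uh \<sigma> \<longleftrightarrow> (\<forall>\<alpha>\<in>set (prem \<sigma>). pure_prem \<alpha>) \<and> pure_concl (concl \<sigma>)"

primrec trm_in_language :: "'m alter_ego \<Rightarrow> 'm trm \<Rightarrow> bool" where
  "trm_in_language E (Var i) \<longleftrightarrow> True"
| "trm_in_language E (App h ts) \<longleftrightarrow> h \<in> eops E \<and> list_all (trm_in_language E) ts"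

primrec atomic_in_language :: "'m alter_ego \<Rightarrow> 'm atomic \<Rightarrow> bool" where
  "atomic_in_language E (Eq s t) \<longleftrightarrow> trm_in_language E s \<and> trm_in_language E t"
| "atomic_in_language E (Rel r ts) \<longleftrightarrow> r \<in> erels E \<and> list_all (trm_in_language E) ts"

primrec concl_in_language :: "'m alter_ego \<Rightarrow> 'm uh_concl \<Rightarrow> bool" where
  "concl_in_language E Bot \<longleftrightarrow> True"
| "concl_in_language E (At \<alpha>) \<longleftrightarrow> atomic_in_language E \<alpha>"


section \<open>Enriched partial clone, definable relations, operational richness\<close>

definition proj_op :: "'m set \<Rightarrow> nat \<Rightarrow> nat \<Rightarrow> 'm partop" where
  "proj_op U n i = (\<lambda>as. if as \<in> tuples n U then Some (as ! i) else None)"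

definition comp_op :: "'m set \<Rightarrow> nat \<Rightarrow> 'm partop \<Rightarrow> 'm partop list \<Rightarrow> 'm partop" where
  "comp_op U k f gs = (\<lambda>as. if as \<in> tuples k U \<and> (\<forall>g\<in>set gs. as \<in> dom g)
     then f (map (\<lambda>g. the (g as)) gs) else None)"

text \<open>
  In \<open>comp\<close> the inner operations all have arity \<open>k\<close>; if there are none, \<open>f\<close> is nullary and the
  composite is the corresponding constant regarded as an operation of arbitrary arity \<open>k\<close>, as is the
  case for a constant term in \<open>k\<close> variables.
\<close>

inductive_set Clo_ep :: "('f, 'm) alg \<Rightarrow> 'm alter_ego \<Rightarrow> 'm partop set"
  for M :: "('f, 'm) alg" and E :: "'m alter_ego" where
  op: "h \<in> eops E \<Longrightarrow> h \<noteq> Map.empty \<Longrightarrow> h \<in> Clo_ep M E"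
| proj: "1 \<le> n \<Longrightarrow> i < n \<Longrightarrow> proj_op (carr M) n i \<in> Clo_ep M E"
| comp: "f \<in> Clo_ep M E \<Longrightarrow> \<forall>g\<in>set gs. g \<in> Clo_ep M E \<and> dom g \<subseteq> tuples k (carr M) \<Longrightarrow>
     comp_op (carr M) k f gs \<noteq> Map.empty \<Longrightarrow> comp_op (carr M) k f gs \<in> Clo_ep M E"

definition Rel_ca :: "('f, 'm) alg \<Rightarrow> 'm alter_ego \<Rightarrow> 'm frel set" where
  "Rel_ca M E = {r. r \<noteq> {} \<and> (\<exists>n \<Phi>. wf_ca E n \<Phi> \<and> r = defined_rel (ego_struct M) n \<Phi>)}"

definition op_rich_at :: "'f signature \<Rightarrow> ('f, 'm) alg \<Rightarrow> 'm alter_ego \<Rightarrow> 'm frel \<Rightarrow> bool" where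
  "op_rich_at sig M E r \<longleftrightarrow>
     (\<forall>n h. compatible_op sig M n h \<longrightarrow> dom h = r \<longrightarrow> (\<exists>f\<in>Clo_ep M E. h \<subseteq>\<^sub>m f))"


section \<open>The sentence \<open>\<phi>\<^sup>\<natural>\<close>\<close>

text \<open>
  The construction depends on chosen enumerations \<open>fs r\<close> of \<open>hom(r, M)\<close> and on chosen formulas
  \<open>\<beta>h r\<close>, in the variables \<open>v\<close> (numbered first) and \<open>w\<close>, defining the relation \<open>hat r (fs r)\<close>.
  If all hom-minimal relations lie in \<open>Rel_ca M E\<close>, such choices exist, see lemma \<open>hat_choice_exists\<close>.
\<close>

definition hat :: "'m frel \<Rightarrow> ('m list \<Rightarrow> 'm) list \<Rightarrow> 'm frel" where
  "hat r fs = {as @ map (\<lambda>f. f as) fs | as. as \<in> r}"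

definition hat_choice :: "'f signature \<Rightarrow> ('f, 'm) alg \<Rightarrow> 'm alter_ego \<Rightarrow>
    ('m frel \<Rightarrow> ('m list \<Rightarrow> 'm) list) \<Rightarrow> ('m frel \<Rightarrow> 'm ca_formula) \<Rightarrow> bool" where
  "hat_choice sig M E fs \<beta>h \<longleftrightarrow> (\<forall>n r. compatible_rel sig M n r \<longrightarrow>
     distinct (fs r) \<and> set (fs r) = alg_hom sig (rel_alg M n r) M \<and>
     wf_ca E (n + length (fs r)) (\<beta>h r) \<and>
     defined_rel (ego_struct M) (n + length (fs r)) (\<beta>h r) = hat r (fs r))"

primrec rename_trm :: "(nat \<Rightarrow> nat) \<Rightarrow> 'm trm \<Rightarrow> 'm trm" where
  "rename_trm \<theta> (Var i) = Var (\<theta> i)"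
| "rename_trm \<theta> (App h ts) = App h (map (rename_trm \<theta>) ts)"

primrec rename_atomic :: "(nat \<Rightarrow> nat) \<Rightarrow> 'm atomic \<Rightarrow> 'm atomic" where
  "rename_atomic \<theta> (Eq s t) = Eq (rename_trm \<theta> s) (rename_trm \<theta> t)"
| "rename_atomic \<theta> (Rel r ts) = Rel r (map (rename_trm \<theta>) ts)"

text \<open>Substitute the variables \<open>is\<close> for \<open>v\<close> and the variables \<open>off, off + 1, \<dots>\<close> for \<open>w\<close>.\<close>

definition inst_hat :: "('m frel \<Rightarrow> ('m list \<Rightarrow> 'm) list) \<Rightarrow> ('m frel \<Rightarrow> 'm ca_formula) \<Rightarrow>
    'm frel \<Rightarrow> nat list \<Rightarrow> nat \<Rightarrow> 'm ca_formula" where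
  "inst_hat fs \<beta>h r is off = map (rename_atomic ((!) (is @ [off..<off + length (fs r)]))) (\<beta>h r)"

fun var_index :: "'m trm \<Rightarrow> nat" where
  "var_index (Var i) = i"

text \<open>A pure premise conjunct expresses that some compatible relation holds of some variables.\<close>

fun prem_rel :: "'m atomic \<Rightarrow> 'm frel" where
  "prem_rel (Rel r ts) = r"
| "prem_rel (Eq (App h ts) t) = op_graph h"

fun prem_vars :: "'m atomic \<Rightarrow> nat list" where
  "prem_vars (Rel r ts) = map var_index ts"
| "prem_vars (Eq (App h ts) t) = map var_index ts @ [var_index t]"

fun natural_prem :: "('m frel \<Rightarrow> ('m list \<Rightarrow> 'm) list) \<Rightarrow> ('m frel \<Rightarrow> 'm ca_formula) \<Rightarrow>
    nat \<Rightarrow> 'm ca_formula \<Rightarrow> 'm ca_formula" where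
  "natural_prem fs \<beta>h off [] = []"
| "natural_prem fs \<beta>h off (\<alpha> # \<Phi>) = inst_hat fs \<beta>h (prem_rel \<alpha>) (prem_vars \<alpha>) off @
     natural_prem fs \<beta>h (off + length (fs (prem_rel \<alpha>))) \<Phi>"

text \<open>\<open>Ex m \<Psi>\<close> quantifies existentially over the last \<open>m\<close> variables of \<open>\<Psi>\<close>.\<close>

datatype 'm ex_concl = ExBot | Ex nat "'m ca_formula"

type_synonym 'm natural_sentence = "('m, 'm ex_concl) sentence"

text \<open>Here \<open>N\<close> is the number of universally quantified variables of the resulting sentence.\<close>

fun natural_concl :: "('m frel \<Rightarrow> ('m list \<Rightarrow> 'm) list) \<Rightarrow> ('m frel \<Rightarrow> 'm ca_formula) \<Rightarrow>
    nat \<Rightarrow> 'm uh_concl \<Rightarrow> 'm ex_concl" where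
  "natural_concl fs \<beta>h N Bot = ExBot"
| "natural_concl fs \<beta>h N (At (Rel r ts)) =
     Ex (length (fs r)) (inst_hat fs \<beta>h r (map var_index ts) N)"
| "natural_concl fs \<beta>h N (At (Eq (App h ts) t)) =
     Ex (length (fs (dom h))) (inst_hat fs \<beta>h (dom h) (map var_index ts) N)"
| "natural_concl fs \<beta>h N (At (Eq (Var i) t)) = Ex 0 [Eq (Var i) t]"

definition natural :: "('m frel \<Rightarrow> ('m list \<Rightarrow> 'm) list) \<Rightarrow> ('m frel \<Rightarrow> 'm ca_formula) \<Rightarrow>
    'm uh_sentence \<Rightarrow> 'm natural_sentence" where
  "natural fs \<beta>h \<phi> =
     (let N = nvars \<phi> + (\<Sum>\<alpha>\<leftarrow>prem \<phi>. length (fs (prem_rel \<alpha>)))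
      in \<lparr>nvars = N, prem = natural_prem fs \<beta>h (nvars \<phi>) (prem \<phi>), concl = natural_concl fs \<beta>h N (concl \<phi>)\<rparr>)"



section \<open>Index sets of powers, existence of the formulas \<open>\<beta>\<close>\<close>

lemma tuples_image:
  assumes "xs \<in> tuples n (k ` A)"
  obtains ys where "ys \<in> tuples n A" "xs = map k ys"
proof -
  have "\<forall>x\<in>set xs. \<exists>y\<in>A. x = k y" using assms by (auto simp: tuples_def)
  then obtain j where j: "\<And>x. x \<in> set xs \<Longrightarrow> j x \<in> A \<and> x = k (j x)" by metis
  show ?thesis
  proof
    show "map j xs \<in> tuples n A" using assms j by (auto simp: tuples_def)
    show "xs = map k (map j xs)" using j by (simp add: map_idI)
  qed
qed

lemma in_ISP_I:
  fixes S :: "'s set" and A :: "('f, 'a) alg" and M :: "('f, 'm) alg"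
  assumes A: "is_alg sig A" and B: "subuniverse sig (alg_power M S) B"
    and g: "alg_iso sig A (subalg (alg_power M S) B) g"
  shows "in_ISP sig M A"
proof -
  define p where "p = (\<lambda>s. \<lambda>a. g a s)"
  define S' where "S' = p ` S"
  define k where "k = (\<lambda>a. if a \<in> carr A then (\<lambda>q\<in>S'. q a) else undefined)"
  have gB: "g a \<in> B" if "a \<in> carr A" for a
    using g that by (auto simp: alg_iso_def alg_hom_def subalg_def)
  have gP: "g a \<in> S \<rightarrow>\<^sub>E carr M" if "a \<in> carr A" for a
    using gB[OF that] B by (auto simp: subuniverse_def alg_power_def)
  have ginj: "inj_on g (carr A)" using g by (auto simp: alg_iso_def bij_betw_def)
  have kp: "k a (p s) = g a s" if "a \<in> carr A" "s \<in> S" for a s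
    using that by (auto simp: k_def S'_def p_def)
  have kS': "k a \<in> S' \<rightarrow>\<^sub>E carr M" if "a \<in> carr A" for a
    using gP[OF that] that by (auto simp: k_def S'_def p_def)
  have kinj: "inj_on k (carr A)"
  proof (rule inj_onI)
    fix a b assume ab: "a \<in> carr A" "b \<in> carr A" "k a = k b"
    then have "g a s = g b s" if "s \<in> S" for s using kp that by metis
    then have "g a = g b" using gP ab by (metis PiE_ext)
    then show "a = b" using ginj ab by (auto dest: inj_onD)
  qed
  have khom: "k (fop A f as) = fop (alg_power M S') f (map k as)"
    if f: "sig f = Some n" "as \<in> tuples n (carr A)" for f n as
  proof (rule PiE_ext)
    have fa: "fop A f as \<in> carr A" using A f by (auto simp: is_alg_def)
    show "k (fop A f as) \<in> S' \<rightarrow>\<^sub>E UNIV" using kS'[OF fa] by (auto simp: PiE_def)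
    show "fop (alg_power M S') f (map k as) \<in> S' \<rightarrow>\<^sub>E UNIV" by (auto simp: alg_power_def)
    fix q assume "q \<in> S'"
    then obtain s where s: "s \<in> S" "q = p s" by (auto simp: S'_def)
    have "g (fop A f as) = fop (alg_power M S) f (map g as)"
      using g f by (auto simp: alg_iso_def alg_hom_def subalg_def)
    then have "g (fop A f as) s = fop M f (map (\<lambda>a. g a s) as)"
      using s by (simp add: alg_power_def comp_def)
    moreover have "map (\<lambda>a. k a q) as = map (\<lambda>a. g a s) as"
      using f s kp by (auto simp: tuples_def)
    moreover have "fop (alg_power M S') f (map k as) q = fop M f (map (\<lambda>a. k a q) as)"
      using \<open>q \<in> S'\<close> by (simp add: alg_power_def comp_def)
    ultimately show "k (fop A f as) q = fop (alg_power M S') f (map k as) q"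
      using s kp[OF fa] by metis
  qed
  have sub: "subuniverse sig (alg_power M S') (k ` carr A)"
    unfolding subuniverse_def
  proof (intro conjI allI impI)
    show "k ` carr A \<noteq> {}" using A by (auto simp: is_alg_def)
    show "k ` carr A \<subseteq> carr (alg_power M S')" using kS' by (auto simp: alg_power_def)
    fix f n as assume f: "sig f = Some n" "as \<in> tuples n (k ` carr A)"
    then obtain bs where "bs \<in> tuples n (carr A)" "as = map k bs" by (auto elim: tuples_image)
    then show "fop (alg_power M S') f as \<in> k ` carr A"
      using khom[OF f(1)] A f(1) by (metis image_eqI is_alg_def)
  qed
  have "alg_iso sig A (subalg (alg_power M S') (k ` carr A)) k"
    using khom kinj by (auto simp: alg_iso_def alg_hom_def subalg_def bij_betw_def k_def)
  with A sub show ?thesis unfolding in_ISP_def by blast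
qed

lemma in_IScP_I:
  fixes S :: "'s set" and X :: "('m, 'x) pstruct" and M :: "('f, 'm) alg"
  assumes X: "boolean_struct E X" and S: "S \<noteq> {}"
    and Y: "closed_under_ops E (struct_power (ego_struct M) S) Y"
    and g: "ziso E X (substruct (struct_power (ego_struct M) S) Y) g"
  shows "in_IScP M E X"
proof -
  define P where "P = struct_power (ego_struct M) S"
  define p where "p = (\<lambda>s. \<lambda>a. g a s)"
  define S' where "S' = p ` S"
  define P' where "P' = struct_power (ego_struct M) S'"
  define k where "k = (\<lambda>a. if a \<in> points X then (\<lambda>q\<in>S'. q a) else undefined)"
  define Y' where "Y' = k ` points X"
  have topP: "points P = S \<rightarrow>\<^sub>E carr M" and topP': "points P' = S' \<rightarrow>\<^sub>E carr M"
    by (simp_all add: P_def P'_def struct_power_def ego_struct_def)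
  have YP: "Y \<subseteq> points P" using Y by (simp add: closed_under_ops_def P_def)
  then have ptsY: "points (substruct P Y) = Y" by (auto simp: substruct_def)
  from g obtain j where gh: "g \<in> zhom E X (substruct P Y)" and jh: "j \<in> zhom E (substruct P Y) X"
    and jg: "\<And>x. x \<in> points X \<Longrightarrow> j (g x) = x" and gj: "\<And>y. y \<in> Y \<Longrightarrow> g (j y) = y"
    unfolding ziso_def P_def[symmetric] ptsY by blast
  have gY: "g a \<in> Y" if "a \<in> points X" for a
    using gh that by (auto simp: zhom_def ptsY)
  have jX: "j y \<in> points X" if "y \<in> Y" for y
    using jh that by (auto simp: zhom_def ptsY)
  have gP: "g a \<in> S \<rightarrow>\<^sub>E carr M" if "a \<in> points X" for a
    using gY[OF that] YP by (auto simp: topP)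
  have kp: "k a (p s) = g a s" if "a \<in> points X" "s \<in> S" for a s
    using that by (auto simp: k_def S'_def p_def)
  have kS': "k a \<in> S' \<rightarrow>\<^sub>E carr M" if "a \<in> points X" for a
    using gP[OF that] that by (auto simp: k_def S'_def p_def)
  have Y'P: "Y' \<subseteq> points P'" using kS' by (auto simp: Y'_def topP')
  then have ptsY': "points (substruct P' Y') = Y'" by (auto simp: substruct_def)
  have pre: "\<exists>ys. set ys \<subseteq> points X \<and> xs = map k ys" if "set xs \<subseteq> Y'" for xs
  proof -
    have "xs \<in> tuples (length xs) (k ` points X)" using that by (simp add: Y'_def tuples_def)
    then obtain ys where "ys \<in> tuples (length xs) (points X)" "xs = map k ys" by (rule tuples_image)
    then show ?thesis unfolding tuples_def by blast
  qed
  have kmap: "map (\<lambda>x. x (p s)) (map k ys) = map (\<lambda>x. x s) (map g ys)"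
    if "set ys \<subseteq> points X" "s \<in> S" for ys s using that kp by auto
  have kall: "(\<forall>q\<in>S'. Q (map (\<lambda>x. x q) (map k ys))) \<longleftrightarrow> (\<forall>s\<in>S. Q (map (\<lambda>x. x s) (map g ys)))"
    if "set ys \<subseteq> points X" for Q ys
  proof -
    have "(\<forall>q\<in>S'. Q (map (\<lambda>x. x q) (map k ys))) \<longleftrightarrow> (\<forall>s\<in>S. Q (map (\<lambda>x. x (p s)) (map k ys)))"
      by (simp only: S'_def ball_simps)
    also have "\<dots> \<longleftrightarrow> (\<forall>s\<in>S. Q (map (\<lambda>x. x s) (map g ys)))"
      by (rule ball_cong[OF refl]) (simp only: kmap[OF that])
    finally show ?thesis .
  qed
  have jmap: "map j (map g ys) = ys" if "set ys \<subseteq> points X" for ys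
    using that jg by (simp add: subset_iff map_idI)
  have gmapP: "set (map g ys) \<subseteq> Y" "set (map g ys) \<subseteq> (S \<rightarrow>\<^sub>E carr M)"
    "set (map k ys) \<subseteq> (S' \<rightarrow>\<^sub>E carr M)" "set (map k ys) \<subseteq> Y'"
    if "set ys \<subseteq> points X" for ys
    unfolding Y'_def set_map image_subset_iff
    using subsetD[OF that] gY gP kS' by (simp_all del: PiE_iff)
  have contp: "continuous_map (ptop X) (discrete_topology (carr M)) (p s)" if s: "s \<in> S" for s
  proof -
    have "continuous_map (ptop X) (ptop P) g"
      using gh by (auto simp: zhom_def substruct_def continuous_map_in_subtopology)
    then show ?thesis using s
      by (auto simp: P_def struct_power_def ego_struct_def continuous_map_componentwise p_def)
  qed
  have contk: "continuous_map (ptop X) (ptop P') k"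
  proof -
    have "continuous_map (ptop X) (discrete_topology (carr M)) (\<lambda>x. k x q)" if "q \<in> S'" for q
    proof -
      obtain s where s: "s \<in> S" "q = p s" using \<open>q \<in> S'\<close> by (auto simp: S'_def)
      show ?thesis
        by (rule continuous_map_eq[OF contp[OF s(1)]]) (use s kp in \<open>auto simp: p_def\<close>)
    qed
    then show ?thesis
      using kS' by (auto simp: P'_def struct_power_def ego_struct_def continuous_map_componentwise PiE_def)
  qed
  have Hd: "Hausdorff_space (ptop P')"
    by (simp add: P'_def struct_power_def ego_struct_def Hausdorff_space_product_topology)
  have "compactin (ptop P') Y'"
    using X contk by (auto simp: Y'_def boolean_struct_def compact_space_def image_compactin)
  then have closed: "closedin (ptop P') Y'" using Hd by (simp add: compactin_imp_closedin)
  have fun_iff: "pfun P' h (map k ys) = Some b \<Longrightarrow> h \<in> eops E \<Longrightarrow>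
      \<exists>x\<in>points X. pfun X h ys = Some x \<and> b = k x" if ys: "set ys \<subseteq> points X" for h ys b
  proof -
    assume b: "pfun P' h (map k ys) = Some b" and h: "h \<in> eops E"
    have d': "\<forall>q\<in>S'. map (\<lambda>x. x q) (map k ys) \<in> dom h"
      and b': "b = (\<lambda>q\<in>S'. the (h (map (\<lambda>x. x q) (map k ys))))"
      using b by (auto simp: P'_def struct_power_def ego_struct_def split: if_splits)
    have d: "\<forall>s\<in>S. map (\<lambda>x. x s) (map g ys) \<in> dom h"
      using d' by (rule kall[OF ys, of "\<lambda>z. z \<in> dom h", THEN iffD1])
    define b0 where "b0 = (\<lambda>s\<in>S. the (h (map (\<lambda>x. x s) (map g ys))))"
    have b0: "pfun P h (map g ys) = Some b0"
      unfolding P_def struct_power_def ego_struct_def b0_def using d gmapP[OF ys] by simp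
    then have b0Y: "b0 \<in> Y" using Y h gmapP(1)[OF ys] unfolding closed_under_ops_def P_def by blast
    have "pfun (substruct P Y) h (map g ys) = Some b0"
      using b0 gmapP(1)[OF ys] by (simp add: substruct_def)
    then have "pfun X h (map j (map g ys)) = Some (j b0)"
      using jh h unfolding zhom_def by blast
    then have "pfun X h ys = Some (j b0)" using jmap[OF ys] by simp
    moreover have "b = k (j b0)"
    proof (rule PiE_ext)
      show "b \<in> S' \<rightarrow>\<^sub>E UNIV" by (simp add: b')
      show "k (j b0) \<in> S' \<rightarrow>\<^sub>E UNIV" using kS'[OF jX[OF b0Y]] by (auto simp: PiE_def)
      fix q assume "q \<in> S'"
      then obtain s where s: "s \<in> S" "q = p s" by (auto simp: S'_def)
      have "b q = the (h (map (\<lambda>x. x (p s)) (map k ys)))" using \<open>q \<in> S'\<close> s by (simp add: b')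
      also have "\<dots> = b0 s" unfolding kmap[OF ys s(1)] using s by (simp add: b0_def)
      also have "b0 s = k (j b0) q" using s kp[OF jX[OF b0Y] s(1)] gj[OF b0Y] by simp
      finally show "b q = k (j b0) q" .
    qed
    ultimately show ?thesis using jX[OF b0Y] by blast
  qed
  have cl: "closed_under_ops E P' Y'"
    unfolding closed_under_ops_def
  proof (intro conjI ballI allI impI)
    show "Y' \<subseteq> points P'" by (rule Y'P)
    fix h xs b assume "h \<in> eops E" "set xs \<subseteq> Y'" "pfun P' h xs = Some b"
    then show "b \<in> Y'" using pre fun_iff unfolding Y'_def by blast
  qed
  have X': "is_pstruct E X" using X by (simp add: boolean_struct_def)
  have kh: "k \<in> zhom E X (substruct P' Y')"
    unfolding zhom_def mem_Collect_eq ptsY'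
  proof (intro conjI ballI allI impI)
    show "k \<in> points X \<rightarrow>\<^sub>E Y'" by (auto simp: Y'_def k_def)
    show "continuous_map (ptop X) (ptop (substruct P' Y')) k"
      using contk by (auto simp: substruct_def continuous_map_in_subtopology Y'_def)
  next
    fix r xs assume r: "r \<in> erels E" "xs \<in> prel X r"
    then have xs: "set xs \<subseteq> points X" using X' unfolding is_pstruct_def tuples_def by blast
    have "map g xs \<in> prel (substruct P Y) r" using gh r by (auto simp: zhom_def)
    then have "\<forall>s\<in>S. map (\<lambda>x. x s) (map g xs) \<in> r"
      by (auto simp: substruct_def P_def struct_power_def ego_struct_def)
    then have "\<forall>q\<in>S'. map (\<lambda>x. x q) (map k xs) \<in> r"
      by (rule kall[OF xs, of "\<lambda>z. z \<in> r", THEN iffD2])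
    then show "map k xs \<in> prel (substruct P' Y') r"
      unfolding substruct_def P'_def struct_power_def ego_struct_def using gmapP[OF xs] by simp
  next
    fix h xs b assume h: "h \<in> eops E" "pfun X h xs = Some b"
    then have xs: "set xs \<subseteq> points X" and bX: "b \<in> points X"
      using X' unfolding is_pstruct_def tuples_def dom_def ran_def by blast+
    have "pfun (substruct P Y) h (map g xs) = Some (g b)" using gh h by (auto simp: zhom_def)
    then have "pfun P h (map g xs) = Some (g b)" by (simp add: substruct_def split: if_splits)
    then have "\<forall>s\<in>S. map (\<lambda>x. x s) (map g xs) \<in> dom h"
      by (auto simp: P_def struct_power_def ego_struct_def split: if_splits)
    then have "\<forall>q\<in>S'. map (\<lambda>x. x q) (map k xs) \<in> dom h"
      by (rule kall[OF xs, of "\<lambda>z. z \<in> dom h", THEN iffD2])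
    then obtain b' where b': "pfun P' h (map k xs) = Some b'"
      unfolding P'_def struct_power_def ego_struct_def using gmapP(3)[OF xs] by simp
    then have "b' = k b" using fun_iff[OF xs b' h(1)] h(2) by auto
    then show "pfun (substruct P' Y') h (map k xs) = Some (k b)"
      using b' gmapP(4)[OF xs] by (simp add: substruct_def)
  qed
  define k' where "k' = (\<lambda>y\<in>Y'. j (\<lambda>s\<in>S. y (p s)))"
  have bk: "(\<lambda>s\<in>S. k x (p s)) = g x" if "x \<in> points X" for x
    using kp[OF that] gP[OF that] by (auto simp: fun_eq_iff PiE_def extensional_def)
  have k'k: "k' (k x) = x" if "x \<in> points X" for x
    using that bk[OF that] jg[OF that] by (simp add: k'_def Y'_def)
  have k'map: "map k' (map k xs) = xs" if "set xs \<subseteq> points X" for xs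
    using that k'k by (simp add: subset_iff map_idI)
  have contk': "continuous_map (subtopology (ptop P') Y') (ptop X) k'"
  proof -
    have 1: "continuous_map (subtopology (ptop P') Y') (subtopology (ptop P) Y) (\<lambda>y. \<lambda>s\<in>S. y (p s))"
      unfolding continuous_map_in_subtopology
    proof (intro conjI)
      have "continuous_map (subtopology (ptop P') Y') (discrete_topology (carr M)) (\<lambda>y. y (p s))"
        if "s \<in> S" for s
        unfolding P'_def struct_power_def ego_struct_def pstruct.simps
        by (rule continuous_map_from_subtopology, rule continuous_map_product_projection)
          (use that in \<open>auto simp: S'_def\<close>)
      then show "continuous_map (subtopology (ptop P') Y') (ptop P) (\<lambda>y. \<lambda>s\<in>S. y (p s))"
        by (auto simp: P_def struct_power_def ego_struct_def continuous_map_componentwise cong: restrict_cong)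
      show "(\<lambda>y. \<lambda>s\<in>S. y (p s)) \<in> topspace (subtopology (ptop P') Y') \<rightarrow> Y"
        using bk gY by (auto simp: Y'_def)
    qed
    have 2: "continuous_map (subtopology (ptop P) Y) (ptop X) j"
      using jh by (auto simp: zhom_def substruct_def)
    show ?thesis
      by (rule continuous_map_eq[OF continuous_map_compose[OF 1 2]]) (auto simp: k'_def)
  qed
  have kh': "k' \<in> zhom E (substruct P' Y') X"
    unfolding zhom_def mem_Collect_eq ptsY'
  proof (intro conjI ballI allI impI)
    show "k' \<in> Y' \<rightarrow>\<^sub>E points X" using k'k by (auto simp: Y'_def k'_def)
    show "continuous_map (ptop (substruct P' Y')) (ptop X) k'"
      using contk' by (simp add: substruct_def)
  next
    fix r xs assume r: "r \<in> erels E" "xs \<in> prel (substruct P' Y') r"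
    then obtain ys where ys: "set ys \<subseteq> points X" "xs = map k ys"
      using pre by (auto simp: substruct_def)
    have "\<forall>q\<in>S'. map (\<lambda>x. x q) (map k ys) \<in> r"
      using r ys by (auto simp: substruct_def P'_def struct_power_def ego_struct_def)
    then have "\<forall>s\<in>S. map (\<lambda>x. x s) (map g ys) \<in> r"
      by (rule kall[OF ys(1), of "\<lambda>z. z \<in> r", THEN iffD1])
    then have "map g ys \<in> prel (substruct P Y) r"
      unfolding substruct_def P_def struct_power_def ego_struct_def using gmapP[OF ys(1)] by simp
    then have "map j (map g ys) \<in> prel X r" using jh r by (auto simp only: zhom_def)
    then show "map k' xs \<in> prel X r" using jmap k'map ys by metis
  next
    fix h xs b assume h: "h \<in> eops E" "pfun (substruct P' Y') h xs = Some b"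
    then obtain ys where ys: "set ys \<subseteq> points X" "xs = map k ys"
      using pre by (auto simp: substruct_def split: if_splits)
    have "pfun P' h (map k ys) = Some b" using h ys by (simp add: substruct_def split: if_splits)
    then obtain x where "x \<in> points X" "pfun X h ys = Some x" "b = k x"
      using fun_iff[OF ys(1)] h(1) by blast
    then show "pfun X h (map k' xs) = Some (k' b)" using k'map k'k ys by metis
  qed
  have "ziso E X (substruct P' Y') k"
    unfolding ziso_def ptsY' using kh
  proof (intro conjI bexI[OF _ kh'] ballI)
    show "k' (k x) = x" if "x \<in> points X" for x using that by (rule k'k)
    show "k (k' y) = y" if "y \<in> Y'" for y using that k'k by (auto simp: Y'_def)
  qed
  moreover have "S' \<noteq> {}" using S by (simp add: S'_def)
  ultimately show ?thesis
    using X closed cl unfolding in_IScP_def P'_def by blast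
qed

lemma hat_choice_exists:
  fixes M :: "('f, 'm) alg"
  assumes M: "is_alg sig M" "finite (carr M)"
    and hm: "\<forall>n r. hom_minimal sig M n r \<longrightarrow> r \<in> Rel_ca M E"
  shows "\<exists>fs \<beta>h. hat_choice sig M E fs \<beta>h"
proof -
  have len: "length as = n" if "compatible_rel sig M n r" "as \<in> r" for n r as
    using that unfolding compatible_rel_def subuniverse_def tuple_power_def tuples_def by auto
  have "\<exists>F \<Phi>. \<forall>n. compatible_rel sig M n r \<longrightarrow>
     distinct F \<and> set F = alg_hom sig (rel_alg M n r) M \<and> wf_ca E (n + length F) \<Phi> \<and>
     defined_rel (ego_struct M) (n + length F) \<Phi> = hat r F" for r :: "'m frel"
  proof (cases "\<exists>n. compatible_rel sig M n r")
    case True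
    then obtain n where n: "compatible_rel sig M n r" by blast
    then have r: "r \<noteq> {}" "r \<subseteq> tuples n (carr M)"
      by (auto simp: compatible_rel_def subuniverse_def tuple_power_def)
    have uniq: "n' = n" if "compatible_rel sig M n' r" for n'
      using len[OF n] len[OF that] r(1) by (metis all_not_in_conv)
    have "finite (tuples n (carr M))"
      using finite_lists_length_eq[OF M(2), of n] by (simp add: tuples_def conj_commute)
    then have "finite r" using r(2) finite_subset by blast
    then have "finite (r \<rightarrow>\<^sub>E carr M)" using M(2) by (simp add: finite_PiE)
    moreover have "alg_hom sig (rel_alg M n r) M \<subseteq> r \<rightarrow>\<^sub>E carr M"
      by (auto simp: alg_hom_def rel_alg_def subalg_def)
    ultimately have "finite (alg_hom sig (rel_alg M n r) M)" using finite_subset by blast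
    then obtain F where F: "set F = alg_hom sig (rel_alg M n r) M" "distinct F"
      using finite_distinct_list by blast
    define e where "e = (\<lambda>as. as @ map (\<lambda>f. f as) F)"
    have hat: "hat r F = e ` r" by (auto simp: hat_def e_def)
    have e1: "e as ! i = as ! i" if "as \<in> r" "i < n" for as i
      using len[OF n] that by (simp add: e_def nth_append)
    have e2: "e as ! (n + i) = (F ! i) as" if "as \<in> r" "i < length F" for as i
      using len[OF n] that by (simp add: e_def nth_append)
    have etup: "e as \<in> tuples (n + length F) (carr M)" if as: "as \<in> r" for as
    proof -
      have "f as \<in> carr M" if "f \<in> set F" for f
        using that as unfolding F alg_hom_def rel_alg_def subalg_def by auto
      then show ?thesis using r(2) as by (auto simp: e_def tuples_def)
    qed
    have eop: "e (fop (tuple_power M n) g ys) = fop (tuple_power M (n + length F)) g (map e ys)"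
      and rop: "fop (tuple_power M n) g ys \<in> r"
      if g: "sig g = Some q" "ys \<in> tuples q r" for g q ys
    proof -
      show y: "fop (tuple_power M n) g ys \<in> r"
        using n g by (auto simp: compatible_rel_def subuniverse_def)
      have ysr: "set ys \<subseteq> r" using g by (simp add: tuples_def)
      show "e (fop (tuple_power M n) g ys) = fop (tuple_power M (n + length F)) g (map e ys)"
      proof (rule nth_equalityI)
        show "length (e (fop (tuple_power M n) g ys)) = length (fop (tuple_power M (n + length F)) g (map e ys))"
          using etup[OF y] by (simp add: tuples_def tuple_power_def)
        fix i assume "i < length (e (fop (tuple_power M n) g ys))"
        then have i: "i < n + length F" using etup[OF y] by (simp add: tuples_def)
        have R: "fop (tuple_power M (n + length F)) g (map e ys) ! i = fop M g (map (\<lambda>x. e x ! i) ys)"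
          using i by (simp add: tuple_power_def comp_def)
        show "e (fop (tuple_power M n) g ys) ! i = fop (tuple_power M (n + length F)) g (map e ys) ! i"
        proof (cases "i < n")
          case True
          have "map (\<lambda>x. e x ! i) ys = map (\<lambda>x. x ! i) ys" using ysr e1 True by (auto simp: subset_iff)
          moreover have "fop (tuple_power M n) g ys ! i = fop M g (map (\<lambda>x. x ! i) ys)"
            using True by (simp add: tuple_power_def)
          ultimately show ?thesis using e1[OF y True] R by metis
        next
          case False
          define l where "l = i - n"
          have l: "i = n + l" "l < length F" using False i by (auto simp: l_def)
          have "map (\<lambda>x. e x ! i) ys = map (F ! l) ys" using ysr e2 l by (auto simp: subset_iff)
          moreover have "(F ! l) (fop (tuple_power M n) g ys) = fop M g (map (F ! l) ys)"
          proof -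
            have "F ! l \<in> alg_hom sig (rel_alg M n r) M" using l F(1) nth_mem by blast
            then show ?thesis using g by (auto simp: alg_hom_def rel_alg_def subalg_def)
          qed
          ultimately show ?thesis using e2[OF y l(2)] R l(1) by metis
        qed
      qed
    qed
    have comp: "compatible_rel sig M (n + length F) (hat r F)"
      unfolding compatible_rel_def subuniverse_def
    proof (intro conjI allI impI)
      show "hat r F \<noteq> {}" using r(1) by (simp add: hat)
      show "hat r F \<subseteq> carr (tuple_power M (n + length F))"
        using etup by (auto simp: hat tuple_power_def)
      fix g q xs assume g: "sig g = Some q" "xs \<in> tuples q (hat r F)"
      then obtain ys where ys: "ys \<in> tuples q r" "xs = map e ys"
        unfolding hat by (blast elim: tuples_image)
      show "fop (tuple_power M (n + length F)) g xs \<in> hat r F"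
        using eop[OF g(1) ys(1)] rop[OF g(1) ys(1)] ys(2) unfolding hat by (metis image_eqI)
    qed
    have "hom_minimal sig M (n + length F) (hat r F)"
      unfolding hom_minimal_def
    proof (intro conjI ballI)
      show "compatible_rel sig M (n + length F) (hat r F)" by (rule comp)
      fix g assume g: "g \<in> alg_hom sig (rel_alg M (n + length F) (hat r F)) M"
      define f where "f = (\<lambda>a\<in>r. g (e a))"
      have "f \<in> alg_hom sig (rel_alg M n r) M"
        unfolding alg_hom_def mem_Collect_eq
      proof (intro conjI allI impI)
        show "f \<in> carr (rel_alg M n r) \<rightarrow>\<^sub>E carr M"
          using g by (auto simp: f_def alg_hom_def rel_alg_def subalg_def hat)
        fix s q ys assume "sig s = Some q" "ys \<in> tuples q (carr (rel_alg M n r))"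
        then have s: "sig s = Some q" "ys \<in> tuples q r" by (auto simp: rel_alg_def subalg_def)
        then have ysr: "set ys \<subseteq> r" by (simp add: tuples_def)
        have "map e ys \<in> tuples q (hat r F)" using s(2) by (auto simp: tuples_def hat)
        then have "g (fop (tuple_power M (n + length F)) s (map e ys)) = fop M s (map g (map e ys))"
          using g s(1) by (auto simp: alg_hom_def rel_alg_def subalg_def)
        moreover have "map g (map e ys) = map f ys" using ysr by (auto simp: f_def subset_iff)
        moreover have "f (fop (tuple_power M n) s ys) = g (e (fop (tuple_power M n) s ys))"
          using rop[OF s] by (simp add: f_def)
        ultimately have "f (fop (tuple_power M n) s ys) = fop M s (map f ys)"
          using eop[OF s] by metis
        then show "f (fop (rel_alg M n r) s ys) = fop M s (map f ys)"
          by (simp add: rel_alg_def subalg_def)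
      qed
      then obtain i where i: "i < length F" "F ! i = f" unfolding F(1)[symmetric] by (metis in_set_conv_nth)
      have "g as = as ! (n + i)" if "as \<in> hat r F" for as
        using that e2 i by (auto simp: hat f_def)
      then show "\<exists>i<n + length F. \<forall>as\<in>hat r F. g as = as ! i"
        using i(1) by (intro exI[of _ "n + i"]) auto
    qed
    then have "hat r F \<in> Rel_ca M E" using hm by blast
    then obtain k \<Phi> where \<Phi>: "wf_ca E k \<Phi>" "hat r F = defined_rel (ego_struct M) k \<Phi>"
      unfolding Rel_ca_def by blast
    obtain as where as: "as \<in> r" using r(1) by blast
    then have "length (e as) = k" using \<Phi>(2) by (auto simp: hat defined_rel_def tuples_def)
    then have "k = n + length F" using etup[OF as] by (simp add: tuples_def)
    then show ?thesis using F \<Phi> uniq by metis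
  qed blast
  then show ?thesis unfolding hat_choice_def by metis
qed

end

theory Submission
  imports Defs
begin

text \<open>
  Let \<open>X\<close> be a Boolean model of the universal Horn theory of \<open>M2\<close>. Interpret every symbol of \<open>M1\<close> in
  \<open>X\<close> by the corresponding formula \<open>\<beta>\<close>; this gives a structure \<open>flat X\<close> on the same space, and
  compactness makes its relations and operations closed. Operational richness turns the existential
  witnesses in \<open>\<beta>\<close> into terms, so each axiom of \<open>M1\<close>, read in \<open>flat X\<close>, becomes a consequence of
  uH-sentences of \<open>M2\<close>. Hence full duality for \<open>M1\<close> applies to \<open>flat X\<close>.

  If \<open>M1\<close> dualises at the finite level, then a hom-minimal relation is defined in \<open>M1\<close> by pure
  atomic formulas and equations of variables; these formulas transfer between \<open>X\<close> and \<open>flat X\<close>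
  because all homomorphisms on a hom-minimal relation are projections. Consequently \<open>X\<close> and \<open>flat X\<close>
  have the same morphisms into \<open>M\<close>, the same dual algebra and the same evaluation map, and the
  morphisms \<open>X \<rightarrow> M\<close> also reflect the structure of \<open>X\<close>.
\<close>

text \<open>The obstacle is that a conclusion \<open>r(v)\<close> of an axiom for \<open>M1\<close>
  turns into an existential formula, while universal Horn sentences have no existential conclusions.
  Every witness must therefore be given by a term of \<open>M2\<close> that is correct on the whole
  relation defined by the premise. Such a term comes from richness at the relation in the
  conclusion, by renaming variables, or from richness at the premise relation itself. Existential
  quantifiers in premises are harmless, as they become universal ones. Purity makes the substitution
  of \<open>\<beta>\<close> possible: every premise conjunct is one compatible relation at
  variables. Passing from \<open>r\<close> to \<open>hat r\<close> adds all homomorphisms on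
  \<open>r\<close> as coordinates. A homomorphism on \<open>hat r\<close> is then one of the
  coordinates, so on this enlarged relation plain variables serve as witnesses. This is how facts of
  \<open>M1\<close> about \<open>hat r\<close> reach \<open>flat X\<close>. Only finitely many
  tuples over \<open>M\<close> lie outside \<open>hat r\<close>, so finitely many facts of
  \<open>M1\<close> cut it out, however large its language is.\<close>

lemma tuplesI: "length as = n \<Longrightarrow> set as \<subseteq> A \<Longrightarrow> as \<in> tuples n A"
  by (simp add: tuples_def)

lemma tuples_length: "as \<in> tuples n A \<Longrightarrow> length as = n"
  by (simp add: tuples_def)

lemma tuples_nth: "as \<in> tuples n A \<Longrightarrow> i < n \<Longrightarrow> as ! i \<in> A"
  by (auto simp: tuples_def)

lemma tuples_append: "as @ bs \<in> tuples (n + m) A" if "as \<in> tuples n A" "bs \<in> tuples m A"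
  using that by (auto simp: tuples_def)

lemma tuples_map_nth: "map ((!) as) js \<in> tuples (length js) A" if "as \<in> tuples n A" "set js \<subseteq> {..<n}"
  using that by (auto simp: tuples_def subset_iff)

lemma finite_tuples: "finite A \<Longrightarrow> finite (tuples n A)"
  using finite_lists_length_eq[of A n] by (simp add: tuples_def conj_commute)

lemma map_nth_append_left: "map ((!) (xs @ ys)) js = map ((!) xs) js" if "set js \<subseteq> {..<length xs}"
  using that by (auto simp: subset_iff nth_append)

section \<open>Compatible relations and homomorphisms on them\<close>

text \<open>Extensionality is left out on purpose: coordinate functions and composites then qualify
  as they stand, and \<open>restrict\<close> enters only where membership in \<open>alg_hom\<close>
  is wanted.\<close>

definition hom_on :: "'f signature \<Rightarrow> ('f, 'm) alg \<Rightarrow> nat \<Rightarrow> 'm frel \<Rightarrow> ('m list \<Rightarrow> 'm) \<Rightarrow> bool" where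
  "hom_on sig M n r g \<longleftrightarrow> g ` r \<subseteq> carr M \<and> (\<forall>f q xs. sig f = Some q \<longrightarrow> xs \<in> tuples q r \<longrightarrow>
     g (fop (tuple_power M n) f xs) = fop M f (map g xs))"

lemma alg_hom_rel_alg:
  "g \<in> alg_hom sig (rel_alg M n r) M \<longleftrightarrow> g \<in> extensional r \<and> hom_on sig M n r g"
  by (auto simp: alg_hom_def rel_alg_def subalg_def hom_on_def PiE_def)

lemma compatible_relD:
  assumes "compatible_rel sig M n r"
  shows "r \<noteq> {}" "r \<subseteq> tuples n (carr M)"
    "sig f = Some q \<Longrightarrow> xs \<in> tuples q r \<Longrightarrow> fop (tuple_power M n) f xs \<in> r"
  using assms by (auto simp: compatible_rel_def subuniverse_def tuple_power_def)

lemma rel_arity_eq: "rel_arity r = n" if "r \<noteq> {}" "r \<subseteq> tuples n A"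
  unfolding rel_arity_def using that by (intro the_equality) (auto simp: tuples_def subset_iff)

lemma compatible_rel_arity: "compatible_rel sig M n r \<Longrightarrow> rel_arity r = n"
  using rel_arity_eq compatible_relD(1,2) by metis

lemma hom_on_cong: "hom_on sig M n r g \<longleftrightarrow> hom_on sig M n r g'"
  if r: "compatible_rel sig M n r" and eq: "\<And>as. as \<in> r \<Longrightarrow> g as = g' as"
proof -
  have "map g xs = map g' xs" if "xs \<in> tuples q r" for xs q
    using that eq by (auto simp: tuples_def)
  moreover have "g ` r = g' ` r" using eq by auto
  ultimately show ?thesis
    using eq compatible_relD(3)[OF r] unfolding hom_on_def by metis
qed

lemma restrict_alg_hom: "restrict g r \<in> alg_hom sig (rel_alg M n r) M"
  if "compatible_rel sig M n r" "hom_on sig M n r g"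
  using that hom_on_cong[of sig M n r g "restrict g r"] by (simp add: alg_hom_rel_alg)

lemma hom_on_nth: "hom_on sig M n r (\<lambda>as. as ! i)" if "compatible_rel sig M n r" "i < n"
  using that compatible_relD(2)[OF that(1)]
  by (auto simp: hom_on_def tuple_power_def dest: tuples_nth)

text \<open>A family of homomorphisms into \<open>M\<close> is one homomorphism into a power; both
  \<open>hom_on_comp\<close> and \<open>compatible_image\<close> rest on this computation.\<close>

lemma tuple_power_map:
  assumes e: "\<And>i. i < k \<Longrightarrow> hom_on sig M N p (e i)" and f: "sig f = Some q" "xs \<in> tuples q p"
  shows "map (\<lambda>i. e i (fop (tuple_power M N) f xs)) [0..<k] =
    fop (tuple_power M k) f (map (\<lambda>a. map (\<lambda>i. e i a) [0..<k]) xs)"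
proof (rule nth_equalityI)
  fix i assume "i < length (map (\<lambda>i. e i (fop (tuple_power M N) f xs)) [0..<k])"
  then have i: "i < k" by simp
  then have "e i (fop (tuple_power M N) f xs) = fop M f (map (e i) xs)"
    using e f by (simp add: hom_on_def)
  moreover have "map (\<lambda>x. map (\<lambda>i. e i x) [0..<k] ! i) xs = map (e i) xs"
    using i by simp
  ultimately show "map (\<lambda>i. e i (fop (tuple_power M N) f xs)) [0..<k] ! i =
      fop (tuple_power M k) f (map (\<lambda>a. map (\<lambda>i. e i a) [0..<k]) xs) ! i"
    using i by (simp add: tuple_power_def comp_def)
qed (simp add: tuple_power_def)

lemma hom_on_comp:
  assumes e: "\<And>i. i < k \<Longrightarrow> hom_on sig M N p (e i)"
    and s: "\<And>a. a \<in> p \<Longrightarrow> map (\<lambda>i. e i a) [0..<k] \<in> s" and g: "hom_on sig M k s g"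
  shows "hom_on sig M N p (\<lambda>a. g (map (\<lambda>i. e i a) [0..<k]))"
  unfolding hom_on_def
proof (intro conjI allI impI)
  show "(\<lambda>a. g (map (\<lambda>i. e i a) [0..<k])) ` p \<subseteq> carr M" using s g by (auto simp: hom_on_def)
  fix f q xs assume f: "sig f = Some q" "xs \<in> tuples q p"
  have "map (\<lambda>a. map (\<lambda>i. e i a) [0..<k]) xs \<in> tuples q s"
    using f(2) s by (auto simp: tuples_def)
  then have "g (fop (tuple_power M k) f (map (\<lambda>a. map (\<lambda>i. e i a) [0..<k]) xs)) =
      fop M f (map g (map (\<lambda>a. map (\<lambda>i. e i a) [0..<k]) xs))"
    using g f(1) by (simp add: hom_on_def)
  moreover have "map (\<lambda>i. e i (fop (tuple_power M N) f xs)) [0..<k] =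
      fop (tuple_power M k) f (map (\<lambda>a. map (\<lambda>i. e i a) [0..<k]) xs)"
    by (rule tuple_power_map[OF e f])
  ultimately show "g (map (\<lambda>i. e i (fop (tuple_power M N) f xs)) [0..<k]) =
      fop M f (map (\<lambda>a. g (map (\<lambda>i. e i a) [0..<k])) xs)"
    by (simp add: comp_def)
qed

text \<open>Used for the two images that occur below: the graph of a homomorphism, and the domain of
  an operation as a projection of its graph.\<close>

lemma compatible_image:
  assumes p: "compatible_rel sig M N p" and e: "\<And>i. i < k \<Longrightarrow> hom_on sig M N p (e i)"
  shows "compatible_rel sig M k ((\<lambda>a. map (\<lambda>i. e i a) [0..<k]) ` p)"
  unfolding compatible_rel_def subuniverse_def
proof (intro conjI allI impI)
  show "(\<lambda>a. map (\<lambda>i. e i a) [0..<k]) ` p \<noteq> {}" using compatible_relD(1)[OF p] by simp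
  show "(\<lambda>a. map (\<lambda>i. e i a) [0..<k]) ` p \<subseteq> carr (tuple_power M k)"
  proof -
    have "e i a \<in> carr M" if "i < k" "a \<in> p" for i a using e[OF that(1)] that(2) by (auto simp: hom_on_def)
    then show ?thesis by (auto simp: tuple_power_def tuples_def)
  qed
  fix f q xs assume f: "sig f = Some q" "xs \<in> tuples q ((\<lambda>a. map (\<lambda>i. e i a) [0..<k]) ` p)"
  then obtain ys where ys: "ys \<in> tuples q p" "xs = map (\<lambda>a. map (\<lambda>i. e i a) [0..<k]) ys"
    by (blast elim: tuples_image)
  show "fop (tuple_power M k) f xs \<in> (\<lambda>a. map (\<lambda>i. e i a) [0..<k]) ` p"
  proof -
    have "map (\<lambda>i. e i (fop (tuple_power M N) f ys)) [0..<k] = fop (tuple_power M k) f xs"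
      unfolding ys(2) by (rule tuple_power_map[OF e f(1) ys(1)])
    then show ?thesis by (rule image_eqI[OF sym compatible_relD(3)[OF p f(1) ys(1)]])
  qed
qed

lemma compatible_op_of_hom:
  assumes p: "compatible_rel sig M N p" and g: "hom_on sig M N p g"
  shows "compatible_op sig M N (\<lambda>a. if a \<in> p then Some (g a) else None)"
proof -
  \<comment> \<open>The graph is the image of \<open>p\<close> under its \<open>N\<close> coordinate
    functions followed by \<open>g\<close> as the last component.\<close>
  define e where "e = (\<lambda>i a. if i < N then a ! i else g a)"
  have e: "hom_on sig M N p (e i)" if "i < Suc N" for i
    using hom_on_nth[OF p, of i] g by (cases "i < N") (simp_all add: e_def)
  have E: "map (\<lambda>i. e i a) [0..<Suc N] = a @ [g a]" if "a \<in> p" for a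
  proof -
    have "length a = N" using compatible_relD(2)[OF p] that by (auto simp: tuples_def)
    then show ?thesis by (auto simp: e_def intro!: nth_equalityI)
  qed
  have "op_graph (\<lambda>a. if a \<in> p then Some (g a) else None) = (\<lambda>a. a @ [g a]) ` p"
    by (auto simp: op_graph_def)
  also have "\<dots> = (\<lambda>a. map (\<lambda>i. e i a) [0..<Suc N]) ` p" using E by (intro image_cong) auto
  finally have "op_graph (\<lambda>a. if a \<in> p then Some (g a) else None) =
    (\<lambda>a. map (\<lambda>i. e i a) [0..<Suc N]) ` p" .
  moreover have "compatible_rel sig M (Suc N) ((\<lambda>a. map (\<lambda>i. e i a) [0..<Suc N]) ` p)"
    by (rule compatible_image[OF p]) (rule e)
  ultimately show ?thesis unfolding compatible_op_def by (simp only:)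
qed

lemma op_graph_iff: "as @ [b] \<in> op_graph h \<longleftrightarrow> h as = Some b"
  by (auto simp: op_graph_def)

lemma compatible_opD:
  assumes h: "compatible_op sig M n h"
  shows "dom h \<noteq> {}" "dom h \<subseteq> tuples n (carr M)" "h as = Some b \<Longrightarrow> as \<in> tuples n (carr M) \<and> b \<in> carr M"
    "op_arity h = n" "rel_arity (op_graph h) = Suc n"
proof -
  have g: "compatible_rel sig M (Suc n) (op_graph h)" using h by (simp add: compatible_op_def)
  show 3: "as \<in> tuples n (carr M) \<and> b \<in> carr M" if "h as = Some b" for as b
  proof -
    have "as @ [b] \<in> tuples (Suc n) (carr M)"
      using that compatible_relD(2)[OF g] by (auto simp: op_graph_def)
    then show ?thesis by (auto simp: tuples_def)
  qed
  show d: "dom h \<noteq> {}" using compatible_relD(1)[OF g] by (auto simp: op_graph_def)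
  show s: "dom h \<subseteq> tuples n (carr M)" using 3 by auto
  show "op_arity h = n" unfolding op_arity_def using d s by (rule rel_arity_eq)
  show "rel_arity (op_graph h) = Suc n" using g by (rule compatible_rel_arity)
qed

lemma compatible_dom:
  assumes h: "compatible_op sig M n h"
  shows "compatible_rel sig M n (dom h)" "hom_on sig M n (dom h) (\<lambda>a. the (h a))"
proof -
  have g: "compatible_rel sig M (Suc n) (op_graph h)" using h by (simp add: compatible_op_def)
  have len: "length a = n" if "h a = Some b" for a b
    using compatible_opD(3)[OF h that] by (simp add: tuples_def)
  have "compatible_rel sig M n ((\<lambda>a. map (\<lambda>i. a ! i) [0..<n]) ` op_graph h)"
    by (rule compatible_image[OF g]) (rule hom_on_nth[OF g], simp)
  moreover have "(\<lambda>a. map (\<lambda>i. a ! i) [0..<n]) ` op_graph h = butlast ` op_graph h"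
    using len by (intro image_cong) (auto simp: op_graph_def nth_append intro!: nth_equalityI)
  moreover have "butlast ` op_graph h = dom h"
    by (force simp: op_graph_def image_iff)
  ultimately show d: "compatible_rel sig M n (dom h)" by simp
  show "hom_on sig M n (dom h) (\<lambda>a. the (h a))"
    unfolding hom_on_def
  proof (intro conjI allI impI)
    show "(\<lambda>a. the (h a)) ` dom h \<subseteq> carr M" using compatible_opD(3)[OF h] by auto
    fix f q xs assume f: "sig f = Some q" "xs \<in> tuples q (dom h)"
    \<comment> \<open>Lift the arguments to the graph; closure of the graph under \<open>f\<close>
      then says that the last component of the result is the value of \<open>h\<close>.\<close>
    define ys where "ys = map (\<lambda>a. a @ [the (h a)]) xs"
    have "ys \<in> tuples q (op_graph h)" using f(2) by (auto simp: ys_def tuples_def op_graph_def)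
    then have "fop (tuple_power M (Suc n)) f ys \<in> op_graph h"
      using compatible_relD(3)[OF g f(1)] by blast
    moreover have "fop (tuple_power M (Suc n)) f ys =
        fop (tuple_power M n) f xs @ [fop M f (map (\<lambda>a. the (h a)) xs)]"
    proof -
      have "length x = n" if "x \<in> set xs" for x using f(2) that len by (auto simp: tuples_def)
      then have "map (\<lambda>x. x ! i) ys = map (\<lambda>x. x ! i) xs" if "i < n" for i
        using that by (auto simp: ys_def nth_append)
      moreover have "map (\<lambda>x. x ! n) ys = map (\<lambda>a. the (h a)) xs"
        using \<open>\<And>x. x \<in> set xs \<Longrightarrow> length x = n\<close> by (auto simp: ys_def nth_append)
      ultimately show ?thesis by (simp add: tuple_power_def)
    qed
    ultimately show "the (h (fop (tuple_power M n) f xs)) = fop M f (map (\<lambda>a. the (h a)) xs)"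
      by (simp add: op_graph_iff)
  qed
qed

text \<open>The map sending \<open>a\<close> to \<open>a @ [the (h a)]\<close> is an isomorphism
  from \<open>dom h\<close> onto the graph. Through it richness at \<open>dom h\<close>, which is
  what is assumed, supplies terms for homomorphisms on the graph, which is what
  \<open>\<beta>\<close> of the graph asks for.\<close>

lemma hom_on_op_graph:
  assumes h: "compatible_op sig M n h" and g: "hom_on sig M (Suc n) (op_graph h) g"
  shows "hom_on sig M n (dom h) (\<lambda>a. g (a @ [the (h a)]))"
proof -
  note d = compatible_dom[OF h]
  define e where "e = (\<lambda>i a. if i < n then a ! i else the (h a))"
  have E: "map (\<lambda>i. e i a) [0..<Suc n] = a @ [the (h a)]" if "a \<in> dom h" for a
    using compatible_opD(2)[OF h] that by (auto simp: e_def tuples_def intro!: nth_equalityI)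
  have "hom_on sig M n (dom h) (\<lambda>a. g (map (\<lambda>i. e i a) [0..<Suc n]))"
  proof (rule hom_on_comp[OF _ _ g])
    show "hom_on sig M n (dom h) (e i)" if "i < Suc n" for i
      using that hom_on_nth[OF d(1), of i] d(2) by (cases "i < n") (simp_all add: e_def)
    show "map (\<lambda>i. e i a) [0..<Suc n] \<in> op_graph h" if "a \<in> dom h" for a
      unfolding E[OF that] using that by (auto simp: op_graph_iff)
  qed
  then show ?thesis using hom_on_cong[OF d(1)] E by (metis (no_types, lifting))
qed

section \<open>Evaluation of terms and formulas\<close>

lemma None_notin_iff: "None \<notin> set os \<longleftrightarrow> (\<exists>vs. os = map Some vs)"
proof (induction os)
  case (Cons p os)
  then show ?case by (cases p) (auto simp: Cons_eq_map_conv)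
qed simp

text \<open>Existence of a list of argument values replaces the test for \<open>None\<close>. This
  list is what inductions over terms carry along a morphism or an operation of
  \<open>M\<close>.\<close>

lemma eval_App_iff: "eval X xs (App h ts) = Some b \<longleftrightarrow>
    (\<exists>vs. map (eval X xs) ts = map Some vs \<and> pfun X h vs = Some b)"
proof -
  have m: "map the (map Some vs) = vs" for vs by (simp add: comp_def)
  show ?thesis
  proof (cases "None \<in> set (map (eval X xs) ts)")
    case True
    then have "eval X xs (App h ts) = None" by (simp only: eval.simps Let_def if_True)
    moreover have "map (eval X xs) ts \<noteq> map Some vs" for vs using True None_notin_iff by metis
    ultimately show ?thesis by simp
  next
    case False
    then obtain vs where vs: "map (eval X xs) ts = map Some vs" using None_notin_iff by metis
    have "eval X xs (App h ts) = pfun X h (map the (map (eval X xs) ts))"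
      using False by (simp only: eval.simps Let_def if_False)
    then have "eval X xs (App h ts) = pfun X h vs" unfolding vs m .
    then show ?thesis unfolding vs inj_map_eq_map[OF inj_Some] by (simp only: simp_thms)
  qed
qed

lemma holds_Rel_iff: "holds X xs (Rel r ts) \<longleftrightarrow>
    (\<exists>vs. map (eval X xs) ts = map Some vs \<and> vs \<in> prel X r)"
proof -
  have "map the (map Some vs) = vs" for vs by (simp add: comp_def)
  moreover have "map (the \<circ> eval X xs) ts = map the (map (eval X xs) ts)" by simp
  ultimately show ?thesis
    using None_notin_iff[of "map (eval X xs) ts"] unfolding holds.simps by (metis (no_types, lifting))
qed

declare eval.simps(2)[simp del] holds.simps(2)[simp del]

lemma map_eval_Var: "map (eval X xs) (map Var js) = map Some vs \<longleftrightarrow> vs = map ((!) xs) js"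
proof -
  have "map (eval X xs) (map Var js) = map Some (map ((!) xs) js)" by simp
  then show ?thesis by (metis inj_map_eq_map inj_Some)
qed

lemma eval_App_Var: "eval X xs (App h (map Var js)) = pfun X h (map ((!) xs) js)"
  using eval_App_iff[of X xs h "map Var js"] by (metis map_eval_Var not_None_eq)

lemma holds_Rel_Var: "holds X xs (Rel r (map Var js)) \<longleftrightarrow> map ((!) xs) js \<in> prel X r"
  unfolding holds_Rel_iff map_eval_Var by simp

lemma map_Some_not_None: "map f ts = map Some vs \<Longrightarrow> t \<in> set ts \<Longrightarrow> f t \<noteq> None"
  using None_notin_iff[of "map f ts"] by (metis image_eqI list.set_map)

lemma eval_App_dom:
  assumes "eval X xs (App h ts) \<noteq> None" "map (eval X xs) ts = map Some vs"
  shows "vs \<in> dom (pfun X h)"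
proof -
  obtain b where "eval X xs (App h ts) = Some b" using assms(1) by blast
  then show ?thesis unfolding eval_App_iff assms(2) inj_map_eq_map[OF inj_Some] by blast
qed

lemma map_eq_map_Some_map:
  assumes "map f ts = map Some vs" "\<And>t b. t \<in> set ts \<Longrightarrow> f t = Some b \<Longrightarrow> f' t = Some (u b)"
  shows "map f' ts = map Some (map u vs)"
  using assms by (induction ts arbitrary: vs) (auto simp: Cons_eq_map_conv)

lemma holds_Rel_prel:
  assumes "holds X xs (Rel r ts)" "map (eval X xs) ts = map Some vs"
  shows "vs \<in> prel X r"
  using assms unfolding holds_Rel_iff assms(2) inj_map_eq_map[OF inj_Some] by blast

lemma eval_cong: "wf_trm E n t \<Longrightarrow> (\<And>i. i < n \<Longrightarrow> xs ! i = ys ! i) \<Longrightarrow> eval X xs t = eval X ys t"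
proof (induction t)
  case (App h ts)
  then have "map (eval X xs) ts = map (eval X ys) ts" by (auto simp: list_all_iff)
  then show ?case by (simp only: eval.simps)
qed simp

lemma holds_cong:
  assumes "wf_atomic E n \<alpha>" "\<And>i. i < n \<Longrightarrow> xs ! i = ys ! i"
  shows "holds X xs \<alpha> = holds X ys \<alpha>"
proof (cases \<alpha>)
  case (Eq s t)
  then show ?thesis using assms eval_cong[of E n _ xs ys X] by auto
next
  case (Rel r ts)
  then have "map (eval X xs) ts = map (eval X ys) ts"
    using assms eval_cong[of E n _ xs ys X] by (auto simp: list_all_iff)
  then show ?thesis by (simp only: Rel holds_Rel_iff)
qed

lemma holds_append: "wf_atomic E (length xs) \<alpha> \<Longrightarrow> holds X (xs @ ys) \<alpha> = holds X xs \<alpha>"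
  by (rule holds_cong) (auto simp: nth_append)

text \<open>Renaming covers only variables; here the witness variables of \<open>\<beta>h\<close>
  have to be replaced by terms.\<close>

primrec subst_trm :: "(nat \<Rightarrow> 'm trm) \<Rightarrow> 'm trm \<Rightarrow> 'm trm" where
  "subst_trm \<theta> (Var i) = \<theta> i"
| "subst_trm \<theta> (App h ts) = App h (map (subst_trm \<theta>) ts)"

primrec subst_atomic :: "(nat \<Rightarrow> 'm trm) \<Rightarrow> 'm atomic \<Rightarrow> 'm atomic" where
  "subst_atomic \<theta> (Eq s t) = Eq (subst_trm \<theta> s) (subst_trm \<theta> t)"
| "subst_atomic \<theta> (Rel r ts) = Rel r (map (subst_trm \<theta>) ts)"

lemma rename_trm_eq_subst: "rename_trm \<theta> t = subst_trm (\<lambda>i. Var (\<theta> i)) t"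
  by (induction t) auto

lemma rename_atomic_eq_subst: "rename_atomic \<theta> \<alpha> = subst_atomic (\<lambda>i. Var (\<theta> i)) \<alpha>"
  by (cases \<alpha>) (auto simp: rename_trm_eq_subst)

lemma wf_subst_trm: "wf_trm E n t \<Longrightarrow> (\<And>i. i < n \<Longrightarrow> wf_trm E N (\<theta> i)) \<Longrightarrow> wf_trm E N (subst_trm \<theta> t)"
  by (induction t) (auto simp: list_all_iff)

lemma wf_subst_atomic:
  "wf_atomic E n \<alpha> \<Longrightarrow> (\<And>i. i < n \<Longrightarrow> wf_trm E N (\<theta> i)) \<Longrightarrow> wf_atomic E N (subst_atomic \<theta> \<alpha>)"
  by (cases \<alpha>) (auto simp: list_all_iff wf_subst_trm)

lemma wf_trm_mono: "wf_trm E n t \<Longrightarrow> n \<le> N \<Longrightarrow> wf_trm E N t"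
  by (induction t) (auto simp: list_all_iff)

lemma wf_atomic_mono: "wf_atomic E n \<alpha> \<Longrightarrow> n \<le> N \<Longrightarrow> wf_atomic E N \<alpha>"
  by (cases \<alpha>) (auto simp: list_all_iff wf_trm_mono)

lemma eval_subst: "wf_trm E n t \<Longrightarrow> (\<And>i. i < n \<Longrightarrow> eval X xs (\<theta> i) = Some (ys ! i)) \<Longrightarrow>
    eval X xs (subst_trm \<theta> t) = eval X ys t"
proof (induction t)
  case (App h ts)
  then have "map (eval X xs) (map (subst_trm \<theta>) ts) = map (eval X ys) ts" by (auto simp: list_all_iff)
  then show ?case by (simp only: eval.simps subst_trm.simps)
qed simp

lemma holds_subst:
  assumes "wf_atomic E n \<alpha>" "\<And>i. i < n \<Longrightarrow> eval X xs (\<theta> i) = Some (ys ! i)"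
  shows "holds X xs (subst_atomic \<theta> \<alpha>) = holds X ys \<alpha>"
proof (cases \<alpha>)
  case (Eq s t)
  then show ?thesis using assms eval_subst[of E n _ X xs \<theta> ys] by auto
next
  case (Rel r ts)
  then have "map (eval X xs) (map (subst_trm \<theta>) ts) = map (eval X ys) ts"
    using assms eval_subst[of E n _ X xs \<theta> ys] by (auto simp: list_all_iff)
  then show ?thesis by (simp only: Rel holds_Rel_iff subst_atomic.simps)
qed

lemma eval_in_points:
  assumes X: "is_pstruct E X" and xs: "xs \<in> tuples n (points X)"
  shows "wf_trm E n t \<Longrightarrow> eval X xs t = Some b \<Longrightarrow> b \<in> points X"
proof (cases t)
  case (App h ts)
  assume "wf_trm E n t" "eval X xs t = Some b"
  then have "h \<in> eops E" "b \<in> ran (pfun X h)"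
    unfolding App eval_App_iff by (auto simp: ran_def)
  then show ?thesis using X by (auto simp: is_pstruct_def)
qed (use xs in \<open>auto simp: tuples_nth\<close>)

lemma evals_in_points:
  assumes X: "is_pstruct E X" and xs: "xs \<in> tuples n (points X)"
    and ts: "list_all (wf_trm E n) ts" "map (eval X xs) ts = map Some vs"
  shows "vs \<in> tuples (length ts) (points X)"
proof (rule tuplesI)
  show "length vs = length ts" using ts(2) by (metis length_map)
  show "set vs \<subseteq> points X"
  proof
    fix v assume "v \<in> set vs"
    then have "Some v \<in> set (map (eval X xs) ts)" using ts(2) by simp
    then obtain t where "t \<in> set ts" "eval X xs t = Some v" by auto
    then show "v \<in> points X" using eval_in_points[OF X xs] ts(1) by (auto simp: list_all_iff)
  qed
qed

text \<open>Definedness travels only forwards along a single morphism; the way back is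
  \<open>eval_embeds\<close>, for a whole family at once.\<close>

lemma eval_zhom:
  assumes u: "u \<in> zhom E X Y" and xs: "length xs = n"
  shows "wf_trm E n t \<Longrightarrow> eval X xs t = Some b \<Longrightarrow> eval Y (map u xs) t = Some (u b)"
proof (induction t arbitrary: b)
  case (Var i)
  then show ?case using xs by simp
next
  case (App h ts)
  then obtain vs where vs: "map (eval X xs) ts = map Some vs" "pfun X h vs = Some b"
    unfolding eval_App_iff by blast
  have "map (eval Y (map u xs)) ts = map Some (map u vs)"
    using App by (intro map_eq_map_Some_map[OF vs(1)]) (simp add: list_all_iff)
  moreover have "pfun Y h (map u vs) = Some (u b)"
    using u App.prems(1) vs(2) unfolding zhom_def by auto
  ultimately show ?case unfolding eval_App_iff by blast
qed

lemma evals_zhom: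
  assumes u: "u \<in> zhom E X Y" and xs: "length xs = n"
    and ts: "list_all (wf_trm E n) ts" "map (eval X xs) ts = map Some vs"
  shows "map (eval Y (map u xs)) ts = map Some (map u vs)"
  using eval_zhom[OF u xs] ts(1) by (intro map_eq_map_Some_map[OF ts(2)]) (simp add: list_all_iff)

lemma holds_zhom:
  assumes u: "u \<in> zhom E X Y" and xs: "length xs = n" and wf: "wf_atomic E n \<alpha>" and h: "holds X xs \<alpha>"
  shows "holds Y (map u xs) \<alpha>"
proof (cases \<alpha>)
  case (Eq s t)
  then show ?thesis using wf h eval_zhom[OF u xs] by auto
next
  case (Rel r ts)
  then obtain vs where "map (eval X xs) ts = map Some vs" "vs \<in> prel X r"
    using h unfolding Rel holds_Rel_iff by blast
  moreover from this have "map u vs \<in> prel Y r" using u wf Rel by (auto simp: zhom_def)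
  ultimately show ?thesis
    using evals_zhom[OF u xs, of ts vs] wf unfolding Rel holds_Rel_iff wf_atomic.simps by blast
qed

lemma zhom_points: "u \<in> zhom E X Y \<Longrightarrow> x \<in> points X \<Longrightarrow> u x \<in> points Y"
  by (auto simp: zhom_def)

lemma ego_struct_simps[simp]:
  "points (ego_struct M) = carr M" "pfun (ego_struct M) h = h" "prel (ego_struct M) r = r"
  "ptop (ego_struct M) = discrete_topology (carr M)"
  by (simp_all add: ego_struct_def)

lemma defined_rel_zhom:
  assumes u: "u \<in> zhom E X Y" and "wf_ca E n \<Phi>" "xs \<in> defined_rel X n \<Phi>"
  shows "map u xs \<in> defined_rel Y n \<Phi>"
proof -
  have "map u xs \<in> tuples n (points Y)"
    using assms zhom_points[OF u] by (auto simp: defined_rel_def tuples_def)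
  then show ?thesis
    using assms holds_zhom[OF u, of xs n] by (auto simp: defined_rel_def tuples_def wf_ca_def)
qed

section \<open>Families of morphisms that reflect the structure\<close>

text \<open>This says that evaluation maps \<open>X\<close> isomorphically onto a substructure of
  the power of \<open>M\<close> over \<open>K\<close>. Reflecting domains suffices for operations,
  since their values are then forced by separation of points. Topology is absent because a
  continuous injection of a compact space into a Hausdorff space is a homeomorphism onto its
  image.\<close>

definition embeds :: "'m alter_ego \<Rightarrow> ('f, 'm) alg \<Rightarrow> ('m, 'x) pstruct \<Rightarrow> ('x \<Rightarrow> 'm) set \<Rightarrow> bool" where
  "embeds E M X K \<longleftrightarrow> K \<subseteq> zhom E X (ego_struct M) \<and>
     (\<forall>x\<in>points X. \<forall>y\<in>points X. (\<forall>u\<in>K. u x = u y) \<longrightarrow> x = y) \<and>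
     (\<forall>r\<in>erels E. \<forall>xs\<in>tuples (rel_arity r) (points X). (\<forall>u\<in>K. map u xs \<in> r) \<longrightarrow> xs \<in> prel X r) \<and>
     (\<forall>h\<in>eops E. \<forall>xs\<in>tuples (op_arity h) (points X). (\<forall>u\<in>K. map u xs \<in> dom h) \<longrightarrow> xs \<in> dom (pfun X h))"

lemma ex_map_eq_map_Some:
  assumes "\<And>t. t \<in> set ts \<Longrightarrow> \<exists>b. ev t = Some b"
  shows "\<exists>vs. map ev ts = map Some vs"
proof
  show "map ev ts = map Some (map (the \<circ> ev) ts)"
    unfolding map_map using assms by (intro map_cong) force+
qed

text \<open>Definedness under all members of \<open>K\<close> descends to the subterms, so the
  arguments have values in \<open>X\<close>; then the domain of the outermost operation is
  reflected.\<close>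

lemma eval_embeds:
  assumes K: "embeds E M X K" and X: "is_pstruct E X" and xs: "xs \<in> tuples n (points X)"
  shows "wf_trm E n t \<Longrightarrow> (\<And>u. u \<in> K \<Longrightarrow> eval (ego_struct M) (map u xs) t \<noteq> None) \<Longrightarrow>
    \<exists>b. eval X xs t = Some b"
proof (induction t)
  case (App h ts)
  have "\<exists>b. eval X xs t = Some b" if t: "t \<in> set ts" for t
  proof (rule App.IH[OF t])
    show "wf_trm E n t" using App.prems(1) t by (simp add: list_all_iff)
    fix u assume "u \<in> K"
    then have "eval (ego_struct M) (map u xs) (App h ts) \<noteq> None" by (rule App.prems(2))
    then obtain b where "eval (ego_struct M) (map u xs) (App h ts) = Some b" by blast
    then obtain vs where "map (eval (ego_struct M) (map u xs)) ts = map Some vs"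
      unfolding eval_App_iff by blast
    then show "eval (ego_struct M) (map u xs) t \<noteq> None" using t by (rule map_Some_not_None)
  qed
  then obtain vs where vs: "map (eval X xs) ts = map Some vs" using ex_map_eq_map_Some[of ts "eval X xs"] by blast
  have ts: "list_all (wf_trm E n) ts" "h \<in> eops E" "length ts = op_arity h" using App.prems(1) by auto
  have "map u vs \<in> dom h" if "u \<in> K" for u
  proof -
    have "u \<in> zhom E X (ego_struct M)" using K that by (auto simp: embeds_def)
    from eval_App_dom[OF App.prems(2)[OF that] evals_zhom[OF this tuples_length[OF xs] ts(1) vs]]
    show ?thesis by simp
  qed
  then have "vs \<in> dom (pfun X h)"
    using K ts(2,3) evals_in_points[OF X xs ts(1) vs] by (auto simp: embeds_def)
  then show ?case unfolding eval_App_iff using vs by blast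
qed simp

lemma holds_embeds:
  assumes K: "embeds E M X K" and X: "is_pstruct E X" and xs: "xs \<in> tuples n (points X)"
    and wf: "wf_atomic E n \<alpha>" and h: "\<And>u. u \<in> K \<Longrightarrow> holds (ego_struct M) (map u xs) \<alpha>"
  shows "holds X xs \<alpha>"
proof (cases \<alpha>)
  case (Eq s t)
  then have st: "wf_trm E n s" "wf_trm E n t" using wf by auto
  obtain b where b: "eval X xs s = Some b"
    using eval_embeds[OF K X xs st(1)] h unfolding Eq by fastforce
  obtain c where c: "eval X xs t = Some c"
    using eval_embeds[OF K X xs st(2)] h unfolding Eq by fastforce
  have "u b = u c" if "u \<in> K" for u
  proof -
    have u: "u \<in> zhom E X (ego_struct M)" using K that by (auto simp: embeds_def)
    show ?thesis
      using eval_zhom[OF u tuples_length[OF xs] st(1) b] eval_zhom[OF u tuples_length[OF xs] st(2) c]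
        h[OF that] unfolding Eq by auto
  qed
  then have "b = c"
    using K eval_in_points[OF X xs st(1) b] eval_in_points[OF X xs st(2) c] by (auto simp: embeds_def)
  then show ?thesis using Eq b c by simp
next
  case (Rel r ts)
  then have ts: "list_all (wf_trm E n) ts" "r \<in> erels E" "length ts = rel_arity r" using wf by auto
  have "\<exists>b. eval X xs t = Some b" if t: "t \<in> set ts" for t
  proof (rule eval_embeds[OF K X xs])
    show "wf_trm E n t" using ts(1) t by (simp add: list_all_iff)
    fix u assume "u \<in> K"
    then have "holds (ego_struct M) (map u xs) (Rel r ts)" using h Rel by blast
    then obtain vs where "map (eval (ego_struct M) (map u xs)) ts = map Some vs"
      unfolding holds_Rel_iff by blast
    then show "eval (ego_struct M) (map u xs) t \<noteq> None" using t by (rule map_Some_not_None)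
  qed
  then obtain vs where vs: "map (eval X xs) ts = map Some vs" using ex_map_eq_map_Some[of ts "eval X xs"] by blast
  have "map u vs \<in> r" if "u \<in> K" for u
  proof -
    have "u \<in> zhom E X (ego_struct M)" using K that by (auto simp: embeds_def)
    from holds_Rel_prel[OF h[OF that, unfolded Rel] evals_zhom[OF this tuples_length[OF xs] ts(1) vs]]
    show ?thesis by simp
  qed
  then have "vs \<in> prel X r"
    using K ts(2,3) evals_in_points[OF X xs ts(1) vs] by (auto simp: embeds_def)
  then show ?thesis unfolding Rel holds_Rel_iff using vs by blast
qed

lemma defined_rel_embeds:
  assumes K: "embeds E M X K" and X: "is_pstruct E X" and xs: "xs \<in> tuples n (points X)"
    and wf: "wf_ca E n \<Phi>" and h: "\<And>u. u \<in> K \<Longrightarrow> map u xs \<in> defined_rel (ego_struct M) n \<Phi>"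
  shows "xs \<in> defined_rel X n \<Phi>"
  using holds_embeds[OF K X xs] wf h xs by (auto simp: defined_rel_def wf_ca_def)

text \<open>Apply every member of \<open>K\<close> to a tuple satisfying the premise, use the
  sentence in \<open>M\<close>, and reflect the conclusion. For the conclusion \<open>Bot\<close> at
  least one morphism is required.\<close>

lemma sat_uh_embeds:
  assumes K: "embeds E M X K" "K \<noteq> {}" and X: "is_pstruct E X" and \<sigma>: "\<sigma> \<in> Th_uH M E"
  shows "sat_uh X \<sigma>"
  unfolding sat_uh_def
proof
  fix xs assume xs: "xs \<in> pr X \<sigma>"
  have wf: "wf_ca E (nvars \<sigma>) (prem \<sigma>)" "wf_uh_concl E (nvars \<sigma>) (concl \<sigma>)"
    and s: "sat_uh (ego_struct M) \<sigma>" using \<sigma> by (auto simp: Th_uH_def wf_uh_def)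
  have *: "holds_uh_concl (ego_struct M) (map u xs) (concl \<sigma>)" if "u \<in> K" for u
  proof -
    have "u \<in> zhom E X (ego_struct M)" using K that by (auto simp: embeds_def)
    from defined_rel_zhom[OF this wf(1)] xs s show ?thesis by (auto simp: pr_def sat_uh_def)
  qed
  show "holds_uh_concl X xs (concl \<sigma>)"
  proof (cases "concl \<sigma>")
    case Bot
    then show ?thesis using * K(2) by auto
  next
    case (At \<alpha>)
    have "xs \<in> tuples (nvars \<sigma>) (points X)" using xs by (auto simp: pr_def defined_rel_def)
    from holds_embeds[OF K(1) X this, of \<alpha>] show ?thesis using At * wf(2) by simp
  qed
qed

section \<open>Definable relations and term functions\<close>

lemma evals_fop:
  fixes M :: "('f, 'm) alg"
  assumes v: "\<And>x. x \<in> set xs \<Longrightarrow> map (ev x) ts = map Some (v x)"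
    and ev: "\<And>t e. t \<in> set ts \<Longrightarrow> (\<And>x. x \<in> set xs \<Longrightarrow> ev x t = Some (e x)) \<Longrightarrow>
      ev' t = Some (fop M F (map e xs))"
  shows "map ev' ts = map Some (fop (tuple_power M (length ts)) F (map v xs))"
proof (rule nth_equalityI)
  show "length (map ev' ts) = length (map Some (fop (tuple_power M (length ts)) F (map v xs)))"
    by (simp add: tuple_power_def)
  fix i assume "i < length (map ev' ts)"
  then have i: "i < length ts" by simp
  have "ev x (ts ! i) = Some (v x ! i)" if "x \<in> set xs" for x
  proof -
    have "length (v x) = length ts" using v[OF that] by (metis length_map)
    then show ?thesis using v[OF that] i by (metis nth_map)
  qed
  then have "ev' (ts ! i) = Some (fop M F (map (\<lambda>x. v x ! i) xs))" using i by (intro ev) auto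
  then show "map ev' ts ! i = map Some (fop (tuple_power M (length ts)) F (map v xs)) ! i"
    using i by (simp add: tuple_power_def comp_def)
qed

text \<open>Induction on the term: the operations of \<open>M\<close> respect the domain and the
  values of each compatible \<open>h\<close>, hence those of term functions.\<close>

lemma eval_fop:
  fixes M :: "('f, 'm) alg"
  assumes E: "is_alter_ego sig M E" and F: "sig F = Some q"
    and xs: "xs \<in> tuples q (tuples n (carr M))"
  shows "wf_trm E n t \<Longrightarrow> (\<And>x. x \<in> set xs \<Longrightarrow> eval (ego_struct M) x t = Some (e x)) \<Longrightarrow>
    eval (ego_struct M) (fop (tuple_power M n) F xs) t = Some (fop M F (map e xs))"
proof (induction t arbitrary: e)
  case (Var i)
  have "map (\<lambda>x. x ! i) xs = map e xs" using Var(2) by (intro map_cong) simp_all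
  then show ?case using Var(1) arg_cong[of _ _ "fop M F"] by (simp add: tuple_power_def del: map_eq_conv)
next
  case (App h ts)
  have ts: "list_all (wf_trm E n) ts" "h \<in> eops E" "length ts = op_arity h" using App.prems(1) by auto
  obtain k where h: "compatible_op sig M k h" using E ts(2) unfolding is_alter_ego_def by blast
  have k: "length ts = k" using ts(3) compatible_opD(4)[OF h] by simp
  have "\<exists>v. map (eval (ego_struct M) x) ts = map Some v \<and> h v = Some (e x)" if "x \<in> set xs" for x
    using App.prems(2)[OF that] unfolding eval_App_iff by simp
  then obtain v where v: "\<And>x. x \<in> set xs \<Longrightarrow> map (eval (ego_struct M) x) ts = map Some (v x)"
    "\<And>x. x \<in> set xs \<Longrightarrow> h (v x) = Some (e x)" by metis
  have dom: "map v xs \<in> tuples q (dom h)" using xs v(2) by (auto simp: tuples_def)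
  note d = compatible_dom[OF h]
  have "map (eval (ego_struct M) (fop (tuple_power M n) F xs)) ts =
      map Some (fop (tuple_power M (length ts)) F (map v xs))"
    using v(1) App.IH ts(1) by (intro evals_fop) (auto simp: list_all_iff)
  moreover have "h (fop (tuple_power M k) F (map v xs)) = Some (fop M F (map e xs))"
  proof -
    have "fop (tuple_power M k) F (map v xs) \<in> dom h" by (rule compatible_relD(3)[OF d(1) F dom])
    moreover have "the (h (fop (tuple_power M k) F (map v xs))) = fop M F (map (\<lambda>a. the (h a)) (map v xs))"
      using d(2) F dom unfolding hom_on_def by blast
    moreover have "map (\<lambda>a. the (h a)) (map v xs) = map e xs" using v(2) by simp
    ultimately have "h (fop (tuple_power M k) F (map v xs)) = Some (fop M F (map e xs))"
      using option.collapse[of "h (fop (tuple_power M k) F (map v xs))"] by (simp only: domIff simp_thms)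
    then show ?thesis .
  qed
  ultimately show ?case unfolding eval_App_iff k by auto
qed

text \<open>In particular the premise relation of \<open>natural fs \<beta>h \<phi>\<close> is a
  subalgebra once it is non-empty, so that richness there speaks about homomorphisms on it.\<close>

lemma compatible_defined_rel:
  fixes M :: "('f, 'm) alg"
  assumes M: "is_alg sig M" and E: "is_alter_ego sig M E"
    and wf: "wf_ca E n \<Phi>" and ne: "defined_rel (ego_struct M) n \<Phi> \<noteq> {}"
  shows "compatible_rel sig M n (defined_rel (ego_struct M) n \<Phi>)"
  unfolding compatible_rel_def subuniverse_def
proof (intro conjI allI impI)
  let ?p = "defined_rel (ego_struct M) n \<Phi>"
  show "?p \<noteq> {}" by (rule ne)
  show "?p \<subseteq> carr (tuple_power M n)" by (auto simp: defined_rel_def tuple_power_def)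
  fix F q xs assume F: "sig F = Some q" and xs: "xs \<in> tuples q ?p"
  have xsM: "xs \<in> tuples q (tuples n (carr M))" using xs by (auto simp: tuples_def defined_rel_def)
  let ?y = "fop (tuple_power M n) F xs"
  have "fop M F (map (\<lambda>x. x ! i) xs) \<in> carr M" if "i < n" for i
  proof -
    have "x ! i \<in> carr M" if "x \<in> set xs" for x
      using xsM that \<open>i < n\<close> tuples_nth[of x n "carr M" i] by (auto simp: tuples_def subset_iff)
    then have "map (\<lambda>x. x ! i) xs \<in> tuples q (carr M)" using xs by (auto simp: tuples_def)
    then show ?thesis using M F by (auto simp: is_alg_def)
  qed
  then have y: "?y \<in> tuples n (carr M)" by (auto simp: tuple_power_def tuples_def)
  have "holds (ego_struct M) ?y \<alpha>" if \<alpha>: "\<alpha> \<in> set \<Phi>" for \<alpha>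
  proof -
    have h: "holds (ego_struct M) x \<alpha>" if "x \<in> set xs" for x
      using xs that \<alpha> by (auto simp: tuples_def defined_rel_def)
    have wfa: "wf_atomic E n \<alpha>" using wf \<alpha> by (simp add: wf_ca_def)
    show ?thesis
    proof (cases \<alpha>)
      case (Eq s t)
      then have "\<exists>b. eval (ego_struct M) x s = Some b \<and> eval (ego_struct M) x t = Some b"
        if "x \<in> set xs" for x using h[OF that] by simp
      then obtain e where "\<And>x. x \<in> set xs \<Longrightarrow> eval (ego_struct M) x s = Some (e x)"
        "\<And>x. x \<in> set xs \<Longrightarrow> eval (ego_struct M) x t = Some (e x)" by metis
      then show ?thesis
        using wfa eval_fop[OF E F xsM, of _ e] by (simp add: Eq)
    next
      case (Rel r ts)
      then have ts: "list_all (wf_trm E n) ts" "r \<in> erels E" "length ts = rel_arity r"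
        using wfa by auto
      obtain k where r: "compatible_rel sig M k r" using E ts(2) unfolding is_alter_ego_def by blast
      have k: "length ts = k" using ts(3) compatible_rel_arity[OF r] by simp
      have "\<exists>v. map (eval (ego_struct M) x) ts = map Some v \<and> v \<in> r" if "x \<in> set xs" for x
        using h[OF that] unfolding Rel holds_Rel_iff by simp
      then obtain v where v: "\<And>x. x \<in> set xs \<Longrightarrow> map (eval (ego_struct M) x) ts = map Some (v x)"
        "\<And>x. x \<in> set xs \<Longrightarrow> v x \<in> r" by metis
      have "map (eval (ego_struct M) ?y) ts = map Some (fop (tuple_power M (length ts)) F (map v xs))"
        using v(1) eval_fop[OF E F xsM] ts(1) by (intro evals_fop) (auto simp: list_all_iff)
      moreover have "fop (tuple_power M k) F (map v xs) \<in> r"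
        using xs v(2) by (intro compatible_relD(3)[OF r F]) (auto simp: tuples_def)
      ultimately show ?thesis unfolding Rel holds_Rel_iff k by auto
    qed
  qed
  then show "?y \<in> ?p" using y by (simp add: defined_rel_def)
qed

text \<open>Terms only have to extend the members of the clone, since richness itself is about
  extensions. Composition becomes substitution.\<close>

lemma Clo_ep_term:
  assumes E: "is_alter_ego sig M E" and f: "f \<in> Clo_ep M E"
  shows "\<exists>n t. dom f \<subseteq> tuples n (carr M) \<and> wf_trm E n t \<and>
    (\<forall>as b. f as = Some b \<longrightarrow> eval (ego_struct M) as t = Some b)"
  using f
proof (induction rule: Clo_ep.induct)
  case (op h)
  obtain n where h: "compatible_op sig M n h" using E op(1) unfolding is_alter_ego_def by blast
  have "eval (ego_struct M) as (App h (map Var [0..<n])) = Some b" if "h as = Some b" for as b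
  proof -
    have "length as = n" using compatible_opD(3)[OF h that] by (simp add: tuples_def)
    then show ?thesis unfolding eval_App_Var using that map_nth[of as] by simp
  qed
  moreover have "wf_trm E n (App h (map Var [0..<n]))"
    using op(1) compatible_opD(4)[OF h] by (simp add: list_all_iff)
  ultimately show ?case using compatible_opD(2)[OF h] by blast
next
  case (proj n i)
  then show ?case
    by (intro exI[of _ n] exI[of _ "Var i"]) (auto simp: proj_op_def split: if_splits)
next
  case (comp f gs k)
  obtain n t where t: "dom f \<subseteq> tuples n (carr M)" "wf_trm E n t"
    "\<And>as b. f as = Some b \<Longrightarrow> eval (ego_struct M) as t = Some b" using comp.IH(1) by blast
  \<comment> \<open>A tuple in the domain of the composite fixes the arities: it shows that
    \<open>f\<close> takes \<open>length gs\<close> arguments and that every inner operation takes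
    \<open>k\<close>.\<close>
  have "comp_op (carr M) k f gs \<noteq> Map.empty" by fact
  then obtain a0 b0 where "comp_op (carr M) k f gs a0 = Some b0" by (auto simp: fun_eq_iff)
  then have a0: "a0 \<in> tuples k (carr M)" "\<And>g. g \<in> set gs \<Longrightarrow> a0 \<in> dom g"
    "f (map (\<lambda>g. the (g a0)) gs) = Some b0" by (auto simp: comp_op_def split: if_splits)
  have n: "length gs = n" using t(1) a0(3) by (auto simp: tuples_def)
  have "\<exists>t. wf_trm E k t \<and> (\<forall>as b. g as = Some b \<longrightarrow> eval (ego_struct M) as t = Some b)"
    if "g \<in> set gs" for g
  proof -
    have "\<exists>n t. dom g \<subseteq> tuples n (carr M) \<and> wf_trm E n t \<and>
        (\<forall>as b. g as = Some b \<longrightarrow> eval (ego_struct M) as t = Some b)"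
      using bspec[OF comp.IH(2) that] by (elim conjE)
    then obtain n' t where t': "dom g \<subseteq> tuples n' (carr M)" "wf_trm E n' t"
      "\<forall>as b. g as = Some b \<longrightarrow> eval (ego_struct M) as t = Some b" by (elim exE conjE)
    from t'(1) have "a0 \<in> tuples n' (carr M)" using a0(2)[OF that] by (rule subsetD)
    from tuples_length[OF this] have "n' = k" using tuples_length[OF a0(1)] by (simp only:)
    then show ?thesis using t'(2,3) by blast
  qed
  then obtain T where T: "\<And>g. g \<in> set gs \<Longrightarrow> wf_trm E k (T g)"
    "\<And>g as b. g \<in> set gs \<Longrightarrow> g as = Some b \<Longrightarrow> eval (ego_struct M) as (T g) = Some b" by metis
  define \<theta> where "\<theta> = (\<lambda>i. T (gs ! i))"
  have "eval (ego_struct M) as (subst_trm \<theta> t) = Some b" if as: "comp_op (carr M) k f gs as = Some b" for as b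
  proof -
    have d: "\<And>g. g \<in> set gs \<Longrightarrow> as \<in> dom g" "f (map (\<lambda>g. the (g as)) gs) = Some b"
      using as by (auto simp: comp_op_def split: if_splits)
    have "eval (ego_struct M) as (\<theta> i) = Some (map (\<lambda>g. the (g as)) gs ! i)" if "i < n" for i
      using T(2)[of "gs ! i" as] d(1)[of "gs ! i"] that n by (auto simp: \<theta>_def)
    then have "eval (ego_struct M) as (subst_trm \<theta> t) = eval (ego_struct M) (map (\<lambda>g. the (g as)) gs) t"
      by (rule eval_subst[OF t(2)])
    then show ?thesis using t(3)[OF d(2)] by simp
  qed
  moreover have "wf_trm E k (subst_trm \<theta> t)"
    using t(2) T(1) n by (intro wf_subst_trm) (auto simp: \<theta>_def)
  moreover have "dom (comp_op (carr M) k f gs) \<subseteq> tuples k (carr M)"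
    by (auto simp: comp_op_def split: if_splits)
  ultimately show ?case by blast
qed

text \<open>The homomorphism becomes a partial operation with domain exactly \<open>p\<close>, which
  is the form that richness quantifies over.\<close>

lemma op_rich_term:
  assumes E: "is_alter_ego sig M E" and rich: "op_rich_at sig M E p"
    and p: "compatible_rel sig M N p" and g: "hom_on sig M N p g"
  obtains t where "wf_trm E N t" "\<And>a. a \<in> p \<Longrightarrow> eval (ego_struct M) a t = Some (g a)"
proof -
  define h where "h = (\<lambda>a. if a \<in> p then Some (g a) else None)"
  have "compatible_op sig M N h" unfolding h_def by (rule compatible_op_of_hom[OF p g])
  moreover have "dom h = p" by (auto simp: h_def split: if_splits)
  ultimately obtain f where f: "f \<in> Clo_ep M E" "h \<subseteq>\<^sub>m f" using rich unfolding op_rich_at_def by blast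
  obtain n t where t: "dom f \<subseteq> tuples n (carr M)" "wf_trm E n t"
    "\<And>as b. f as = Some b \<Longrightarrow> eval (ego_struct M) as t = Some b" using Clo_ep_term[OF E f(1)] by blast
  have fa: "f a = Some (g a)" if "a \<in> p" for a
    using f(2) that by (auto simp: h_def map_le_def dom_def split: if_splits)
  obtain a where a: "a \<in> p" using compatible_relD(1)[OF p] by blast
  have "a \<in> tuples N (carr M)" "a \<in> tuples n (carr M)"
    using compatible_relD(2)[OF p] t(1) fa[OF a] a by auto
  then have "n = N" by (simp add: tuples_def)
  then show thesis using that t(2,3) fa by blast
qed

section \<open>The formulas \<open>\<beta>\<close>\<close>

locale hat_ego =
  fixes sig :: "'f signature" and M :: "('f, 'm) alg" and E :: "'m alter_ego"
    and fs :: "'m frel \<Rightarrow> ('m list \<Rightarrow> 'm) list" and \<beta>h :: "'m frel \<Rightarrow> 'm ca_formula"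
  assumes alg: "is_alg sig M" and fin: "finite (carr M)"
    and ego: "is_alter_ego sig M E" and choice: "hat_choice sig M E fs \<beta>h"
begin

text \<open>The relation that the existential formula \<open>\<beta>\<^sub>r\<close> of the paper defines in \<open>X\<close>.\<close>

definition beta_rel :: "('m, 'x) pstruct \<Rightarrow> 'm frel \<Rightarrow> 'x frel" where
  "beta_rel X r = {xs \<in> tuples (rel_arity r) (points X).
     \<exists>ws. xs @ ws \<in> defined_rel X (rel_arity r + length (fs r)) (\<beta>h r)}"

lemma hatD:
  assumes "compatible_rel sig M n r"
  shows "set (fs r) = alg_hom sig (rel_alg M n r) M" "wf_ca E (n + length (fs r)) (\<beta>h r)"
    "defined_rel (ego_struct M) (n + length (fs r)) (\<beta>h r) = hat r (fs r)"
  using choice assms unfolding hat_choice_def by blast+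

lemma fs_hom_on: "compatible_rel sig M n r \<Longrightarrow> f \<in> set (fs r) \<Longrightarrow> hom_on sig M n r f"
  using hatD(1) alg_hom_rel_alg by blast

lemma beta_relI:
  assumes "compatible_rel sig M n r" "length xs = n"
    "xs @ ws \<in> defined_rel X (n + length (fs r)) (\<beta>h r)"
  shows "xs \<in> beta_rel X r"
  using assms compatible_rel_arity[OF assms(1)] by (auto simp: beta_rel_def defined_rel_def tuples_def)

lemma beta_relE:
  assumes "compatible_rel sig M n r" "xs \<in> beta_rel X r"
  obtains ws where "xs \<in> tuples n (points X)" "ws \<in> tuples (length (fs r)) (points X)"
    "xs @ ws \<in> defined_rel X (n + length (fs r)) (\<beta>h r)"
  using assms compatible_rel_arity[OF assms(1)] by (auto simp: beta_rel_def defined_rel_def tuples_def)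

text \<open>In \<open>M\<close> the formula \<open>\<beta>h r\<close> defines \<open>hat r\<close>,
  where the witnesses are the values \<open>f xs\<close>; dropping them returns
  \<open>r\<close>.\<close>

lemma beta_rel_ego: "beta_rel (ego_struct M) r = r" if r: "compatible_rel sig M n r"
proof (intro set_eqI iffI)
  have len: "length as = n" if "as \<in> r" for as
    using compatible_relD(2)[OF r] that by (auto simp: tuples_def)
  fix xs
  show "xs \<in> r" if "xs \<in> beta_rel (ego_struct M) r"
  proof -
    obtain ws where "xs \<in> tuples n (carr M)" "xs @ ws \<in> hat r (fs r)"
      using \<open>xs \<in> beta_rel (ego_struct M) r\<close> hatD(3)[OF r] by (auto elim: beta_relE[OF r])
    then obtain as where "xs @ ws = as @ map (\<lambda>f. f as) (fs r)" "as \<in> r" "length xs = n"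
      by (auto simp: hat_def tuples_def)
    then show ?thesis using len[of as] by simp
  qed
  show "xs \<in> beta_rel (ego_struct M) r" if "xs \<in> r"
    using that len[OF that] hatD(3)[OF r]
    by (intro beta_relI[OF r, of _ "map (\<lambda>f. f xs) (fs r)"]) (auto simp: hat_def)
qed

lemma holds_inst_hat:
  assumes r: "compatible_rel sig M n r" and js: "length js = n"
  shows "(\<forall>\<alpha>\<in>set (inst_hat fs \<beta>h r js off). holds X ys \<alpha>) \<longleftrightarrow>
    (\<forall>\<alpha>\<in>set (\<beta>h r). holds X (map ((!) ys) (js @ [off..<off + length (fs r)])) \<alpha>)"
proof -
  let ?ks = "js @ [off..<off + length (fs r)]"
  have "holds X ys (rename_atomic ((!) ?ks) \<alpha>) = holds X (map ((!) ys) ?ks) \<alpha>" if "\<alpha> \<in> set (\<beta>h r)" for \<alpha>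
    unfolding rename_atomic_eq_subst
  proof (rule holds_subst)
    show "wf_atomic E (n + length (fs r)) \<alpha>" using hatD(2)[OF r] that by (simp add: wf_ca_def)
    show "eval X ys (Var (?ks ! i)) = Some (map ((!) ys) ?ks ! i)" if "i < n + length (fs r)" for i
      using that js by (simp del: map_append)
  qed
  then show ?thesis by (simp add: inst_hat_def)
qed

lemma wf_inst_hat:
  assumes r: "compatible_rel sig M n r" and js: "length js = n" "set js \<subseteq> {..<L}"
    and L: "off + length (fs r) \<le> L"
  shows "wf_ca E L (inst_hat fs \<beta>h r js off)"
  unfolding wf_ca_def
proof
  let ?ks = "js @ [off..<off + length (fs r)]"
  fix \<alpha> assume "\<alpha> \<in> set (inst_hat fs \<beta>h r js off)"
  then obtain \<alpha>' where \<alpha>': "\<alpha>' \<in> set (\<beta>h r)" "\<alpha> = rename_atomic ((!) ?ks) \<alpha>'"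
    by (auto simp: inst_hat_def)
  show "wf_atomic E L \<alpha>"
    unfolding \<alpha>'(2) rename_atomic_eq_subst
  proof (rule wf_subst_atomic)
    show "wf_atomic E (n + length (fs r)) \<alpha>'" using hatD(2)[OF r] \<alpha>'(1) by (simp add: wf_ca_def)
    fix i assume "i < n + length (fs r)"
    then have "?ks ! i \<in> set ?ks" using js by (intro nth_mem) simp
    also have "set ?ks \<subseteq> {..<L}" using js L by auto
    finally show "wf_trm E L (Var (?ks ! i))" by simp
  qed
qed

text \<open>Lets relational conjuncts and equations be treated alike, through
  \<open>prem_rel\<close> and \<open>prem_vars\<close>; the list of variables also fixes the
  arity.\<close>

definition ok_prem :: "nat \<Rightarrow> 'm atomic \<Rightarrow> bool" where
  "ok_prem N \<alpha> \<longleftrightarrow> compatible_rel sig M (length (prem_vars \<alpha>)) (prem_rel \<alpha>) \<and> set (prem_vars \<alpha>) \<subseteq> {..<N}"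

abbreviation wcount :: "'m ca_formula \<Rightarrow> nat" where
  "wcount \<Phi> \<equiv> (\<Sum>\<alpha>\<leftarrow>\<Phi>. length (fs (prem_rel \<alpha>)))"

lemma ok_prem_mono: "ok_prem N \<alpha> \<Longrightarrow> N \<le> N' \<Longrightarrow> ok_prem N' \<alpha>"
  by (auto simp: ok_prem_def)

text \<open>The witnesses are chosen conjunct by conjunct. The variables of the conjuncts lie below
  \<open>off\<close>, so appending a block of witnesses does not disturb them.\<close>

lemma natural_prem_satisfied:
  assumes "\<And>\<alpha>. \<alpha> \<in> set \<Phi> \<Longrightarrow> ok_prem off \<alpha> \<and> map ((!) xs) (prem_vars \<alpha>) \<in> beta_rel X (prem_rel \<alpha>)"
    and "xs \<in> tuples off (points X)"
  shows "\<exists>ws \<in> tuples (wcount \<Phi>) (points X). \<forall>\<alpha>\<in>set (natural_prem fs \<beta>h off \<Phi>). holds X (xs @ ws) \<alpha>"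
  using assms
proof (induction \<Phi> arbitrary: off xs)
  case Nil
  then show ?case by (simp add: tuples_def)
next
  case (Cons \<alpha> \<Phi>)
  let ?r = "prem_rel \<alpha>" and ?js = "prem_vars \<alpha>"
  let ?m = "length (fs ?r)" and ?n = "length ?js"
  have r: "compatible_rel sig M ?n ?r" and js: "set ?js \<subseteq> {..<off}"
    and b: "map ((!) xs) ?js \<in> beta_rel X ?r"
    using Cons.prems(1)[of \<alpha>] by (auto simp: ok_prem_def)
  have lxs: "length xs = off" using Cons.prems(2) by (rule tuples_length)
  obtain ws1 where ws1: "ws1 \<in> tuples ?m (points X)"
    "map ((!) xs) ?js @ ws1 \<in> defined_rel X (?n + ?m) (\<beta>h ?r)" using beta_relE[OF r b] by blast
  have "\<exists>ws\<in>tuples (wcount \<Phi>) (points X).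
      \<forall>\<alpha>\<in>set (natural_prem fs \<beta>h (off + ?m) \<Phi>). holds X ((xs @ ws1) @ ws) \<alpha>"
  proof (rule Cons.IH)
    show "xs @ ws1 \<in> tuples (off + ?m) (points X)" using Cons.prems(2) ws1(1) by (rule tuples_append)
    fix \<gamma> assume "\<gamma> \<in> set \<Phi>"
    then have \<gamma>: "ok_prem off \<gamma>" "map ((!) xs) (prem_vars \<gamma>) \<in> beta_rel X (prem_rel \<gamma>)"
      using Cons.prems(1)[of \<gamma>] by simp_all
    have "map ((!) (xs @ ws1)) (prem_vars \<gamma>) = map ((!) xs) (prem_vars \<gamma>)"
      using \<gamma>(1) lxs by (intro map_nth_append_left) (auto simp: ok_prem_def)
    then show "ok_prem (off + ?m) \<gamma> \<and> map ((!) (xs @ ws1)) (prem_vars \<gamma>) \<in> beta_rel X (prem_rel \<gamma>)"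
      using \<gamma> ok_prem_mono[OF \<gamma>(1)] by (simp del: map_eq_conv)
  qed
  then obtain ws2 where ws2: "ws2 \<in> tuples (wcount \<Phi>) (points X)"
    "\<forall>\<alpha>\<in>set (natural_prem fs \<beta>h (off + ?m) \<Phi>). holds X (xs @ ws1 @ ws2) \<alpha>" by auto
  have "map ((!) (xs @ ws1 @ ws2)) (?js @ [off..<off + ?m]) = map ((!) xs) ?js @ ws1"
  proof -
    have "map ((!) (xs @ ws1 @ ws2)) ?js = map ((!) xs) ?js"
      using js lxs by (intro map_nth_append_left) simp
    moreover have "map ((!) (xs @ ws1 @ ws2)) [off..<off + ?m] = ws1"
      using lxs tuples_length[OF ws1(1)] by (intro nth_equalityI) (auto simp: nth_append)
    ultimately show ?thesis by simp
  qed
  then have "\<forall>\<alpha>\<in>set (inst_hat fs \<beta>h ?r ?js off). holds X (xs @ ws1 @ ws2) \<alpha>"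
    using holds_inst_hat[OF r refl, of off X "xs @ ws1 @ ws2"] ws1(2)
    by (simp add: defined_rel_def del: map_append map_eq_conv)
  moreover have "ws1 @ ws2 \<in> tuples (wcount (\<alpha> # \<Phi>)) (points X)"
    using tuples_append[OF ws1(1) ws2(1)] by simp
  ultimately show ?case using ws2(2) by (intro bexI[of _ "ws1 @ ws2"]) auto
qed

text \<open>Each conjunct finds its witnesses in the block that starts at its own offset.\<close>

lemma natural_premD:
  assumes "\<forall>\<alpha>\<in>set (natural_prem fs \<beta>h off \<Phi>). holds X ys \<alpha>" "ys \<in> tuples L (points X)"
    "off + wcount \<Phi> \<le> L" "\<And>\<alpha>. \<alpha> \<in> set \<Phi> \<Longrightarrow> ok_prem L \<alpha>" "\<alpha> \<in> set \<Phi>"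
  shows "map ((!) ys) (prem_vars \<alpha>) \<in> beta_rel X (prem_rel \<alpha>)"
  using assms
proof (induction \<Phi> arbitrary: off)
  case (Cons \<gamma> \<Phi>)
  let ?r = "prem_rel \<gamma>" and ?js = "prem_vars \<gamma>"
  let ?m = "length (fs ?r)" and ?n = "length ?js"
  show ?case
  proof (cases "\<alpha> = \<gamma>")
    case True
    have r: "compatible_rel sig M ?n ?r" and js: "set ?js \<subseteq> {..<L}"
      using Cons.prems(4)[of \<gamma>] by (auto simp: ok_prem_def)
    let ?ks = "?js @ [off..<off + ?m]"
    have "\<forall>\<alpha>\<in>set (inst_hat fs \<beta>h ?r ?js off). holds X ys \<alpha>" using Cons.prems(1) by simp
    then have "\<forall>\<alpha>\<in>set (\<beta>h ?r). holds X (map ((!) ys) ?ks) \<alpha>"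
      using holds_inst_hat[OF r refl] by blast
    moreover have "map ((!) ys) ?ks \<in> tuples (length ?ks) (points X)"
      using Cons.prems(3) js by (intro tuples_map_nth[OF Cons.prems(2)]) auto
    ultimately have "map ((!) ys) ?ks \<in> defined_rel X (?n + ?m) (\<beta>h ?r)"
      by (simp add: defined_rel_def)
    then show ?thesis unfolding True
      by (intro beta_relI[OF r, of _ "map ((!) ys) [off..<off + ?m]"]) simp_all
  next
    case False
    then show ?thesis using Cons.prems by (intro Cons.IH[of "off + ?m"]) auto
  qed
qed simp

lemma wf_natural_prem:
  assumes "off + wcount \<Phi> \<le> L" "\<And>\<alpha>. \<alpha> \<in> set \<Phi> \<Longrightarrow> ok_prem L \<alpha>"
  shows "wf_ca E L (natural_prem fs \<beta>h off \<Phi>)"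
  using assms
proof (induction \<Phi> arbitrary: off)
  case (Cons \<gamma> \<Phi>)
  have "wf_ca E L (natural_prem fs \<beta>h (off + length (fs (prem_rel \<gamma>))) \<Phi>)"
    using Cons.prems by (intro Cons.IH) auto
  moreover have "wf_ca E L (inst_hat fs \<beta>h (prem_rel \<gamma>) (prem_vars \<gamma>) off)"
    using Cons.prems(1) Cons.prems(2)[of \<gamma>]
    by (intro wf_inst_hat[of "length (prem_vars \<gamma>)"]) (auto simp: ok_prem_def)
  ultimately show ?case by (auto simp: wf_ca_def)
qed (simp add: wf_ca_def)

text \<open>Over \<open>M\<close> the formula \<open>\<beta>\<close> defines \<open>r\<close>
  itself, so forgetting the witness variables leads back to the original premise. Thus a sentence
  can be applied to the tuples of the premise relation of its translation.\<close>

lemma natural_prem_ego: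
  assumes ok: "\<And>\<alpha>. \<alpha> \<in> set \<Phi> \<Longrightarrow> ok_prem N \<alpha>"
    and a: "a \<in> defined_rel (ego_struct M) (N + wcount \<Phi>) (natural_prem fs \<beta>h N \<Phi>)"
  shows "take N a \<in> tuples N (carr M)"
    "\<alpha> \<in> set \<Phi> \<Longrightarrow> map ((!) (take N a)) (prem_vars \<alpha>) \<in> prem_rel \<alpha>"
proof -
  have at: "a \<in> tuples (N + wcount \<Phi>) (carr M)" using a by (simp add: defined_rel_def)
  show "take N a \<in> tuples N (carr M)" using at by (auto simp: tuples_def dest: in_set_takeD)
  assume \<alpha>: "\<alpha> \<in> set \<Phi>"
  have r: "compatible_rel sig M (length (prem_vars \<alpha>)) (prem_rel \<alpha>)" and js: "set (prem_vars \<alpha>) \<subseteq> {..<N}"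
    using ok[OF \<alpha>] by (auto simp: ok_prem_def)
  have "map ((!) a) (prem_vars \<alpha>) \<in> beta_rel (ego_struct M) (prem_rel \<alpha>)"
  proof (rule natural_premD)
    show "\<forall>\<alpha>\<in>set (natural_prem fs \<beta>h N \<Phi>). holds (ego_struct M) a \<alpha>"
      using a by (simp add: defined_rel_def)
    show "a \<in> tuples (N + wcount \<Phi>) (points (ego_struct M))" using at by simp
    show "ok_prem (N + wcount \<Phi>) \<gamma>" if "\<gamma> \<in> set \<Phi>" for \<gamma>
      by (rule ok_prem_mono[OF ok[OF that]]) simp
  qed (use \<alpha> in simp_all)
  moreover have "map ((!) a) (prem_vars \<alpha>) = map ((!) (take N a)) (prem_vars \<alpha>)"
    using js by (intro map_cong) auto
  ultimately show "map ((!) (take N a)) (prem_vars \<alpha>) \<in> prem_rel \<alpha>"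
    using beta_rel_ego[OF r] by simp
qed

text \<open>
  The choice in \<open>pfun\<close> is unambiguous only for compatible \<open>h\<close> and models \<open>X\<close> of the universal Horn
  theory, where \<open>\<beta>\<close> for the graph of \<open>h\<close> defines the graph of a partial operation.
\<close>

definition flat :: "('m, 'x) pstruct \<Rightarrow> ('m, 'x) pstruct" where
  "flat X = \<lparr>ptop = ptop X,
     pfun = (\<lambda>h xs. if \<exists>b. xs @ [b] \<in> beta_rel X (op_graph h)
       then Some (SOME b. xs @ [b] \<in> beta_rel X (op_graph h)) else None),
     prel = beta_rel X\<rparr>"

lemma flat_simps [simp]: "ptop (flat X) = ptop X" "prel (flat X) = beta_rel X"
  by (simp_all add: flat_def)

text \<open>The two sources of witness terms. At \<open>p\<close>, richness is applied to
  \<open>g\<close> composed with the coordinates \<open>js\<close>; at \<open>s\<close>, a term for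
  \<open>g\<close> is found first and its variables are renamed to \<open>js\<close>. The former
  serves conclusions foreign to the language of \<open>E\<close>, the latter those within
  it.\<close>

lemma term_pull:
  assumes p: "compatible_rel sig M N p" and s: "compatible_rel sig M k s"
    and rich: "op_rich_at sig M E p \<or> op_rich_at sig M E s"
    and js: "length js = k" "set js \<subseteq> {..<N}" and ps: "\<And>a. a \<in> p \<Longrightarrow> map ((!) a) js \<in> s"
    and g: "hom_on sig M k s g"
  shows "\<exists>u. wf_trm E N u \<and> (\<forall>a\<in>p. eval (ego_struct M) a u = Some (g (map ((!) a) js)))"
  using rich
proof
  assume rich: "op_rich_at sig M E p"
  have nth: "map (\<lambda>i. a ! (js ! i)) [0..<k] = map ((!) a) js" for a :: "'m list"
    using js(1) by (intro nth_equalityI) simp_all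
  have "hom_on sig M N p (\<lambda>a. g (map (\<lambda>i. a ! (js ! i)) [0..<k]))"
  proof (rule hom_on_comp[OF _ _ g])
    show "hom_on sig M N p (\<lambda>a. a ! (js ! i))" if "i < k" for i
      using js that by (intro hom_on_nth[OF p]) (auto simp: subset_iff)
    show "map (\<lambda>i. a ! (js ! i)) [0..<k] \<in> s" if "a \<in> p" for a unfolding nth by (rule ps[OF that])
  qed
  then have "hom_on sig M N p (\<lambda>a. g (map ((!) a) js))" unfolding nth .
  then show ?thesis using op_rich_term[OF ego rich p] by metis
next
  assume rich: "op_rich_at sig M E s"
  obtain t where t: "wf_trm E k t" "\<And>a. a \<in> s \<Longrightarrow> eval (ego_struct M) a t = Some (g a)"
    using op_rich_term[OF ego rich s g] by metis
  let ?u = "subst_trm (\<lambda>i. Var (js ! i)) t"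
  have "wf_trm E N ?u" using js by (intro wf_subst_trm[OF t(1)]) (auto simp: subset_iff)
  moreover have "eval (ego_struct M) a ?u = Some (g (map ((!) a) js))" if "a \<in> p" for a
  proof -
    have "eval (ego_struct M) a ?u = eval (ego_struct M) (map ((!) a) js) t"
      by (rule eval_subst[OF t(1)]) (simp add: js(1))
    then show ?thesis using t(2)[OF ps[OF that]] by simp
  qed
  ultimately show ?thesis by blast
qed

end

section \<open>Models of the universal Horn theory, and the behaviour of \<open>flat\<close> on
  them\<close>

locale uh_model = hat_ego sig M E fs \<beta>h
  for sig :: "'f signature" and M :: "('f, 'm) alg" and E :: "'m alter_ego" and fs \<beta>h +
  fixes X :: "('m, 'x) pstruct"
  assumes pstruct: "is_pstruct E X" and model: "\<And>\<sigma>. \<sigma> \<in> Th_uH M E \<Longrightarrow> sat_uh X \<sigma>"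
begin

text \<open>The only access to \<open>model\<close>: whatever is to be shown of a tuple of
  \<open>X\<close> has to be put as one atomic conclusion, or \<open>Bot\<close>, from finitely many
  atomic premises, valid in \<open>M\<close>.\<close>

lemma transfer:
  assumes "wf_ca E N \<Psi>" "wf_uh_concl E N \<gamma>" "x \<in> defined_rel X N \<Psi>"
    and "\<And>a. a \<in> defined_rel (ego_struct M) N \<Psi> \<Longrightarrow> holds_uh_concl (ego_struct M) a \<gamma>"
  shows "holds_uh_concl X x \<gamma>"
proof -
  let ?\<sigma> = "\<lparr>nvars = N, prem = \<Psi>, concl = \<gamma>\<rparr>"
  have "?\<sigma> \<in> Th_uH M E" using assms by (auto simp: Th_uH_def wf_uh_def sat_uh_def pr_def)
  from model[OF this] show ?thesis using assms(3) by (simp add: sat_uh_def pr_def)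
qed

lemma beta_rel_of_terms:
  assumes wf: "wf_ca E N \<Psi>" and x: "x \<in> defined_rel X N \<Psi>"
    and s: "compatible_rel sig M n s"
    and ts: "list_all (wf_trm E N) ts"
    and v: "\<And>a. a \<in> defined_rel (ego_struct M) N \<Psi> \<Longrightarrow>
      map (eval (ego_struct M) a) ts = map Some (v a) \<and> v a \<in> s"
    and us: "\<And>f. f \<in> set (fs s) \<Longrightarrow> \<exists>u. wf_trm E N u \<and>
      (\<forall>a\<in>defined_rel (ego_struct M) N \<Psi>. eval (ego_struct M) a u = Some (f (v a)))"
    and len: "length ts = n"
  shows "\<exists>vs\<in>beta_rel X s. map (eval X x) ts = map Some vs"
proof -
  obtain u where u: "\<And>f. f \<in> set (fs s) \<Longrightarrow> wf_trm E N (u f)"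
    "\<And>f a. f \<in> set (fs s) \<Longrightarrow> a \<in> defined_rel (ego_struct M) N \<Psi> \<Longrightarrow>
      eval (ego_struct M) a (u f) = Some (f (v a))" using us by metis
  define ts' where "ts' = ts @ map u (fs s)"
  have wf': "wf_trm E N t" if "t \<in> set ts'" for t
    using that ts u(1) by (auto simp: ts'_def list_all_iff)
  have len': "length ts' = n + length (fs s)" using len by (simp add: ts'_def)
  have evM: "map (eval (ego_struct M) a) ts' = map Some (v a @ map (\<lambda>f. f (v a)) (fs s))"
    if "a \<in> defined_rel (ego_struct M) N \<Psi>" for a
    using v[OF that] u(2)[OF _ that] by (simp add: ts'_def)
  \<comment> \<open>Definedness is an atomic formula, namely \<open>t = t\<close>.\<close>
  have "eval X x t \<noteq> None" if t: "t \<in> set ts'" for t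
  proof -
    have "holds_uh_concl X x (At (Eq t t))"
    proof (rule transfer[OF wf _ x])
      show "wf_uh_concl E N (At (Eq t t))" using wf'[OF t] by simp
      fix a assume "a \<in> defined_rel (ego_struct M) N \<Psi>"
      from map_Some_not_None[OF evM[OF this] t]
      show "holds_uh_concl (ego_struct M) a (At (Eq t t))" by auto
    qed
    then show ?thesis by auto
  qed
  then obtain vs where vs: "map (eval X x) ts' = map Some vs"
    using ex_map_eq_map_Some[of ts' "eval X x"] by blast
  have xt: "x \<in> tuples N (points X)" using x by (simp add: defined_rel_def)
  have vst: "vs \<in> tuples (n + length (fs s)) (points X)"
    using evals_in_points[OF pstruct xt _ vs] wf' len' by (simp add: list_all_iff)
  have "holds X vs \<alpha>" if \<alpha>: "\<alpha> \<in> set (\<beta>h s)" for \<alpha>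
  proof -
    have wfa: "wf_atomic E (n + length (fs s)) \<alpha>" using hatD(2)[OF s] \<alpha> by (simp add: wf_ca_def)
    have "holds_uh_concl X x (At (subst_atomic ((!) ts') \<alpha>))"
    proof (rule transfer[OF wf _ x])
      show "wf_uh_concl E N (At (subst_atomic ((!) ts') \<alpha>))"
        using wf' len' wf_subst_atomic[OF wfa, of N "(!) ts'"] by simp
      fix a assume a: "a \<in> defined_rel (ego_struct M) N \<Psi>"
      let ?w = "v a @ map (\<lambda>f. f (v a)) (fs s)"
      have "?w \<in> hat s (fs s)" using v[OF a] by (auto simp: hat_def)
      then have h: "holds (ego_struct M) ?w \<alpha>"
        using \<alpha> unfolding hatD(3)[OF s, symmetric] by (simp add: defined_rel_def)
      have "eval (ego_struct M) a (ts' ! i) = Some (?w ! i)" if "i < n + length (fs s)" for i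
      proof -
        have lw: "length ?w = length ts'" using arg_cong[OF evM[OF a], of length] by simp
        have "eval (ego_struct M) a (ts' ! i) = map (eval (ego_struct M) a) ts' ! i"
          using that len' by simp
        also have "\<dots> = map Some ?w ! i" by (simp only: evM[OF a])
        also have "\<dots> = Some (?w ! i)" using that len' lw by (intro nth_map) simp
        finally show ?thesis .
      qed
      then show "holds_uh_concl (ego_struct M) a (At (subst_atomic ((!) ts') \<alpha>))"
        using holds_subst[OF wfa, of "ego_struct M" a "(!) ts'" ?w] h by simp
    qed
    moreover have "eval X x (ts' ! i) = Some (vs ! i)" if "i < n + length (fs s)" for i
      using vs that len' vst by (metis nth_map tuples_length)
    ultimately show ?thesis using holds_subst[OF wfa, of X x "(!) ts'" vs] by simp
  qed
  then have d: "vs \<in> defined_rel X (n + length (fs s)) (\<beta>h s)" using vst by (simp add: defined_rel_def)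
  have "take n vs \<in> beta_rel X s"
    by (rule beta_relI[OF s, of _ "drop n vs"]) (use d tuples_length[OF vst] in simp_all)
  moreover have "map (eval X x) ts = map Some (take n vs)"
    using arg_cong[OF vs, of "take n"] len by (simp add: ts'_def take_map)
  ultimately show ?thesis by blast
qed

lemma beta_rel_of_vars:
  assumes wf: "wf_ca E N \<Psi>" and x: "x \<in> defined_rel X N \<Psi>"
    and s: "compatible_rel sig M (length js) s" and js: "set js \<subseteq> {..<N}"
    and v: "\<And>a. a \<in> defined_rel (ego_struct M) N \<Psi> \<Longrightarrow> map ((!) a) js \<in> s"
    and us: "\<And>f. f \<in> set (fs s) \<Longrightarrow> \<exists>u. wf_trm E N u \<and>
      (\<forall>a\<in>defined_rel (ego_struct M) N \<Psi>. eval (ego_struct M) a u = Some (f (map ((!) a) js)))"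
  shows "map ((!) x) js \<in> beta_rel X s"
proof -
  have "\<exists>vs\<in>beta_rel X s. map (eval X x) (map Var js) = map Some vs"
    by (rule beta_rel_of_terms[OF wf x s, where v = "\<lambda>a. map ((!) a) js"])
      (use js v us in \<open>auto simp: list_all_iff map_eval_Var\<close>)
  then show ?thesis unfolding map_eval_Var by blast
qed

text \<open>Existential quantifiers move out of the premise: witnesses in \<open>X\<close> prolong
  \<open>x\<close>, and neither \<open>\<Theta>\<close> nor the conclusion sees the additional
  variables. Thus \<open>\<beta>\<close> may be used freely in premises; \<open>\<Theta>\<close>
  collects those that are atomic over \<open>E\<close> already.\<close>

lemma concl_of_beta_rel:
  assumes ok: "\<And>\<alpha>. \<alpha> \<in> set \<Phi> \<Longrightarrow> ok_prem N \<alpha> \<and> map ((!) x) (prem_vars \<alpha>) \<in> beta_rel X (prem_rel \<alpha>)"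
    and \<Theta>: "wf_ca E N \<Theta>" "x \<in> defined_rel X N \<Theta>" and \<gamma>: "wf_uh_concl E N \<gamma>"
    and imp: "\<And>a. a \<in> defined_rel (ego_struct M) N \<Theta> \<Longrightarrow>
      (\<And>\<alpha>. \<alpha> \<in> set \<Phi> \<Longrightarrow> map ((!) a) (prem_vars \<alpha>) \<in> prem_rel \<alpha>) \<Longrightarrow> holds_uh_concl (ego_struct M) a \<gamma>"
  shows "holds_uh_concl X x \<gamma>"
proof -
  let ?N = "N + wcount \<Phi>" and ?\<Psi> = "natural_prem fs \<beta>h N \<Phi>"
  have xt: "x \<in> tuples N (points X)" using \<Theta>(2) by (simp add: defined_rel_def)
  have concl_append: "holds_uh_concl S (y @ w) \<gamma> = holds_uh_concl S y \<gamma>" if "length y = N"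
    for S :: "('m, 'm) pstruct" and y w
    using \<gamma> that by (cases \<gamma>) (auto simp: holds_append[of E])
  obtain ws where ws: "ws \<in> tuples (wcount \<Phi>) (points X)"
    "\<forall>\<alpha>\<in>set ?\<Psi>. holds X (x @ ws) \<alpha>"
    using natural_prem_satisfied[OF ok xt] by blast
  have "holds_uh_concl X (x @ ws) \<gamma>"
  proof (rule transfer)
    have "wf_ca E ?N ?\<Psi>" using ok by (intro wf_natural_prem) (simp_all add: ok_prem_mono[of N])
    moreover have "wf_ca E ?N \<Theta>" using \<Theta>(1) by (auto simp: wf_ca_def wf_atomic_mono[of E N])
    ultimately show "wf_ca E ?N (?\<Psi> @ \<Theta>)" by (auto simp: wf_ca_def)
    show "wf_uh_concl E ?N \<gamma>" using \<gamma> by (cases \<gamma>) (auto simp: wf_atomic_mono[of E N])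
    have "holds X (x @ ws) \<alpha>" if "\<alpha> \<in> set \<Theta>" for \<alpha>
      using \<Theta> that holds_append[of E x \<alpha> X ws] tuples_length[OF xt] by (auto simp: wf_ca_def defined_rel_def)
    then show "x @ ws \<in> defined_rel X ?N (?\<Psi> @ \<Theta>)"
      using ws tuples_append[OF xt ws(1)] by (auto simp: defined_rel_def)
    fix a assume a: "a \<in> defined_rel (ego_struct M) ?N (?\<Psi> @ \<Theta>)"
    then have a': "a \<in> defined_rel (ego_struct M) ?N ?\<Psi>" by (auto simp: defined_rel_def)
    have okN: "\<And>\<alpha>. \<alpha> \<in> set \<Phi> \<Longrightarrow> ok_prem N \<alpha>" using ok by blast
    note np = natural_prem_ego[OF okN a']
    have "holds (ego_struct M) (take N a) \<alpha>" if "\<alpha> \<in> set \<Theta>" for \<alpha>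
    proof -
      have "holds (ego_struct M) (take N a @ drop N a) \<alpha>" using a that by (simp add: defined_rel_def)
      then show ?thesis
        using holds_append[of E "take N a" \<alpha> "ego_struct M" "drop N a"] \<Theta>(1) that tuples_length[OF np(1)]
        by (simp add: wf_ca_def del: append_take_drop_id)
    qed
    then have "take N a \<in> defined_rel (ego_struct M) N \<Theta>" using np(1) by (simp add: defined_rel_def)
    then have "holds_uh_concl (ego_struct M) (take N a) \<gamma>" using imp np(2) by blast
    then show "holds_uh_concl (ego_struct M) a \<gamma>"
      using concl_append[OF tuples_length[OF np(1)], of "ego_struct M" "drop N a"] by simp
  qed
  then show ?thesis using \<gamma> tuples_length[OF xt] by (cases \<gamma>) (auto simp: holds_append[of E])
qed

text \<open>That a graph is functional is itself a Horn implication, with \<open>\<beta>\<close>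
  twice in the premise and an equation of variables as conclusion.\<close>

lemma beta_rel_op_graph_unique:
  assumes h: "compatible_op sig M n h" and b: "xs @ [b] \<in> beta_rel X (op_graph h)"
    and c: "xs @ [c] \<in> beta_rel X (op_graph h)"
  shows "b = c"
proof -
  have g: "compatible_rel sig M (Suc n) (op_graph h)" using h by (simp add: compatible_op_def)
  \<comment> \<open>The variables below \<open>n\<close> are the common arguments, \<open>n\<close>
    and \<open>Suc n\<close> the two values.\<close>
  let ?\<Phi> = "[Rel (op_graph h) (map Var ([0..<n] @ [n])), Rel (op_graph h) (map Var ([0..<n] @ [Suc n]))]"
  let ?x = "xs @ [b, c]"
  have "xs @ [b] \<in> tuples (Suc n) (points X)" "xs @ [c] \<in> tuples (Suc n) (points X)"
    using b c by (auto elim: beta_relE[OF g])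
  then have x: "?x \<in> tuples (Suc (Suc n)) (points X)" and len: "length xs = n"
    by (auto simp: tuples_def)
  have pv: "map var_index (map Var js) = js" for js by (simp add: comp_def)
  have m: "map ((!) ?x) ([0..<n] @ [n]) = xs @ [b]" "map ((!) ?x) ([0..<n] @ [Suc n]) = xs @ [c]"
    using len by (auto simp: nth_append intro!: nth_equalityI)
  have "holds_uh_concl X ?x (At (Eq (Var n) (Var (Suc n))))"
  proof (rule concl_of_beta_rel[where \<Phi> = ?\<Phi> and \<Theta> = "[]" and N = "Suc (Suc n)"])
    fix \<alpha> assume "\<alpha> \<in> set ?\<Phi>"
    then consider "\<alpha> = Rel (op_graph h) (map Var ([0..<n] @ [n]))" | "\<alpha> = Rel (op_graph h) (map Var ([0..<n] @ [Suc n]))"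
      by auto
    then show "ok_prem (Suc (Suc n)) \<alpha> \<and> map ((!) ?x) (prem_vars \<alpha>) \<in> beta_rel X (prem_rel \<alpha>)"
    proof cases
      case 1
      have "prem_vars \<alpha> = [0..<n] @ [n]" unfolding 1 prem_vars.simps pv ..
      then show ?thesis unfolding ok_prem_def using g b m by (auto simp: 1)
    next
      case 2
      have "prem_vars \<alpha> = [0..<n] @ [Suc n]" unfolding 2 prem_vars.simps pv ..
      then show ?thesis unfolding ok_prem_def using g c m by (auto simp: 2)
    qed
  next
    show "?x \<in> defined_rel X (Suc (Suc n)) []" using x by (simp add: defined_rel_def)
    fix a assume "a \<in> defined_rel (ego_struct M) (Suc (Suc n)) []"
      and r: "\<And>\<alpha>. \<alpha> \<in> set ?\<Phi> \<Longrightarrow> map ((!) a) (prem_vars \<alpha>) \<in> prem_rel \<alpha>"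
    have "map ((!) a) ([0..<n] @ [n]) \<in> op_graph h"
      using r[of "Rel (op_graph h) (map Var ([0..<n] @ [n]))"] unfolding prem_vars.simps prem_rel.simps pv by simp
    moreover have "map ((!) a) ([0..<n] @ [Suc n]) \<in> op_graph h"
      using r[of "Rel (op_graph h) (map Var ([0..<n] @ [Suc n]))"] unfolding prem_vars.simps prem_rel.simps pv by simp
    ultimately show "holds_uh_concl (ego_struct M) a (At (Eq (Var n) (Var (Suc n))))"
      by (simp add: op_graph_iff)
  qed (simp_all add: wf_ca_def)
  then show ?thesis using len by (simp add: nth_append)
qed

lemma flat_fun:
  assumes "compatible_op sig M n h"
  shows "pfun (flat X) h xs = Some b \<longleftrightarrow> xs @ [b] \<in> beta_rel X (op_graph h)"
proof
  assume "pfun (flat X) h xs = Some b"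
  then have "\<exists>b. xs @ [b] \<in> beta_rel X (op_graph h)" "b = (SOME b. xs @ [b] \<in> beta_rel X (op_graph h))"
    by (auto simp: flat_def split: if_splits)
  then show "xs @ [b] \<in> beta_rel X (op_graph h)" using someI_ex by metis
next
  assume b: "xs @ [b] \<in> beta_rel X (op_graph h)"
  then have "xs @ [SOME b. xs @ [b] \<in> beta_rel X (op_graph h)] \<in> beta_rel X (op_graph h)" by (rule someI)
  then have "(SOME b. xs @ [b] \<in> beta_rel X (op_graph h)) = b"
    using beta_rel_op_graph_unique[OF assms _ b] by blast
  then show "pfun (flat X) h xs = Some b" using b by (auto simp: flat_def)
qed

lemma pstruct_flat:
  assumes E': "is_alter_ego sig M E'"
  shows "is_pstruct E' (flat X)"
  unfolding is_pstruct_def flat_simps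
proof (intro conjI ballI)
  fix h assume "h \<in> eops E'"
  then obtain n where h: "compatible_op sig M n h" using E' unfolding is_alter_ego_def by blast
  have g: "compatible_rel sig M (Suc n) (op_graph h)" using h by (simp add: compatible_op_def)
  have *: "xs \<in> tuples n (points X) \<and> b \<in> points X" if "pfun (flat X) h xs = Some b" for xs b
  proof -
    have "xs @ [b] \<in> tuples (Suc n) (points X)"
      using that unfolding flat_fun[OF h] by (auto elim: beta_relE[OF g])
    then show ?thesis by (auto simp: tuples_def)
  qed
  show "dom (pfun (flat X) h) \<subseteq> tuples (op_arity h) (points X)"
    using * unfolding compatible_opD(4)[OF h] by blast
  show "ran (pfun (flat X) h) \<subseteq> points X" using * by (auto simp: ran_def)
qed (auto simp: beta_rel_def)

lemma pure_prem_iff: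
  assumes E': "is_alter_ego sig M E'" and wf: "wf_atomic E' N \<alpha>" and pure: "pure_prem \<alpha>"
  shows "ok_prem N \<alpha>" "holds (flat X) xs \<alpha> \<longleftrightarrow> map ((!) xs) (prem_vars \<alpha>) \<in> beta_rel X (prem_rel \<alpha>)"
    "holds (ego_struct M) as \<alpha> \<longleftrightarrow> map ((!) as) (prem_vars \<alpha>) \<in> prem_rel \<alpha>"
proof -
  have pv: "map var_index (map Var js) = js" for js by (simp add: comp_def)
  have "ok_prem N \<alpha> \<and> (holds (flat X) xs \<alpha> \<longleftrightarrow> map ((!) xs) (prem_vars \<alpha>) \<in> beta_rel X (prem_rel \<alpha>)) \<and>
    (holds (ego_struct M) as \<alpha> \<longleftrightarrow> map ((!) as) (prem_vars \<alpha>) \<in> prem_rel \<alpha>)"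
    using pure unfolding pure_prem_def
  proof (elim disjE exE)
    fix r js assume \<alpha>: "\<alpha> = Rel r (map Var js)"
    then have r: "r \<in> erels E'" "length js = rel_arity r" "set js \<subseteq> {..<N}"
      using wf by (auto simp: list_all_iff)
    then obtain n where n: "compatible_rel sig M n r" using E' unfolding is_alter_ego_def by blast
    have "length js = n" using r(2) compatible_rel_arity[OF n] by simp
    then show ?thesis
      using n r(3) unfolding \<alpha> ok_prem_def prem_vars.simps prem_rel.simps pv holds_Rel_Var by simp
  next
    fix h js i assume \<alpha>: "\<alpha> = Eq (App h (map Var js)) (Var i)"
    then have h: "h \<in> eops E'" "length js = op_arity h" "set js \<subseteq> {..<N}" "i < N"
      using wf by (auto simp: list_all_iff)
    then obtain n where n: "compatible_op sig M n h" using E' unfolding is_alter_ego_def by blast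
    have "length js = n" using h(2) compatible_opD(4)[OF n] by simp
    moreover have "holds (flat X) xs \<alpha> \<longleftrightarrow> map ((!) xs) js @ [xs ! i] \<in> beta_rel X (op_graph h)"
      unfolding \<alpha> flat_fun[OF n, symmetric] holds.simps eval_App_Var by auto
    moreover have "holds (ego_struct M) as \<alpha> \<longleftrightarrow> map ((!) as) js @ [as ! i] \<in> op_graph h"
      unfolding \<alpha> op_graph_iff holds.simps eval_App_Var by auto
    moreover have "prem_vars \<alpha> = js @ [i]" "prem_rel \<alpha> = op_graph h"
      unfolding \<alpha> prem_vars.simps prem_rel.simps pv by simp_all
    ultimately show ?thesis using n h(3,4) by (simp add: ok_prem_def compatible_op_def)
  qed
  then show "ok_prem N \<alpha>" "holds (flat X) xs \<alpha> \<longleftrightarrow> map ((!) xs) (prem_vars \<alpha>) \<in> beta_rel X (prem_rel \<alpha>)"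
    "holds (ego_struct M) as \<alpha> \<longleftrightarrow> map ((!) as) (prem_vars \<alpha>) \<in> prem_rel \<alpha>" by blast+
qed

text \<open>The conclusion decides how the axiom transfers. Equations of variables and
  \<open>Bot\<close> are Horn conclusions over \<open>E\<close> already. For a relation or a domain
  the witnesses come from \<open>term_pull\<close>: by richness at the relation in the conclusion if
  its symbol belongs to \<open>E\<close>, at the translated premise otherwise.\<close>

lemma flat_sat:
  assumes E': "is_alter_ego sig M E'" and \<sigma>: "\<sigma> \<in> Th_uH M E'" and pure: "pure_uh \<sigma>"
    and op: "\<And>r. r \<in> erels E \<union> dom ` eops E \<Longrightarrow> op_rich_at sig M E r"
    and ax: "\<not> concl_in_language E (concl \<sigma>) \<Longrightarrow> op_rich_at sig M E (pr (ego_struct M) (natural fs \<beta>h \<sigma>))"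
  shows "sat_uh (flat X) \<sigma>"
  unfolding sat_uh_def
proof
  let ?N = "nvars \<sigma>" and ?\<Phi> = "prem \<sigma>" and ?\<gamma> = "concl \<sigma>"
  let ?\<Psi> = "natural_prem fs \<beta>h ?N ?\<Phi>" and ?L = "?N + wcount ?\<Phi>"
  let ?p = "defined_rel (ego_struct M) ?L ?\<Psi>"
  fix x assume "x \<in> pr (flat X) \<sigma>"
  then have xt: "x \<in> tuples ?N (points X)" and xh: "\<And>\<alpha>. \<alpha> \<in> set ?\<Phi> \<Longrightarrow> holds (flat X) x \<alpha>"
    by (auto simp: pr_def defined_rel_def)
  have wf: "\<And>\<alpha>. \<alpha> \<in> set ?\<Phi> \<Longrightarrow> wf_atomic E' ?N \<alpha>" "wf_uh_concl E' ?N ?\<gamma>"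
    and sat: "sat_uh (ego_struct M) \<sigma>" using \<sigma> by (auto simp: Th_uH_def wf_uh_def wf_ca_def)
  have pp: "\<And>\<alpha>. \<alpha> \<in> set ?\<Phi> \<Longrightarrow> pure_prem \<alpha>" and pc: "pure_concl ?\<gamma>" using pure by (auto simp: pure_uh_def)
  have ok: "ok_prem ?N \<alpha> \<and> map ((!) x) (prem_vars \<alpha>) \<in> beta_rel X (prem_rel \<alpha>)" if "\<alpha> \<in> set ?\<Phi>" for \<alpha>
    using pure_prem_iff(1,2)[OF E' wf(1)[OF that] pp[OF that]] xh[OF that] by blast
  have okN: "\<And>\<alpha>. \<alpha> \<in> set ?\<Phi> \<Longrightarrow> ok_prem ?N \<alpha>" using ok by blast
  have imp: "holds_uh_concl (ego_struct M) a ?\<gamma>"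
    if "a \<in> tuples ?N (carr M)" "\<And>\<alpha>. \<alpha> \<in> set ?\<Phi> \<Longrightarrow> map ((!) a) (prem_vars \<alpha>) \<in> prem_rel \<alpha>" for a
    using sat that pure_prem_iff(3)[OF E' wf(1) pp] by (auto simp: sat_uh_def pr_def defined_rel_def)
  have direct: "holds_uh_concl X x ?\<gamma>" if "wf_uh_concl E ?N ?\<gamma>"
    by (rule concl_of_beta_rel[where \<Phi> = ?\<Phi> and \<Theta> = "[]", OF ok _ _ that imp])
      (use xt in \<open>auto simp: wf_ca_def defined_rel_def\<close>)
  obtain ws where ws: "ws \<in> tuples (wcount ?\<Phi>) (points X)" "\<forall>\<alpha>\<in>set ?\<Psi>. holds X (x @ ws) \<alpha>"
    using natural_prem_satisfied[OF ok xt] by blast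
  let ?x = "x @ ws"
  have x\<Psi>: "?x \<in> defined_rel X ?L ?\<Psi>" using ws tuples_append[OF xt ws(1)] by (simp add: defined_rel_def)
  have wf\<Psi>: "wf_ca E ?L ?\<Psi>" using okN by (intro wf_natural_prem) (simp_all add: ok_prem_mono[of ?N])
  \<comment> \<open>Compatible relations are non-empty by definition. If \<open>?p\<close> were
    empty, the translated premise would imply \<open>Bot\<close> in \<open>M\<close> and so in
    \<open>X\<close>, although \<open>x @ ws\<close> satisfies it.\<close>
  have "?p \<noteq> {}"
  proof
    assume e: "?p = {}"
    have "holds_uh_concl X ?x Bot" by (rule transfer[OF wf\<Psi> _ x\<Psi>]) (use e in auto)
    then show False by simp
  qed
  then have p: "compatible_rel sig M ?L ?p" using compatible_defined_rel[OF alg ego wf\<Psi>] by blast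
  have ax': "op_rich_at sig M E ?p" if "\<not> concl_in_language E ?\<gamma>"
    using ax[OF that] by (simp add: pr_def natural_def Let_def)
  have pconcl: "holds_uh_concl (ego_struct M) a ?\<gamma>" if "a \<in> ?p" for a
  proof -
    note np = natural_prem_ego[OF okN that]
    have "holds_uh_concl (ego_struct M) (take ?N a) ?\<gamma>" by (rule imp[OF np(1) np(2)])
    then show ?thesis
      using wf(2) tuples_length[OF np(1)] holds_append[of E' "take ?N a" _ "ego_struct M" "drop ?N a"]
      by (cases ?\<gamma>) auto
  qed
  show "holds_uh_concl (flat X) x ?\<gamma>"
    using pc unfolding pure_concl_def
  proof (elim disjE exE)
    fix r js assume c: "?\<gamma> = At (Rel r (map Var js))"
    then have r: "r \<in> erels E'" "length js = rel_arity r" "set js \<subseteq> {..<?N}"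
      using wf(2) by (auto simp: list_all_iff)
    obtain n where n: "compatible_rel sig M n r" using E' r(1) unfolding is_alter_ego_def by blast
    have len: "length js = n" using r(2) compatible_rel_arity[OF n] by simp
    have js: "set js \<subseteq> {..<?L}" using r(3) by auto
    have pr: "map ((!) a) js \<in> r" if "a \<in> ?p" for a
      using pconcl[OF that] unfolding c holds_uh_concl.simps holds_Rel_Var by simp
    have rich: "op_rich_at sig M E ?p \<or> op_rich_at sig M E r"
      using ax' op[of r] unfolding c by (auto simp: list_all_iff)
    have "map ((!) ?x) js \<in> beta_rel X r"
    proof (rule beta_rel_of_vars[OF wf\<Psi> x\<Psi> _ js])
      show "compatible_rel sig M (length js) r" using n len by simp
      show "map ((!) a) js \<in> r" if "a \<in> ?p" for a by (rule pr[OF that])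
      show "\<exists>u. wf_trm E ?L u \<and> (\<forall>a\<in>?p. eval (ego_struct M) a u = Some (f (map ((!) a) js)))"
        if "f \<in> set (fs r)" for f
        by (rule term_pull[OF p n rich len js pr fs_hom_on[OF n that]])
    qed
    moreover have "map ((!) ?x) js = map ((!) x) js"
      using r(3) tuples_length[OF xt] by (intro map_nth_append_left) simp
    ultimately show ?thesis unfolding c holds_uh_concl.simps holds_Rel_Var by simp
  next
    fix h js assume c: "?\<gamma> = At (Eq (App h (map Var js)) (App h (map Var js)))"
    then have h: "h \<in> eops E'" "length js = op_arity h" "set js \<subseteq> {..<?N}"
      using wf(2) by (auto simp: list_all_iff)
    obtain n where n: "compatible_op sig M n h" using E' h(1) unfolding is_alter_ego_def by blast
    have g: "compatible_rel sig M (Suc n) (op_graph h)" using n by (simp add: compatible_op_def)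
    note d = compatible_dom[OF n]
    have len: "length js = n" using h(2) compatible_opD(4)[OF n] by simp
    have js: "set js \<subseteq> {..<?L}" using h(3) by auto
    have pd: "map ((!) a) js \<in> dom h" if "a \<in> ?p" for a
      using pconcl[OF that] unfolding c holds_uh_concl.simps holds.simps eval_App_Var by auto
    have rich: "op_rich_at sig M E ?p \<or> op_rich_at sig M E (dom h)"
      using ax' op[of "dom h"] unfolding c by (auto simp: list_all_iff)
    have pull: "\<exists>u. wf_trm E ?L u \<and> (\<forall>a\<in>?p. eval (ego_struct M) a u = Some (g (map ((!) a) js)))"
      if "hom_on sig M n (dom h) g" for g
      by (rule term_pull[OF p d(1) rich len js pd that])
    \<comment> \<open>The translated conclusion is \<open>\<beta>\<close> of \<open>dom h\<close>,
      but definedness in \<open>flat X\<close> means that \<open>\<beta>\<close> of the graph has a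
      solution. So the value of \<open>h\<close> needs a term of its own, and homomorphisms on the
      graph are pulled back through \<open>dom h\<close>.\<close>
    obtain t where t: "wf_trm E ?L t"
      "\<And>a. a \<in> ?p \<Longrightarrow> eval (ego_struct M) a t = Some (the (h (map ((!) a) js)))"
      using pull[OF d(2)] by blast
    have "\<exists>vs\<in>beta_rel X (op_graph h). map (eval X ?x) (map Var js @ [t]) = map Some vs"
    proof (rule beta_rel_of_terms[OF wf\<Psi> x\<Psi> g, where v = "\<lambda>a. map ((!) a) js @ [the (h (map ((!) a) js))]"])
      show "list_all (wf_trm E ?L) (map Var js @ [t])" using t(1) js by (auto simp: list_all_iff)
      show "map (eval (ego_struct M) a) (map Var js @ [t]) = map Some (map ((!) a) js @ [the (h (map ((!) a) js))])
          \<and> map ((!) a) js @ [the (h (map ((!) a) js))] \<in> op_graph h" if "a \<in> ?p" for a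
        using t(2)[OF that] pd[OF that] by (auto simp: op_graph_iff)
      show "\<exists>u. wf_trm E ?L u \<and> (\<forall>a\<in>?p. eval (ego_struct M) a u =
          Some (f (map ((!) a) js @ [the (h (map ((!) a) js))])))" if "f \<in> set (fs (op_graph h))" for f
        by (rule pull[OF hom_on_op_graph[OF n fs_hom_on[OF g that]]])
      show "length (map Var js @ [t]) = Suc n" using len by simp
    qed
    then obtain vs where vs: "vs \<in> beta_rel X (op_graph h)"
      "map (eval X ?x) (map Var js @ [t]) = map Some vs" by blast
    obtain us b where us: "vs = us @ [b]"
      using vs(2) by (cases vs rule: rev_cases) auto
    have "map (eval X ?x) (map Var js) = map Some us" using vs(2) unfolding us by simp
    then have "us = map ((!) ?x) js" unfolding map_eval_Var .
    also have "\<dots> = map ((!) x) js"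
      using h(3) tuples_length[OF xt] by (intro map_nth_append_left) simp
    finally have "pfun (flat X) h (map ((!) x) js) = Some b"
      using vs(1) unfolding flat_fun[OF n] us by simp
    then show ?thesis unfolding c holds_uh_concl.simps holds.simps eval_App_Var by simp
  next
    fix i j assume c: "?\<gamma> = At (Eq (Var i) (Var j))"
    have "holds_uh_concl X x ?\<gamma>" using wf(2) by (intro direct) (simp add: c)
    then show ?thesis by (simp add: c)
  next
    assume c: "?\<gamma> = Bot"
    have "holds_uh_concl X x ?\<gamma>" by (intro direct) (simp add: c)
    then show ?thesis by (simp add: c)
  qed
qed

end

section \<open>Topology of finite powers\<close>

lemma topspace_tuple_topology [simp]: "topspace (tuple_topology T n) = tuples n (topspace T)"
  by (auto simp: tuple_topology_def topspace_pullback_topology tuples_nth)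

lemma closedin_tuples [simp]: "closedin (tuple_topology T n) (tuples n (topspace T))"
  using closedin_topspace[of "tuple_topology T n"] by simp

lemma continuous_map_nth:
  assumes "i < n"
  shows "continuous_map (tuple_topology T n) T (\<lambda>xs. xs ! i)"
proof -
  have "continuous_map (tuple_topology T n) T ((\<lambda>y. y i) \<circ> (\<lambda>xs. \<lambda>i\<in>{..<n}. xs ! i))"
    unfolding tuple_topology_def using assms
    by (intro continuous_map_pullback continuous_map_product_projection) simp
  then show ?thesis by (rule continuous_map_eq) (use assms in simp)
qed

lemma continuous_map_into_tuple_topology:
  assumes "\<And>x. x \<in> topspace S \<Longrightarrow> length (g x) = n"
    and g: "\<And>i. i < n \<Longrightarrow> continuous_map S T (\<lambda>x. g x ! i)"
  shows "continuous_map S (tuple_topology T n) g"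
  unfolding tuple_topology_def
proof (rule continuous_map_pullback')
  show "continuous_map S (product_topology (\<lambda>_. T) {..<n}) ((\<lambda>xs. \<lambda>i\<in>{..<n}. xs ! i) \<circ> g)"
    unfolding continuous_map_componentwise using g by (auto cong: restrict_cong)
  have "g x \<in> tuples n (topspace T)" if x: "x \<in> topspace S" for x
  proof -
    have "g x ! i \<in> topspace T" if "i < n" for i
      using g[OF that] x by (auto simp: continuous_map_def)
    then show ?thesis using assms(1)[OF x] by (auto simp: tuples_def in_set_conv_nth)
  qed
  then show "topspace S \<subseteq> g -` tuples n (topspace T)" by blast
qed

text \<open>Compactness is carried over from the function space along the continuous surjection that
  lists the values.\<close>

lemma compact_space_tuple_topology:
  assumes "compact_space T"
  shows "compact_space (tuple_topology T n)"
proof -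
  let ?P = "product_topology (\<lambda>_. T) {..<n}"
  have "continuous_map ?P T (\<lambda>y. map y [0..<n] ! i)" if "i < n" for i
    using continuous_map_product_projection[of i "{..<n}" "\<lambda>_. T"] that by simp
  then have cont: "continuous_map ?P (tuple_topology T n) (\<lambda>y. map y [0..<n])"
    by (intro continuous_map_into_tuple_topology) simp_all
  have "compact_space ?P" using assms by (simp add: compact_space_product_topology)
  then have "compactin ?P (topspace ?P)" by (simp only: compact_space_def)
  from image_compactin[OF this cont]
  have "compactin (tuple_topology T n) ((\<lambda>y. map y [0..<n]) ` topspace ?P)" .
  moreover have "(\<lambda>y. map y [0..<n]) ` topspace ?P = tuples n (topspace T)"
  proof (intro equalityI subsetI)
    fix xs assume xs: "xs \<in> tuples n (topspace T)"
    have "xs = map (\<lambda>i\<in>{..<n}. xs ! i) [0..<n]"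
      using xs by (intro nth_equalityI) (auto simp: tuples_def)
    moreover have "(\<lambda>i\<in>{..<n}. xs ! i) \<in> topspace ?P" using xs by (auto simp: tuples_nth)
    ultimately show "xs \<in> (\<lambda>y. map y [0..<n]) ` topspace ?P" by (rule image_eqI)
  next
    fix xs assume "xs \<in> (\<lambda>y. map y [0..<n]) ` topspace ?P"
    then obtain y where y: "xs = map y [0..<n]" "y \<in> topspace ?P" by (rule imageE)
    have "y i \<in> topspace T" if "i < n" for i using y(2) that PiE_mem[of y "{..<n}" "\<lambda>_. topspace T" i] by simp
    then show "xs \<in> tuples n (topspace T)" unfolding y(1) by (intro tuplesI) auto
  qed
  ultimately show ?thesis by (simp add: compact_space_def)
qed

lemma Hausdorff_space_tuple_topology:
  assumes "Hausdorff_space T"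
  shows "Hausdorff_space (tuple_topology T n)"
proof (rule Hausdorff_space_injective_preimage)
  show "Hausdorff_space (product_topology (\<lambda>_. T) {..<n})"
    using assms by (simp add: Hausdorff_space_product_topology)
  show "continuous_map (tuple_topology T n) (product_topology (\<lambda>_. T) {..<n}) (\<lambda>xs. \<lambda>i\<in>{..<n}. xs ! i)"
    unfolding continuous_map_componentwise using continuous_map_nth by (auto cong: restrict_cong)
  show "inj_on (\<lambda>xs. \<lambda>i\<in>{..<n}. xs ! i) (topspace (tuple_topology T n))"
  proof (rule inj_onI)
    fix xs ys assume "xs \<in> topspace (tuple_topology T n)" "ys \<in> topspace (tuple_topology T n)"
      and eq: "(\<lambda>i\<in>{..<n}. xs ! i) = (\<lambda>i\<in>{..<n}. ys ! i)"
    then have "length xs = n" "length ys = n" by (auto simp: tuples_def)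
    moreover have "xs ! i = ys ! i" if "i < n" for i using fun_cong[OF eq, of i] that by simp
    ultimately show "xs = ys" by (intro nth_equalityI) auto
  qed
qed

text \<open>Projection is a closed map because the space is compact and Hausdorff. This is what
  keeps existential formulas closed.\<close>

lemma closedin_take_image:
  assumes T: "compact_space T" "Hausdorff_space T" and C: "closedin (tuple_topology T m) C" and n: "n \<le> m"
  shows "closedin (tuple_topology T n) (take n ` C)"
proof (rule compactin_imp_closedin[OF Hausdorff_space_tuple_topology[OF T(2)]])
  have "continuous_map (tuple_topology T m) (tuple_topology T n) (take n)"
  proof (rule continuous_map_into_tuple_topology)
    fix i assume i: "i < n"
    show "continuous_map (tuple_topology T m) T (\<lambda>x. take n x ! i)"
      using continuous_map_nth[of i m T] i n by simp
  qed (use n in \<open>simp add: tuples_def\<close>)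
  then show "compactin (tuple_topology T n) (take n ` C)"
    using closedin_compact_space[OF compact_space_tuple_topology[OF T(1)] C] image_compactin by blast
qed

lemma continuous_map_inverse:
  assumes "continuous_map S T g" "compact_space S" "Hausdorff_space T"
    and "\<And>x. x \<in> topspace S \<Longrightarrow> k (g x) = x"
    and "\<And>y. y \<in> topspace T \<Longrightarrow> k y \<in> topspace S \<and> g (k y) = y"
  shows "continuous_map T S k"
proof -
  have "closed_map S T g" by (rule continuous_imp_closed_map[OF assms(1-3)])
  moreover have "{y \<in> topspace T. k y \<in> C} = g ` C" if "closedin S C" for C
  proof -
    have C: "C \<subseteq> topspace S" using closedin_subset[OF that] .
    have "g x \<in> topspace T" if "x \<in> topspace S" for x
      using assms(1) that by (auto simp: continuous_map_def)
    then show ?thesis using assms(4,5) C by (auto simp: image_iff) (metis)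
  qed
  ultimately show ?thesis using assms(5) by (auto simp: continuous_map_closedin closed_map_def)
qed

lemma boolean_evals_closed:
  assumes X: "boolean_struct E X"
    and ts: "\<And>t. t \<in> set ts \<Longrightarrow> closedin (tuple_topology (ptop X) n) {xs \<in> tuples n (points X). eval X xs t \<noteq> None} \<and>
     continuous_map (subtopology (tuple_topology (ptop X) n) {xs \<in> tuples n (points X). eval X xs t \<noteq> None})
       (ptop X) (\<lambda>xs. the (eval X xs t))"
    and D: "D = {xs \<in> tuples n (points X). \<forall>t\<in>set ts. eval X xs t \<noteq> None}"
  shows "closedin (tuple_topology (ptop X) n) D"
    "continuous_map (subtopology (tuple_topology (ptop X) n) D) (tuple_topology (ptop X) (length ts))
      (\<lambda>xs. map (\<lambda>t. the (eval X xs t)) ts)"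
proof -
  let ?T = "tuple_topology (ptop X) n"
  let ?D = "\<lambda>t. {xs \<in> tuples n (points X). eval X xs t \<noteq> None}"
  have "closedin ?T (\<Inter> (insert (topspace ?T) (?D ` set ts)))"
    using ts by (intro closedin_Inter) auto
  moreover have "\<Inter> (insert (topspace ?T) (?D ` set ts)) = D" unfolding D by auto
  ultimately show "closedin ?T D" by simp
  show "continuous_map (subtopology ?T D) (tuple_topology (ptop X) (length ts))
      (\<lambda>xs. map (\<lambda>t. the (eval X xs t)) ts)"
  proof (rule continuous_map_into_tuple_topology)
    fix i assume i: "i < length ts"
    then have "continuous_map (subtopology ?T (?D (ts ! i))) (ptop X) (\<lambda>xs. the (eval X xs (ts ! i)))"
      using ts by simp
    then have "continuous_map (subtopology ?T D) (ptop X) (\<lambda>xs. the (eval X xs (ts ! i)))"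
      by (rule continuous_map_from_subtopology_mono) (use i in \<open>auto simp: D\<close>)
    then show "continuous_map (subtopology ?T D) (ptop X) (\<lambda>xs. map (\<lambda>t. the (eval X xs t)) ts ! i)"
      using i by simp
  qed simp
qed

lemma map_eval_the:
  "map (eval X xs) ts = map Some vs \<longleftrightarrow>
    (\<forall>t\<in>set ts. eval X xs t \<noteq> None) \<and> vs = map (\<lambda>t. the (eval X xs t)) ts"
proof
  assume *: "map (eval X xs) ts = map Some vs"
  then have "map (\<lambda>t. the (eval X xs t)) ts = map the (map Some vs)" by (metis (no_types, lifting) comp_def map_eq_conv map_map)
  then show "(\<forall>t\<in>set ts. eval X xs t \<noteq> None) \<and> vs = map (\<lambda>t. the (eval X xs t)) ts"
    using map_Some_not_None[OF *] by (simp add: comp_def)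
qed auto

text \<open>Closedness of the domain and continuity of the term function are proved together: the
  domain of \<open>App h ts\<close> is a preimage under the continuous map given by
  \<open>ts\<close>.\<close>

lemma boolean_eval_closed:
  assumes X: "boolean_struct E X" and wf: "wf_trm E n t"
    and D: "D = {xs \<in> tuples n (points X). eval X xs t \<noteq> None}"
  shows "closedin (tuple_topology (ptop X) n) D \<and>
    continuous_map (subtopology (tuple_topology (ptop X) n) D) (ptop X) (\<lambda>xs. the (eval X xs t))"
  using wf D
proof (induction t arbitrary: D)
  case (Var i)
  then have "D = topspace (tuple_topology (ptop X) n)" by simp
  then show ?case
    using continuous_map_nth[of i n "ptop X"] Var by (simp add: continuous_map_from_subtopology)
next
  case (App h ts)
  let ?T = "tuple_topology (ptop X) n"
  define D0 where "D0 = {xs \<in> tuples n (points X). \<forall>t\<in>set ts. eval X xs t \<noteq> None}"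
  define g where "g = (\<lambda>xs. map (\<lambda>t. the (eval X xs t)) ts)"
  have IH: "closedin ?T {xs \<in> tuples n (points X). eval X xs t \<noteq> None} \<and>
     continuous_map (subtopology ?T {xs \<in> tuples n (points X). eval X xs t \<noteq> None})
       (ptop X) (\<lambda>xs. the (eval X xs t))" if "t \<in> set ts" for t
    using App.IH[OF that _ refl] App.prems(1) that by (simp add: list_all_iff)
  have D0: "closedin ?T D0"
    and g: "continuous_map (subtopology ?T D0) (tuple_topology (ptop X) (length ts)) g"
    unfolding g_def by (rule boolean_evals_closed[OF X IH D0_def], assumption)+
  have h: "h \<in> eops E" "length ts = op_arity h" using App.prems(1) by auto
  have hc: "closedin (tuple_topology (ptop X) (length ts)) (dom (pfun X h))"
    "continuous_map (subtopology (tuple_topology (ptop X) (length ts)) (dom (pfun X h))) (ptop X)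
      (\<lambda>xs. the (pfun X h xs))" using X h by (auto simp: boolean_struct_def)
  have ev: "eval X xs (App h ts) = Some b \<longleftrightarrow>
      (\<forall>t\<in>set ts. eval X xs t \<noteq> None) \<and> pfun X h (g xs) = Some b" for xs b
    unfolding eval_App_iff map_eval_the g_def by auto
  have D: "D = {xs \<in> topspace (subtopology ?T D0). g xs \<in> dom (pfun X h)}"
  proof -
    have "eval X xs (App h ts) \<noteq> None \<longleftrightarrow> (\<forall>t\<in>set ts. eval X xs t \<noteq> None) \<and> g xs \<in> dom (pfun X h)" for xs
      using ev[of xs] by auto
    then show ?thesis unfolding App.prems(2) D0_def by auto
  qed
  have "closedin (subtopology ?T D0) D"
    unfolding D by (rule closedin_continuous_map_preimage[OF g hc(1)])
  then have cl: "closedin ?T D" using D0 by (rule closedin_trans_full)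
  have DD0: "D \<subseteq> D0" unfolding D by auto
  have "continuous_map (subtopology ?T D) (subtopology (tuple_topology (ptop X) (length ts)) (dom (pfun X h))) g"
    unfolding continuous_map_in_subtopology
    using continuous_map_from_subtopology_mono[OF g DD0] by (auto simp: D)
  from continuous_map_compose[OF this hc(2)]
  have "continuous_map (subtopology ?T D) (ptop X) (\<lambda>xs. the (eval X xs (App h ts)))"
  proof (rule continuous_map_eq)
    fix xs assume "xs \<in> topspace (subtopology ?T D)"
    then have "eval X xs (App h ts) \<noteq> None" using App.prems(2) by auto
    then obtain b where b: "eval X xs (App h ts) = Some b" by blast
    show "((\<lambda>xs. the (pfun X h xs)) \<circ> g) xs = the (eval X xs (App h ts))" using b ev[of xs b] by simp
  qed
  then show ?case using cl by blast
qed

lemma boolean_holds_closed: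
  assumes X: "boolean_struct E X" and wf: "wf_atomic E n \<alpha>"
  shows "closedin (tuple_topology (ptop X) n) {xs \<in> tuples n (points X). holds X xs \<alpha>}"
proof (cases \<alpha>)
  let ?T = "tuple_topology (ptop X) n"
  {
    case (Eq s t)
    define D where "D = {xs \<in> tuples n (points X). \<forall>t\<in>set [s, t]. eval X xs t \<noteq> None}"
    have c: "closedin ?T {xs \<in> tuples n (points X). eval X xs t' \<noteq> None} \<and>
      continuous_map (subtopology ?T {xs \<in> tuples n (points X). eval X xs t' \<noteq> None})
       (ptop X) (\<lambda>xs. the (eval X xs t'))" if "t' \<in> set [s, t]" for t'
      using boolean_eval_closed[OF X _ refl, of n t'] that wf Eq by auto
    have D: "closedin ?T D"
      and g: "continuous_map (subtopology ?T D) (tuple_topology (ptop X) (length [s, t])) (\<lambda>xs. map (\<lambda>t. the (eval X xs t)) [s, t])"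
      by (rule boolean_evals_closed[OF X c D_def], assumption)+
    have st: "continuous_map (subtopology ?T D) (ptop X) (\<lambda>xs. the (eval X xs s))"
      "continuous_map (subtopology ?T D) (ptop X) (\<lambda>xs. the (eval X xs t))"
      using continuous_map_compose[OF g continuous_map_nth[of 0 "length [s, t]" "ptop X"]]
        continuous_map_compose[OF g continuous_map_nth[of 1 "length [s, t]" "ptop X"]]
      by (simp_all add: comp_def)
    have "closedin (subtopology ?T D) {xs \<in> topspace (subtopology ?T D). the (eval X xs s) = the (eval X xs t)}"
      by (rule closedin_continuous_maps_eq[OF _ st]) (use X in \<open>simp add: boolean_struct_def\<close>)
    then have "closedin ?T {xs \<in> topspace (subtopology ?T D). the (eval X xs s) = the (eval X xs t)}"
      using D by (rule closedin_trans_full)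
    moreover have "{xs \<in> topspace (subtopology ?T D). the (eval X xs s) = the (eval X xs t)} =
        {xs \<in> tuples n (points X). holds X xs \<alpha>}"
      unfolding Eq D_def by auto
    ultimately show ?thesis by simp
  next
    case (Rel r ts)
    then have ts: "list_all (wf_trm E n) ts" "r \<in> erels E" "length ts = rel_arity r" using wf by auto
    define D where "D = {xs \<in> tuples n (points X). \<forall>t\<in>set ts. eval X xs t \<noteq> None}"
    let ?g = "\<lambda>xs. map (\<lambda>t. the (eval X xs t)) ts"
    have c: "closedin ?T {xs \<in> tuples n (points X). eval X xs t' \<noteq> None} \<and>
      continuous_map (subtopology ?T {xs \<in> tuples n (points X). eval X xs t' \<noteq> None})
       (ptop X) (\<lambda>xs. the (eval X xs t'))" if "t' \<in> set ts" for t'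
      using boolean_eval_closed[OF X _ refl, of n t'] that ts by (auto simp: list_all_iff)
    have D: "closedin ?T D"
      and g: "continuous_map (subtopology ?T D) (tuple_topology (ptop X) (length ts)) ?g"
      by (rule boolean_evals_closed[OF X c D_def], assumption)+
    have "closedin (tuple_topology (ptop X) (length ts)) (prel X r)"
      using X ts by (auto simp: boolean_struct_def)
    from closedin_continuous_map_preimage[OF g this]
    have "closedin ?T {xs \<in> topspace (subtopology ?T D). ?g xs \<in> prel X r}"
      using D by (rule closedin_trans_full)
    moreover have "{xs \<in> topspace (subtopology ?T D). ?g xs \<in> prel X r} =
        {xs \<in> tuples n (points X). holds X xs \<alpha>}"
      unfolding Rel holds_Rel_iff D_def map_eval_the by auto
    ultimately show ?thesis by simp
  }
qed

lemma boolean_defined_rel_closed: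
  assumes X: "boolean_struct E X" and wf: "wf_ca E n \<Phi>"
  shows "closedin (tuple_topology (ptop X) n) (defined_rel X n \<Phi>)"
proof -
  let ?T = "tuple_topology (ptop X) n"
  have "closedin ?T (\<Inter> (insert (topspace ?T) ((\<lambda>\<alpha>. {xs \<in> tuples n (points X). holds X xs \<alpha>}) ` set \<Phi>)))"
    using boolean_holds_closed[OF X] wf by (intro closedin_Inter) (auto simp: wf_ca_def)
  moreover have "\<Inter> (insert (topspace ?T) ((\<lambda>\<alpha>. {xs \<in> tuples n (points X). holds X xs \<alpha>}) ` set \<Phi>)) =
      defined_rel X n \<Phi>" unfolding defined_rel_def by auto
  ultimately show ?thesis by simp
qed

text \<open>Quantifying out the witnesses is the projection \<open>take n\<close> of a closed
  relation.\<close>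

lemma (in hat_ego) beta_rel_closed:
  assumes X: "boolean_struct E X" and r: "compatible_rel sig M n r"
  shows "closedin (tuple_topology (ptop X) n) (beta_rel X r)"
proof -
  let ?m = "n + length (fs r)"
  have "beta_rel X r = take n ` defined_rel X ?m (\<beta>h r)"
  proof (intro equalityI subsetI)
    fix xs assume "xs \<in> beta_rel X r"
    then obtain ws where "xs \<in> tuples n (points X)" "xs @ ws \<in> defined_rel X ?m (\<beta>h r)"
      by (auto elim: beta_relE[OF r])
    moreover from this have "xs = take n (xs @ ws)" by (simp add: tuples_def)
    ultimately show "xs \<in> take n ` defined_rel X ?m (\<beta>h r)" by blast
  next
    fix xs assume "xs \<in> take n ` defined_rel X ?m (\<beta>h r)"
    then obtain ys where ys: "ys \<in> defined_rel X ?m (\<beta>h r)" "xs = take n ys" by blast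
    show "xs \<in> beta_rel X r"
      by (rule beta_relI[OF r, of _ "drop n ys"]) (use ys in \<open>auto simp: defined_rel_def tuples_def\<close>)
  qed
  moreover have "closedin (tuple_topology (ptop X) n) (take n ` defined_rel X ?m (\<beta>h r))"
    by (rule closedin_take_image[OF _ _ boolean_defined_rel_closed[OF X hatD(2)[OF r]]])
      (use X in \<open>simp_all add: boolean_struct_def\<close>)
  ultimately show ?thesis by simp
qed

text \<open>A closed graph over a compact Hausdorff space gives a continuous operation on a closed
  domain: the preimage of a closed set is the projection of a closed part of the graph, and the
  domain is the preimage of the whole space.\<close>

lemma (in uh_model) boolean_flat:
  assumes X: "boolean_struct E X" and E': "is_alter_ego sig M E'"
  shows "boolean_struct E' (flat X)"
proof -
  have T: "compact_space (ptop X)" "Hausdorff_space (ptop X)" using X by (simp_all add: boolean_struct_def)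
  have op: "closedin (tuple_topology (ptop X) (op_arity h)) (dom (pfun (flat X) h)) \<and>
      continuous_map (subtopology (tuple_topology (ptop X) (op_arity h)) (dom (pfun (flat X) h))) (ptop X)
        (\<lambda>xs. the (pfun (flat X) h xs))" if "h \<in> eops E'" for h
  proof -
    obtain n where h: "compatible_op sig M n h" using E' \<open>h \<in> eops E'\<close> unfolding is_alter_ego_def by blast
    have g: "compatible_rel sig M (Suc n) (op_graph h)" using h by (simp add: compatible_op_def)
    let ?G = "beta_rel X (op_graph h)" and ?T = "tuple_topology (ptop X) n"
    have G: "closedin (tuple_topology (ptop X) (Suc n)) ?G" by (rule beta_rel_closed[OF X g])
    have Gt: "?G \<subseteq> tuples (Suc n) (points X)" using closedin_subset[OF G] by simp
    have pre: "{xs \<in> dom (pfun (flat X) h). the (pfun (flat X) h xs) \<in> C} =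
        take n ` {ys \<in> ?G. ys ! n \<in> C}" for C
    proof (intro equalityI subsetI)
      fix xs assume "xs \<in> {xs \<in> dom (pfun (flat X) h). the (pfun (flat X) h xs) \<in> C}"
      then obtain b where b: "xs @ [b] \<in> ?G" "b \<in> C" using flat_fun[OF h] by auto
      then have "length xs = n" using Gt by (auto simp: tuples_def)
      then show "xs \<in> take n ` {ys \<in> ?G. ys ! n \<in> C}"
        using b by (intro image_eqI[of _ _ "xs @ [b]"]) (simp_all add: nth_append)
    next
      fix xs assume "xs \<in> take n ` {ys \<in> ?G. ys ! n \<in> C}"
      then obtain ys where ys: "ys \<in> ?G" "ys ! n \<in> C" "xs = take n ys" by blast
      then have "length ys = Suc n" using Gt by (auto simp: tuples_def)
      then have "ys = xs @ [ys ! n]" using ys(3) by (simp add: take_Suc_conv_app_nth[symmetric])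
      then have "pfun (flat X) h xs = Some (ys ! n)" using ys(1) flat_fun[OF h] by metis
      then show "xs \<in> {xs \<in> dom (pfun (flat X) h). the (pfun (flat X) h xs) \<in> C}" using ys(2) by auto
    qed
    have cl: "closedin ?T {xs \<in> dom (pfun (flat X) h). the (pfun (flat X) h xs) \<in> C}"
      if C: "closedin (ptop X) C" for C
    proof -
      have "closedin (tuple_topology (ptop X) (Suc n)) {ys \<in> ?G. ys ! n \<in> C}"
        by (rule closedin_continuous_map_preimage_gen[OF continuous_map_nth G C]) simp
      from closedin_take_image[OF T this, of n] show ?thesis unfolding pre by simp
    qed
    have pts: "the (pfun (flat X) h xs) \<in> points X" if "xs \<in> dom (pfun (flat X) h)" for xs
    proof -
      obtain b where b: "pfun (flat X) h xs = Some b" using \<open>xs \<in> dom (pfun (flat X) h)\<close> by blast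
      then have "xs @ [b] \<in> tuples (Suc n) (points X)" using Gt flat_fun[OF h] by blast
      then show ?thesis using b by (simp add: tuples_def)
    qed
    then have "{xs \<in> dom (pfun (flat X) h). the (pfun (flat X) h xs) \<in> points X} = dom (pfun (flat X) h)"
      by blast
    then have d: "closedin ?T (dom (pfun (flat X) h))" using cl[of "points X"] by simp
    then have dt: "dom (pfun (flat X) h) \<subseteq> topspace ?T" by (rule closedin_subset)
    have "continuous_map (subtopology ?T (dom (pfun (flat X) h))) (ptop X) (\<lambda>xs. the (pfun (flat X) h xs))"
      unfolding continuous_map_closedin closedin_closed_subtopology[OF d]
    proof (intro conjI allI impI)
      show "(\<lambda>xs. the (pfun (flat X) h xs)) \<in> topspace (subtopology ?T (dom (pfun (flat X) h))) \<rightarrow> points X"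
        using pts by auto
      fix C assume C: "closedin (ptop X) C"
      have *: "{xs \<in> topspace (subtopology ?T (dom (pfun (flat X) h))). the (pfun (flat X) h xs) \<in> C} =
          {xs \<in> dom (pfun (flat X) h). the (pfun (flat X) h xs) \<in> C}"
        unfolding topspace_subtopology using dt by blast
      show "closedin ?T {xs \<in> topspace (subtopology ?T (dom (pfun (flat X) h))). the (pfun (flat X) h xs) \<in> C}"
        unfolding * by (rule cl[OF C])
      show "{xs \<in> topspace (subtopology ?T (dom (pfun (flat X) h))). the (pfun (flat X) h xs) \<in> C} \<subseteq> dom (pfun (flat X) h)"
        by auto
    qed
    then show ?thesis using d compatible_opD(4)[OF h] by simp
  qed
  have rel: "closedin (tuple_topology (ptop X) (rel_arity r)) (beta_rel X r)" if "r \<in> erels E'" for r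
  proof -
    obtain n where r: "compatible_rel sig M n r" using E' \<open>r \<in> erels E'\<close> unfolding is_alter_ego_def by blast
    show ?thesis using beta_rel_closed[OF X r] compatible_rel_arity[OF r] by simp
  qed
  show ?thesis
    using X op rel pstruct_flat[OF E'] unfolding boolean_struct_def by simp
qed

lemma pstruct_prel: "is_pstruct E X \<Longrightarrow> r \<in> erels E \<Longrightarrow> xs \<in> prel X r \<Longrightarrow> set xs \<subseteq> points X"
  unfolding is_pstruct_def tuples_def by blast

lemma pstruct_pfun:
  assumes "is_pstruct E X" "h \<in> eops E" "pfun X h xs = Some b"
  shows "xs \<in> tuples (op_arity h) (points X)" "b \<in> points X"
  using assms unfolding is_pstruct_def ran_def by blast+

text \<open>Relations and graphs of operations are treated uniformly as relations between points.\<close>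

definition facts :: "'m alter_ego \<Rightarrow> ('m, 'x) pstruct \<Rightarrow> ('m frel \<times> 'x list) set" where
  "facts E X = {(r, xs). r \<in> erels E \<and> xs \<in> prel X r} \<union>
     {(op_graph h, xs @ [b]) | h xs b. h \<in> eops E \<and> pfun X h xs = Some b}"

lemma zhom_ego_iff: "u \<in> zhom E X (ego_struct M) \<longleftrightarrow> u \<in> points X \<rightarrow>\<^sub>E carr M \<and>
    continuous_map (ptop X) (discrete_topology (carr M)) u \<and> (\<forall>r xs. (r, xs) \<in> facts E X \<longrightarrow> map u xs \<in> r)"
proof -
  have "(\<forall>r xs. (r, xs) \<in> facts E X \<longrightarrow> map u xs \<in> r) \<longleftrightarrow>
    (\<forall>r\<in>erels E. \<forall>xs\<in>prel X r. map u xs \<in> r) \<and>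
    (\<forall>h\<in>eops E. \<forall>xs b. pfun X h xs = Some b \<longrightarrow> map u (xs @ [b]) \<in> op_graph h)"
    unfolding facts_def by blast
  then show ?thesis by (simp add: zhom_def op_graph_iff)
qed

lemma facts_compatible:
  assumes E: "is_alter_ego sig M E" and X: "is_pstruct E X" and f: "(r, xs) \<in> facts E X"
  obtains n where "compatible_rel sig M n r" "xs \<in> tuples n (points X)"
  using f unfolding facts_def
proof (elim UnE CollectE exE conjE case_prodE)
  fix r' ys assume r: "(r, xs) = (r', ys)" "r' \<in> erels E" "ys \<in> prel X r'"
  then obtain n where n: "compatible_rel sig M n r" using E unfolding is_alter_ego_def by blast
  have "xs \<in> tuples n (points X)" using X r compatible_rel_arity[OF n] by (auto simp: is_pstruct_def)
  with n show thesis by (rule that)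
next
  fix h ys b assume h: "(r, xs) = (op_graph h, ys @ [b])" "h \<in> eops E" "pfun X h ys = Some b"
  then obtain n where n: "compatible_op sig M n h" using E unfolding is_alter_ego_def by blast
  have "xs \<in> tuples (Suc n) (points X)"
    using pstruct_pfun[OF X h(2,3)] h(1) compatible_opD(4)[OF n] by (simp add: tuples_def)
  with n h(1) show thesis by (intro that) (simp_all add: compatible_op_def)
qed

section \<open>Dual structures and dual algebras\<close>

text \<open>Homomorphisms to \<open>M\<close> are closed under every compatible partial operation,
  here given as a homomorphism \<open>f\<close> on its domain. With \<open>f\<close> from
  \<open>fs r\<close> this provides points of the dual as witnesses for
  \<open>\<beta>\<close>.\<close>

lemma alg_hom_comp:
  assumes A: "is_alg sig A" and r: "compatible_rel sig M n r" and f: "hom_on sig M n r f"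
    and xs: "length xs = n" "set xs \<subseteq> alg_hom sig A M"
    and pt: "\<And>t. t \<in> carr A \<Longrightarrow> map (\<lambda>x. x t) xs \<in> r"
  shows "(\<lambda>t\<in>carr A. f (map (\<lambda>x. x t) xs)) \<in> alg_hom sig A M"
  unfolding alg_hom_def mem_Collect_eq
proof (intro conjI allI impI)
  have "f as \<in> carr M" if "as \<in> r" for as using f that by (auto simp: hom_on_def)
  then show "(\<lambda>t\<in>carr A. f (map (\<lambda>x. x t) xs)) \<in> carr A \<rightarrow>\<^sub>E carr M" using pt by auto
  fix F q ts assume F: "sig F = Some q" "ts \<in> tuples q (carr A)"
  have FA: "fop A F ts \<in> carr A" using A F by (auto simp: is_alg_def)
  have tsA: "t \<in> carr A" if "t \<in> set ts" for t using F(2) that by (auto simp: tuples_def)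
  define zs where "zs = map (\<lambda>t. map (\<lambda>x. x t) xs) ts"
  have zs: "zs \<in> tuples q r" using F(2) pt by (auto simp: zs_def tuples_def)
  have "map (\<lambda>x. x (fop A F ts)) xs = fop (tuple_power M n) F zs"
  proof (rule nth_equalityI)
    show "length (map (\<lambda>x. x (fop A F ts)) xs) = length (fop (tuple_power M n) F zs)"
      using xs(1) by (simp add: tuple_power_def)
    fix i assume "i < length (map (\<lambda>x. x (fop A F ts)) xs)"
    then have i: "i < n" using xs(1) by simp
    then have "xs ! i \<in> alg_hom sig A M" using xs by (auto simp: subset_iff)
    then have "(xs ! i) (fop A F ts) = fop M F (map (xs ! i) ts)" using F by (auto simp: alg_hom_def)
    moreover have "map (\<lambda>z. z ! i) zs = map (xs ! i) ts" using i xs(1) by (simp add: zs_def)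
    ultimately show "map (\<lambda>x. x (fop A F ts)) xs ! i = fop (tuple_power M n) F zs ! i"
      using i xs(1) by (simp add: tuple_power_def)
  qed
  then have "f (map (\<lambda>x. x (fop A F ts)) xs) = fop M F (map f zs)"
    using f F(1) zs by (simp add: hom_on_def)
  moreover have "map f zs = map (\<lambda>t\<in>carr A. f (map (\<lambda>x. x t) xs)) ts"
    using tsA by (simp add: zs_def)
  ultimately show "(\<lambda>t\<in>carr A. f (map (\<lambda>x. x t) xs)) (fop A F ts) =
      fop M F (map (\<lambda>t\<in>carr A. f (map (\<lambda>x. x t) xs)) ts)" using FA by simp
qed

lemma alg_hom_ext: "alg_hom sig A M \<subseteq> carr A \<rightarrow>\<^sub>E carr M"
  by (auto simp: alg_hom_def)

lemma sub_power_simps: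
  assumes "Y \<subseteq> S \<rightarrow>\<^sub>E carr M"
  shows "points (substruct (struct_power (ego_struct M) S) Y) = Y"
    "ptop (substruct (struct_power (ego_struct M) S) Y) =
      subtopology (product_topology (\<lambda>_. discrete_topology (carr M)) S) Y"
    "xs \<in> prel (substruct (struct_power (ego_struct M) S) Y) r \<longleftrightarrow>
      set xs \<subseteq> Y \<and> (\<forall>s\<in>S. map (\<lambda>x. x s) xs \<in> r)"
  using assms by (auto simp: substruct_def struct_power_def)

lemma pfun_sub_power:
  assumes Y: "Y \<subseteq> S \<rightarrow>\<^sub>E carr M"
  shows "pfun (substruct (struct_power (ego_struct M) S) Y) h xs = Some b \<longleftrightarrow>
    set xs \<subseteq> Y \<and> b \<in> extensional S \<and> (\<forall>s\<in>S. h (map (\<lambda>x. x s) xs) = Some (b s))"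
    (is "?l \<longleftrightarrow> ?r")
proof
  assume ?l
  then have h: "set xs \<subseteq> Y" "\<forall>s\<in>S. map (\<lambda>x. x s) xs \<in> dom h"
    "b = (\<lambda>s\<in>S. the (h (map (\<lambda>x. x s) xs)))"
    by (auto simp: substruct_def struct_power_def split: if_splits)
  have "h (map (\<lambda>x. x s) xs) = Some (b s)" if s: "s \<in> S" for s
  proof -
    have "map (\<lambda>x. x s) xs \<in> dom h" using h(2) s by blast
    then show ?thesis using s by (auto simp: h(3))
  qed
  then show ?r using h(1) by (simp add: h(3))
next
  assume r: ?r
  then have "\<forall>s\<in>S. map (\<lambda>x. x s) xs \<in> dom h" by auto
  moreover have "(\<lambda>s\<in>S. the (h (map (\<lambda>x. x s) xs))) = b"
    using r by (intro extensionalityI[of _ S]) auto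
  moreover have "set xs \<subseteq> (S \<rightarrow>\<^sub>E carr M)" using r Y by blast
  ultimately show ?l using r by (simp add: substruct_def struct_power_def)
qed

lemma points_dual_D [simp]: "points (dual_D sig M A) = alg_hom sig A M"
  unfolding dual_D_def by (rule sub_power_simps(1)[OF alg_hom_ext])

lemma ptop_dual_D: "ptop (dual_D sig M A) =
    subtopology (product_topology (\<lambda>_. discrete_topology (carr M)) (carr A)) (alg_hom sig A M)"
  unfolding dual_D_def by (rule sub_power_simps(2)[OF alg_hom_ext])

lemma prel_dual_D: "xs \<in> prel (dual_D sig M A) r \<longleftrightarrow>
    set xs \<subseteq> alg_hom sig A M \<and> (\<forall>t\<in>carr A. map (\<lambda>x. x t) xs \<in> r)"
  unfolding dual_D_def by (rule sub_power_simps(3)[OF alg_hom_ext])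

lemma pfun_dual_D: "pfun (dual_D sig M A) h xs = Some b \<longleftrightarrow>
    set xs \<subseteq> alg_hom sig A M \<and> b \<in> extensional (carr A) \<and> (\<forall>t\<in>carr A. h (map (\<lambda>x. x t) xs) = Some (b t))"
  unfolding dual_D_def by (rule pfun_sub_power[OF alg_hom_ext])

lemma dual_D_op_hom:
  assumes A: "is_alg sig A" and h: "compatible_op sig M n h" and b: "pfun (dual_D sig M A) h xs = Some b"
  shows "length xs = n" "b \<in> alg_hom sig A M"
proof -
  note b' = b[unfolded pfun_dual_D]
  obtain t where "t \<in> carr A" using A by (auto simp: is_alg_def)
  then have "map (\<lambda>x. x t) xs \<in> tuples n (carr M)" using b' compatible_opD(3)[OF h] by blast
  then show len: "length xs = n" by (simp add: tuples_def)
  have "(\<lambda>t\<in>carr A. the (h (map (\<lambda>x. x t) xs))) \<in> alg_hom sig A M"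
    using b' by (intro alg_hom_comp[OF A compatible_dom[OF h] len]) auto
  moreover have "(\<lambda>t\<in>carr A. the (h (map (\<lambda>x. x t) xs))) = b"
    using b' by (intro extensionalityI[of _ "carr A"]) auto
  ultimately show "b \<in> alg_hom sig A M" by simp
qed

text \<open>The index \<open>s\<close> bounds lengths: over an empty index set, lists of every
  length would be related.\<close>

lemma pstruct_sub_power:
  fixes M :: "('f, 'm) alg"
  assumes E: "is_alter_ego sig M E" and S: "s \<in> S"
    and Y: "closed_under_ops E (struct_power (ego_struct M) S) Y"
  shows "is_pstruct E (substruct (struct_power (ego_struct M) S) Y)"
proof -
  have YP: "Y \<subseteq> S \<rightarrow>\<^sub>E carr M" using Y by (simp add: closed_under_ops_def struct_power_def)
  note sub = sub_power_simps[OF YP] pfun_sub_power[OF YP]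
  show ?thesis
    unfolding is_pstruct_def sub(1)
  proof (intro conjI ballI)
    fix h assume h: "h \<in> eops E"
    then obtain n where n: "compatible_op sig M n h" using E unfolding is_alter_ego_def by blast
    have *: "xs \<in> tuples n Y \<and> b \<in> Y"
      if xs: "pfun (substruct (struct_power (ego_struct M) S) Y) h xs = Some b" for xs b
    proof -
      have "map (\<lambda>x. x s) xs \<in> tuples n (carr M)"
        using xs S compatible_opD(3)[OF n] unfolding sub(4) by blast
      moreover have "set xs \<subseteq> Y" "b \<in> Y"
        using xs Y h unfolding closed_under_ops_def by (auto simp: substruct_def split: if_splits)
      ultimately show ?thesis by (simp add: tuples_def)
    qed
    show "dom (pfun (substruct (struct_power (ego_struct M) S) Y) h) \<subseteq> tuples (op_arity h) Y"
      unfolding compatible_opD(4)[OF n] using * by blast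
    show "ran (pfun (substruct (struct_power (ego_struct M) S) Y) h) \<subseteq> Y" unfolding ran_def using * by blast
  next
    fix r assume "r \<in> erels E"
    then obtain n where n: "compatible_rel sig M n r" using E unfolding is_alter_ego_def by blast
    show "prel (substruct (struct_power (ego_struct M) S) Y) r \<subseteq> tuples (rel_arity r) Y"
      unfolding compatible_rel_arity[OF n] using S compatible_relD(2)[OF n] by (force simp: sub(3) tuples_def)
  qed
qed

lemma closed_under_ops_alg_hom:
  assumes A: "is_alg sig A" and E: "is_alter_ego sig M E"
  shows "closed_under_ops E (struct_power (ego_struct M) (carr A)) (alg_hom sig A M)"
  unfolding closed_under_ops_def
proof (intro conjI ballI allI impI)
  show "alg_hom sig A M \<subseteq> points (struct_power (ego_struct M) (carr A))"
    using alg_hom_ext by (simp add: struct_power_def)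
  fix h xs b assume h: "h \<in> eops E" "set xs \<subseteq> alg_hom sig A M"
    "pfun (struct_power (ego_struct M) (carr A)) h xs = Some b"
  then obtain n where n: "compatible_op sig M n h" using E unfolding is_alter_ego_def by blast
  have "pfun (dual_D sig M A) h xs = Some b" using h(2,3) by (simp add: dual_D_def substruct_def)
  from dual_D_op_hom(2)[OF A n this] show "b \<in> alg_hom sig A M" .
qed

lemma pstruct_dual_D:
  assumes A: "is_alg sig A" and E: "is_alter_ego sig M E"
  shows "is_pstruct E (dual_D sig M A)"
proof -
  obtain t where "t \<in> carr A" using A by (auto simp: is_alg_def)
  from pstruct_sub_power[OF E this closed_under_ops_alg_hom[OF A E]] show ?thesis by (simp add: dual_D_def)
qed

lemma facts_dual_D:
  assumes A: "is_alg sig A" and E: "is_alter_ego sig M E" and f: "(r, xs) \<in> facts E (dual_D sig M A)"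
  shows "set xs \<subseteq> alg_hom sig A M" "t \<in> carr A \<Longrightarrow> map (\<lambda>x. x t) xs \<in> r"
proof -
  have "set xs \<subseteq> alg_hom sig A M \<and> (\<forall>t\<in>carr A. map (\<lambda>x. x t) xs \<in> r)"
    using f unfolding facts_def
  proof (elim UnE CollectE exE conjE case_prodE)
    fix h ys b assume h: "(r, xs) = (op_graph h, ys @ [b])" "h \<in> eops E" "pfun (dual_D sig M A) h ys = Some b"
    then obtain n where n: "compatible_op sig M n h" using E unfolding is_alter_ego_def by blast
    show ?thesis
      using h(1) h(3)[unfolded pfun_dual_D] dual_D_op_hom(2)[OF A n h(3)] by (auto simp: op_graph_iff)
  qed (auto simp: prel_dual_D)
  then show "set xs \<subseteq> alg_hom sig A M" "t \<in> carr A \<Longrightarrow> map (\<lambda>x. x t) xs \<in> r" by blast+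
qed

text \<open>Structure in a power is defined coordinatewise, which is exactly what makes the
  projections reflect it.\<close>

lemma embeds_sub_power:
  fixes M :: "('f, 'm) alg"
  assumes Y: "closed_under_ops E (struct_power (ego_struct M) S) Y"
  shows "embeds E M (substruct (struct_power (ego_struct M) S) Y) ((\<lambda>s. \<lambda>y\<in>Y. y s) ` S)"
proof -
  let ?P = "struct_power (ego_struct M) S" and ?p = "\<lambda>s. \<lambda>y\<in>Y. y s :: 'm"
  have YP: "Y \<subseteq> S \<rightarrow>\<^sub>E carr M" using Y by (simp add: closed_under_ops_def struct_power_def)
  note sub = sub_power_simps[OF YP] pfun_sub_power[OF YP]
  have pm: "map (?p s) xs = map (\<lambda>x. x s) xs" if "set xs \<subseteq> Y" for s xs using that by auto
  have z: "?p s \<in> zhom E (substruct ?P Y) (ego_struct M)" if s: "s \<in> S" for s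
    unfolding zhom_ego_iff sub(1)
  proof (intro conjI allI impI)
    show "?p s \<in> Y \<rightarrow>\<^sub>E carr M" using YP s by auto
    have "continuous_map (ptop (substruct ?P Y)) (discrete_topology (carr M)) (\<lambda>y. y s)"
      unfolding sub(2) using s by (intro continuous_map_from_subtopology continuous_map_product_projection)
    then show "continuous_map (ptop (substruct ?P Y)) (discrete_topology (carr M)) (?p s)"
      by (rule continuous_map_eq) (simp add: sub(1))
    fix r xs assume "(r, xs) \<in> facts E (substruct ?P Y)"
    then show "map (?p s) xs \<in> r"
      unfolding facts_def
    proof (elim UnE CollectE exE conjE case_prodE)
      fix r' ys assume r: "(r, xs) = (r', ys)" "ys \<in> prel (substruct ?P Y) r'"
      then have "set xs \<subseteq> Y" "map (\<lambda>x. x s) xs \<in> r" using s by (auto simp: sub(3))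
      then show ?thesis by (simp only: pm)
    next
      fix h ys b assume h: "(r, xs) = (op_graph h, ys @ [b])" "h \<in> eops E" "pfun (substruct ?P Y) h ys = Some b"
      then have "pfun ?P h ys = Some b" "set ys \<subseteq> Y" by (auto simp: substruct_def split: if_splits)
      then have "b \<in> Y" using Y h(2) unfolding closed_under_ops_def by blast
      then show ?thesis using h(1,3) s \<open>set ys \<subseteq> Y\<close> by (simp add: sub(4) pm op_graph_iff)
    qed
  qed
  show ?thesis
    unfolding embeds_def sub(1)
  proof (intro conjI ballI impI)
    show "?p ` S \<subseteq> zhom E (substruct ?P Y) (ego_struct M)" using z by blast
    fix x y assume x: "x \<in> Y" and y: "y \<in> Y" and eq: "\<forall>u\<in>?p ` S. u x = u y"
    show "x = y"
    proof (rule PiE_ext)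
      show "x \<in> S \<rightarrow>\<^sub>E carr M" "y \<in> S \<rightarrow>\<^sub>E carr M" using x y YP by blast+
      show "x s = y s" if "s \<in> S" for s using eq that x y by auto
    qed
  next
    fix r xs assume "xs \<in> tuples (rel_arity r) Y" "\<forall>u\<in>?p ` S. map u xs \<in> r"
    then show "xs \<in> prel (substruct ?P Y) r" unfolding sub(3) by (auto simp: tuples_def pm)
  next
    fix h xs assume xs: "xs \<in> tuples (op_arity h) Y" "\<forall>u\<in>?p ` S. map u xs \<in> dom h"
    then have s: "set xs \<subseteq> Y" by (simp add: tuples_def)
    have "h (map (\<lambda>x. x s) xs) = Some ((\<lambda>s\<in>S. the (h (map (\<lambda>x. x s) xs))) s)" if "s \<in> S" for s
    proof -
      have "map (\<lambda>x. x s) xs \<in> dom h" using xs(2) that by (simp only: pm[OF s] ball_simps)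
      then show ?thesis using that by auto
    qed
    then have "pfun (substruct ?P Y) h xs = Some (\<lambda>s\<in>S. the (h (map (\<lambda>x. x s) xs)))"
      using s unfolding sub(4) by blast
    then show "xs \<in> dom (pfun (substruct ?P Y) h)" by blast
  qed
qed

text \<open>Coincides with \<open>eta sig M A t\<close> for \<open>t\<close> in the carrier of
  \<open>A\<close>; it appears here as a coordinate projection of the power that contains the
  dual.\<close>

definition eval_at :: "'f signature \<Rightarrow> ('f, 'm) alg \<Rightarrow> ('f, 'a) alg \<Rightarrow> 'a \<Rightarrow> ('a \<Rightarrow> 'm) \<Rightarrow> 'm" where
  "eval_at sig M A t = (\<lambda>x\<in>alg_hom sig A M. x t)"

lemma map_eval_at: "set xs \<subseteq> alg_hom sig A M \<Longrightarrow> map (eval_at sig M A t) xs = map (\<lambda>x. x t) xs"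
  by (auto simp: eval_at_def)

lemma embeds_dual_D:
  assumes A: "is_alg sig A" and E: "is_alter_ego sig M E"
  shows "embeds E M (dual_D sig M A) (eval_at sig M A ` carr A)"
  using embeds_sub_power[OF closed_under_ops_alg_hom[OF A E]] unfolding dual_D_def eval_at_def by simp

lemma eval_at_zhom:
  assumes "is_alg sig A" "is_alter_ego sig M E" "t \<in> carr A"
  shows "eval_at sig M A t \<in> zhom E (dual_D sig M A) (ego_struct M)"
  using embeds_dual_D[OF assms(1,2)] assms(3) unfolding embeds_def by blast

text \<open>A finite power of a finite discrete space is discrete, so any operation on it is
  continuous.\<close>

lemma continuous_map_finite_op:
  assumes U: "finite U" and us: "\<And>u. u \<in> set us \<Longrightarrow> continuous_map T (discrete_topology U) u"
    and g: "\<And>as. as \<in> tuples (length us) U \<Longrightarrow> g as \<in> U"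
  shows "continuous_map T (discrete_topology U) (\<lambda>x. g (map (\<lambda>u. u x) us))"
proof -
  let ?T = "tuple_topology (discrete_topology U) (length us)"
  have "continuous_map T ?T (\<lambda>x. map (\<lambda>u. u x) us)"
    using us by (intro continuous_map_into_tuple_topology) simp_all
  moreover have "?T = discrete_topology (tuples (length us) U)"
    using finite_tuples[OF U]
    by (intro finite_topspace_imp_discrete_topology Hausdorff_space_tuple_topology) simp_all
  then have "continuous_map ?T (discrete_topology U) g" using g by auto
  ultimately show ?thesis using continuous_map_compose[of T ?T _ _ g] by (simp add: comp_def)
qed

text \<open>Morphisms to \<open>M\<close> form a subuniverse because the relations named by the
  facts of \<open>X\<close> are closed under the operations of \<open>M\<close>.\<close>

lemma zhom_closed:
  fixes M :: "('f, 'm) alg"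
  assumes M: "is_alg sig M" "finite (carr M)" and E: "is_alter_ego sig M E" and X: "is_pstruct E X"
    and F: "sig F = Some q" "us \<in> tuples q (zhom E X (ego_struct M))"
  shows "(\<lambda>x\<in>points X. fop M F (map (\<lambda>u. u x) us)) \<in> zhom E X (ego_struct M)"
    (is "?u \<in> _")
  unfolding zhom_ego_iff
proof (intro conjI allI impI)
  have us: "length us = q" "\<And>u. u \<in> set us \<Longrightarrow> u \<in> zhom E X (ego_struct M)" using F(2) by (auto simp: tuples_def)
  have um: "u x \<in> carr M" if "u \<in> set us" "x \<in> points X" for u x
    using us(2)[OF that(1)] that(2) by (auto simp: zhom_def)
  have FM: "fop M F as \<in> carr M" if "as \<in> tuples q (carr M)" for as using M(1) F(1) that by (auto simp: is_alg_def)
  show "?u \<in> points X \<rightarrow>\<^sub>E carr M"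
    using um us(1) by (auto intro!: FM simp: tuples_def)
  have "continuous_map (ptop X) (discrete_topology (carr M)) (\<lambda>x. fop M F (map (\<lambda>u. u x) us))"
    using us FM by (intro continuous_map_finite_op[OF M(2)]) (auto simp: zhom_def)
  then show "continuous_map (ptop X) (discrete_topology (carr M)) ?u"
    by (rule continuous_map_eq) simp
  have key: "map ?u xs \<in> r"
    if r: "compatible_rel sig M n r" and xs: "set xs \<subseteq> points X" "length xs = n"
      and us: "\<And>u. u \<in> set us \<Longrightarrow> map u xs \<in> r" for n r xs
  proof -
    have "map (\<lambda>u. map u xs) us \<in> tuples q r" using us F(2) by (auto simp: tuples_def)
    from compatible_relD(3)[OF r F(1) this]
    have "fop (tuple_power M n) F (map (\<lambda>u. map u xs) us) \<in> r" .
    moreover have "fop (tuple_power M n) F (map (\<lambda>u. map u xs) us) = map ?u xs"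
    proof (rule nth_equalityI)
      fix i assume "i < length (fop (tuple_power M n) F (map (\<lambda>u. map u xs) us))"
      then have i: "i < n" by (simp add: tuple_power_def)
      then have "xs ! i \<in> points X" using xs by (auto simp: subset_iff)
      moreover have "map (\<lambda>x. x ! i) (map (\<lambda>u. map u xs) us) = map (\<lambda>u. u (xs ! i)) us"
        using i xs(2) by simp
      ultimately show "fop (tuple_power M n) F (map (\<lambda>u. map u xs) us) ! i = map ?u xs ! i"
        using i xs(2) by (simp add: tuple_power_def comp_def)
    qed (simp add: tuple_power_def xs(2))
    ultimately show ?thesis by simp
  qed
  fix r xs assume f: "(r, xs) \<in> facts E X"
  obtain n where n: "compatible_rel sig M n r" "xs \<in> tuples n (points X)"
    using facts_compatible[OF E X f] by blast
  then show "map ?u xs \<in> r"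
    using us(2) f by (intro key[OF n(1)]) (auto simp: tuples_def zhom_ego_iff)
qed

lemma is_alg_dual_E:
  fixes M :: "('f, 'm) alg"
  assumes M: "is_alg sig M" "finite (carr M)" and E: "is_alter_ego sig M E" and X: "is_pstruct E X"
    and ne: "zhom E X (ego_struct M) \<noteq> {}"
  shows "is_alg sig (dual_E M E X)"
  using zhom_closed[OF M E X] ne
  by (auto simp: is_alg_def dual_E_def subalg_def alg_power_def)

lemma carr_dual_E [simp]: "carr (dual_E M E X) = zhom E X (ego_struct M)"
  by (simp add: dual_E_def subalg_def)

section \<open>Structures embedded in powers\<close>

lemma zhom_comp:
  assumes g: "g \<in> zhom E X Y" and v: "v \<in> zhom E Y Z" and X: "is_pstruct E X"
  shows "(\<lambda>x\<in>points X. v (g x)) \<in> zhom E X Z"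
proof -
  have m: "map (\<lambda>x\<in>points X. v (g x)) xs = map v (map g xs)" if "set xs \<subseteq> points X" for xs
    using that by auto
  show ?thesis
    unfolding zhom_def mem_Collect_eq
  proof (intro conjI ballI allI impI)
    show "(\<lambda>x\<in>points X. v (g x)) \<in> points X \<rightarrow>\<^sub>E points Z"
      using zhom_points[OF v] zhom_points[OF g] by auto
    have "continuous_map (ptop X) (ptop Z) (v \<circ> g)"
      using g v by (intro continuous_map_compose[of _ "ptop Y"]) (simp_all add: zhom_def)
    then show "continuous_map (ptop X) (ptop Z) (\<lambda>x\<in>points X. v (g x))"
      by (rule continuous_map_eq) simp
  next
    fix r xs assume r: "r \<in> erels E" "xs \<in> prel X r"
    then have "map v (map g xs) \<in> prel Z r" using g v unfolding zhom_def by blast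
    then show "map (\<lambda>x\<in>points X. v (g x)) xs \<in> prel Z r" by (simp only: m[OF pstruct_prel[OF X r]])
  next
    fix h xs b assume h: "h \<in> eops E" "pfun X h xs = Some b"
    have xs: "set xs \<subseteq> points X" "b \<in> points X" using pstruct_pfun[OF X h] by (simp_all add: tuples_def)
    have "pfun Z h (map v (map g xs)) = Some (v (g b))" using g v h unfolding zhom_def by blast
    then show "pfun Z h (map (\<lambda>x\<in>points X. v (g x)) xs) = Some ((\<lambda>x\<in>points X. v (g x)) b)"
      unfolding m[OF xs(1)] using xs(2) by simp
  qed
qed

text \<open>Reflection descends from \<open>Y\<close> to \<open>X\<close> because the left inverse
  \<open>k\<close> of \<open>g\<close> is itself a morphism.\<close>

lemma embeds_pullback:
  assumes L: "embeds E M Y L" and X: "is_pstruct E X"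
    and g: "g \<in> zhom E X Y" and k: "k \<in> zhom E Y X" and kg: "\<And>x. x \<in> points X \<Longrightarrow> k (g x) = x"
  shows "embeds E M X ((\<lambda>v. \<lambda>x\<in>points X. v (g x)) ` L)" (is "embeds E M X (?c ` L)")
proof -
  have cm: "map (?c v) xs = map v (map g xs)" if "set xs \<subseteq> points X" for v xs using that by auto
  have gt: "map g xs \<in> tuples n (points Y)" if "xs \<in> tuples n (points X)" for xs n
    using that zhom_points[OF g] by (auto simp: tuples_def)
  have km: "map k (map g xs) = xs" if "set xs \<subseteq> points X" for xs
    using that kg by (simp add: subset_iff map_idI)
  show ?thesis
    unfolding embeds_def
  proof (intro conjI ballI impI)
    show "?c ` L \<subseteq> zhom E X (ego_struct M)" using zhom_comp[OF g _ X] L by (auto simp: embeds_def)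
    fix x y assume x: "x \<in> points X" and y: "y \<in> points X" and "\<forall>u\<in>?c ` L. u x = u y"
    then have "\<forall>v\<in>L. v (g x) = v (g y)" by simp
    then have "g x = g y" using L zhom_points[OF g x] zhom_points[OF g y] by (simp add: embeds_def)
    then show "x = y" using kg x y by metis
  next
    fix r xs assume r: "r \<in> erels E" "xs \<in> tuples (rel_arity r) (points X)" "\<forall>u\<in>?c ` L. map u xs \<in> r"
    then have xs: "set xs \<subseteq> points X" by (simp add: tuples_def)
    have "\<forall>v\<in>L. map v (map g xs) \<in> r" using r(3) unfolding cm[OF xs, symmetric] by blast
    then have "map g xs \<in> prel Y r" using L r(1) gt[OF r(2)] unfolding embeds_def by blast
    then have "map k (map g xs) \<in> prel X r" using k r(1) unfolding zhom_def by blast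
    then show "xs \<in> prel X r" by (simp only: km[OF xs])
  next
    fix h xs assume h: "h \<in> eops E" "xs \<in> tuples (op_arity h) (points X)" "\<forall>u\<in>?c ` L. map u xs \<in> dom h"
    then have xs: "set xs \<subseteq> points X" by (simp add: tuples_def)
    have "\<forall>v\<in>L. map v (map g xs) \<in> dom h" using h(3) unfolding cm[OF xs, symmetric] by blast
    then have "map g xs \<in> dom (pfun Y h)" using L h(1) gt[OF h(2)] unfolding embeds_def by blast
    then obtain b where "pfun Y h (map g xs) = Some b" by blast
    then have "pfun X h (map k (map g xs)) = Some (k b)" using k h(1) unfolding zhom_def by blast
    then show "xs \<in> dom (pfun X h)" unfolding km[OF xs] by (rule domI)
  qed
qed

text \<open>The inverse of a bijective morphism need not be a morphism. Here \<open>K\<close>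
  detects the structure of \<open>X\<close>, and every \<open>u\<close> in \<open>K\<close> factors
  through \<open>g\<close>, so \<open>u\<close> after \<open>k\<close> agrees with a morphism on
  \<open>Y\<close>.\<close>

lemma inverse_zhom:
  assumes K: "embeds E M X K" and X: "is_pstruct E X" and Y: "is_pstruct E Y" and g: "g \<in> zhom E X Y"
    and k: "k \<in> points Y \<rightarrow>\<^sub>E points X" "continuous_map (ptop Y) (ptop X) k"
    and kg: "\<And>x. x \<in> points X \<Longrightarrow> k (g x) = x" and gk: "\<And>y. y \<in> points Y \<Longrightarrow> g (k y) = y"
    and ext: "\<And>u. u \<in> K \<Longrightarrow> \<exists>v\<in>zhom E Y (ego_struct M). \<forall>x\<in>points X. v (g x) = u x"
  shows "k \<in> zhom E Y X"
proof -
  have kt: "map k ys \<in> tuples n (points X)" if "ys \<in> tuples n (points Y)" for ys n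
    using that k(1) by (auto simp: tuples_def)
  have gkm: "map g (map k ys) = ys" if "set ys \<subseteq> points Y" for ys
    using that gk by (simp add: subset_iff map_idI)
  have v: "\<exists>v\<in>zhom E Y (ego_struct M). \<forall>ys. set ys \<subseteq> points Y \<longrightarrow> map u (map k ys) = map v ys" if u: "u \<in> K" for u
  proof -
    obtain v where v: "v \<in> zhom E Y (ego_struct M)" "\<forall>x\<in>points X. v (g x) = u x" using ext[OF u] by blast
    have "u (k y) = v y" if "y \<in> points Y" for y
      using v(2) gk[OF that] k(1) that by (metis PiE_mem)
    then show ?thesis using v(1) by (intro bexI[of _ v]) auto
  qed
  show ?thesis
    unfolding zhom_def mem_Collect_eq
  proof (intro conjI ballI allI impI k)
    fix r ys assume r: "r \<in> erels E" "ys \<in> prel Y r"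
    have ys: "ys \<in> tuples (rel_arity r) (points Y)" using Y r unfolding is_pstruct_def by blast
    have "map u (map k ys) \<in> r" if u: "u \<in> K" for u
    proof -
      obtain v where "v \<in> zhom E Y (ego_struct M)" "map u (map k ys) = map v ys"
        using v[OF u] pstruct_prel[OF Y r] by blast
      then show ?thesis using r by (simp add: zhom_def del: map_map)
    qed
    then show "map k ys \<in> prel X r" using K r(1) kt[OF ys] by (simp add: embeds_def del: map_map)
  next
    fix h ys b assume h: "h \<in> eops E" "pfun Y h ys = Some b"
    note ys = pstruct_pfun[OF Y h]
    then have ys': "set ys \<subseteq> points Y" by (simp add: tuples_def)
    have "map u (map k ys) \<in> dom h" if u: "u \<in> K" for u
    proof -
      obtain v where v: "v \<in> zhom E Y (ego_struct M)" "map u (map k ys) = map v ys"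
        using v[OF u] ys' by blast
      have "h (map v ys) = Some (v b)" using v(1) h by (simp add: zhom_def)
      then show ?thesis unfolding v(2) by (rule domI)
    qed
    then have "map k ys \<in> dom (pfun X h)" using K h(1) kt[OF ys(1)] by (simp add: embeds_def domIff del: map_map)
    then obtain c where c: "pfun X h (map k ys) = Some c" by blast
    then have "pfun Y h (map g (map k ys)) = Some (g c)" using g h(1) unfolding zhom_def by blast
    then have "b = g c" using h(2) gkm[OF ys'] by simp
    then show "pfun X h (map k ys) = Some (k b)" using c kg pstruct_pfun(2)[OF X h(1) c] by simp
  qed
qed

section \<open>Membership in \<open>in_IScP\<close> in terms of embedding families, and the case of
  finite models\<close>

lemma in_IScP_embeds:
  fixes M :: "('f, 'm) alg" and X :: "('m, 'x) pstruct"
  assumes X: "in_IScP M E X"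
  shows "\<exists>K. K \<noteq> {} \<and> embeds E M X K"
proof -
  obtain S :: "('x \<Rightarrow> 'm) set" and Y g where S: "S \<noteq> {}"
    and Y: "closed_under_ops E (struct_power (ego_struct M) S) Y"
    and g: "ziso E X (substruct (struct_power (ego_struct M) S) Y) g"
    and B: "is_pstruct E X"
    using X unfolding in_IScP_def boolean_struct_def by blast
  let ?Y = "substruct (struct_power (ego_struct M) S) Y"
  obtain k where k: "g \<in> zhom E X ?Y" "k \<in> zhom E ?Y X" "\<And>x. x \<in> points X \<Longrightarrow> k (g x) = x"
    using g unfolding ziso_def by blast
  show ?thesis
  proof (intro exI conjI)
    show "embeds E M X ((\<lambda>v. \<lambda>x\<in>points X. v (g x)) ` (\<lambda>s. \<lambda>y\<in>Y. y s) ` S)"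
      by (rule embeds_pullback[OF embeds_sub_power[OF Y] B k(1,2)]) (rule k(3))
  qed (use S in simp)
qed

text \<open>The power is taken over \<open>K\<close> itself. The inverse of the embedding is
  continuous by compactness of \<open>X\<close> and preserves the structure because \<open>K\<close>
  reflects it; closedness of the image is supplied by \<open>in_IScP_I\<close>.\<close>

lemma embeds_in_IScP:
  fixes M :: "('f, 'm) alg" and X :: "('m, 'x) pstruct"
  assumes E: "is_alter_ego sig M E" and X: "boolean_struct E X" and K: "embeds E M X K" "K \<noteq> {}"
  shows "in_IScP M E X"
proof -
  define P where "P = struct_power (ego_struct M) K"
  define g where "g = (\<lambda>x\<in>points X. \<lambda>u\<in>K. u x)"
  define Y where "Y = g ` points X"
  define k where "k = (\<lambda>y\<in>Y. inv_into (points X) g y)"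
  have Kz: "u \<in> zhom E X (ego_struct M)" if "u \<in> K" for u using K(1) that by (auto simp: embeds_def)
  have um: "u x \<in> carr M" if "u \<in> K" "x \<in> points X" for u x
    using zhom_points[OF Kz[OF that(1)] that(2)] by simp
  have X': "is_pstruct E X" using X by (simp add: boolean_struct_def)
  have gx: "g x u = u x" if "x \<in> points X" "u \<in> K" for x u using that by (simp add: g_def)
  have gP: "g x \<in> K \<rightarrow>\<^sub>E carr M" if "x \<in> points X" for x using that um by (simp add: g_def)
  have inj: "inj_on g (points X)"
  proof (rule inj_onI)
    fix x y assume xy: "x \<in> points X" "y \<in> points X" "g x = g y"
    then have "\<forall>u\<in>K. u x = u y" using gx by metis
    then show "x = y" using K(1) xy unfolding embeds_def by blast
  qed
  have topP: "points P = K \<rightarrow>\<^sub>E carr M" by (simp add: P_def struct_power_def)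
  have YP: "Y \<subseteq> K \<rightarrow>\<^sub>E carr M" using gP by (auto simp: Y_def simp del: PiE_iff)
  then have ptsY: "points (substruct P Y) = Y" by (auto simp: substruct_def topP)
  have kg: "k (g x) = x" if "x \<in> points X" for x using that inj by (simp add: k_def Y_def)
  have kY: "k y \<in> points X \<and> g (k y) = y" if "y \<in> Y" for y
    using that kg by (auto simp: Y_def)
  have pre: "\<exists>ys. set ys \<subseteq> points X \<and> xs = map g ys" if "set xs \<subseteq> Y" for xs
  proof (intro exI conjI)
    show "set (map k xs) \<subseteq> points X" using that kY by auto
    show "xs = map g (map k xs)" using that kY by (simp add: subset_iff map_idI)
  qed
  have gm: "map (\<lambda>y. y u) (map g ys) = map u ys" if "set ys \<subseteq> points X" "u \<in> K" for ys u
    using that gx by (auto simp: subset_iff)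
  have gS: "set (map g xs) \<subseteq> Y" "set (map g xs) \<subseteq> (K \<rightarrow>\<^sub>E carr M)" if "set xs \<subseteq> points X" for xs
    using that gP by (auto simp: Y_def simp del: PiE_iff)
  have gfun: "pfun P h (map g ys) = Some (g b)" if h: "h \<in> eops E" "pfun X h ys = Some b" for h ys b
  proof -
    have ys: "set ys \<subseteq> points X" and b: "b \<in> points X"
      using X' h unfolding is_pstruct_def tuples_def dom_def ran_def by blast+
    have "h (map u ys) = Some (u b)" if "u \<in> K" for u using Kz[OF that] h by (auto simp: zhom_def)
    then have *: "h (map (\<lambda>y. y u) (map g ys)) = Some (g b u)" if "u \<in> K" for u
      unfolding gm[OF ys that] using that gx[OF b that] by simp
    then have "\<forall>s\<in>K. map (\<lambda>x. x s) (map g ys) \<in> dom h" by blast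
    moreover have "(\<lambda>s\<in>K. the (h (map (\<lambda>x. x s) (map g ys)))) = g b"
      using gP[OF b] * by (intro extensionalityI[of _ K]) (auto simp: PiE_def simp del: map_map)
    ultimately show ?thesis using gS(2)[OF ys] by (simp add: P_def struct_power_def del: PiE_iff map_map set_map)
  qed
  have gfun': "\<exists>c. pfun X h ys = Some c \<and> b = g c"
    if h: "h \<in> eops E" "set ys \<subseteq> points X" "pfun P h (map g ys) = Some b" for h ys b
  proof -
    obtain n where n: "compatible_op sig M n h" using E h(1) unfolding is_alter_ego_def by blast
    have d: "\<forall>u\<in>K. map u ys \<in> dom h"
      using h(3) gm[OF h(2)] by (simp add: P_def struct_power_def split: if_splits del: map_map)
    \<comment> \<open>One member of \<open>K\<close> shows that \<open>ys\<close> has the arity of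
      \<open>h\<close>; reflection is stated only for such lists.\<close>
    obtain u where "u \<in> K" using K(2) by blast
    then have "map u ys \<in> tuples n (carr M)" using d compatible_opD(2)[OF n] by blast
    then have "ys \<in> tuples (op_arity h) (points X)" using h(2) compatible_opD(4)[OF n] by (simp add: tuples_def)
    then obtain c where c: "pfun X h ys = Some c" using K(1) d h(1) unfolding embeds_def by blast
    then show ?thesis using gfun[OF h(1) c] h(3) by simp
  qed
  have cl: "closed_under_ops E P Y"
    unfolding closed_under_ops_def
  proof (intro conjI ballI allI impI)
    show "Y \<subseteq> points P" using YP topP by simp
    fix h xs b assume h: "h \<in> eops E" "set xs \<subseteq> Y" "pfun P h xs = Some b"
    obtain ys where ys: "set ys \<subseteq> points X" "xs = map g ys" using pre[OF h(2)] by blast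
    obtain c where c: "pfun X h ys = Some c" "b = g c" using gfun'[OF h(1) ys(1)] h(3) ys(2) by blast
    have "c \<in> points X" using X' h(1) c(1) unfolding is_pstruct_def ran_def by blast
    then show "b \<in> Y" using c(2) by (simp add: Y_def)
  qed
  have contg: "continuous_map (ptop X) (subtopology (ptop P) Y) g"
    unfolding continuous_map_in_subtopology
  proof
    have "continuous_map (ptop X) (discrete_topology (carr M)) (\<lambda>x. g x u)" if u: "u \<in> K" for u
    proof (rule continuous_map_eq)
      show "continuous_map (ptop X) (discrete_topology (carr M)) u" using Kz[OF u] by (simp add: zhom_def)
    qed (use u gx in simp)
    moreover have "g ` points X \<subseteq> extensional K" using gP by (auto simp: PiE_def)
    ultimately show "continuous_map (ptop X) (ptop P) g"
      by (simp add: P_def struct_power_def continuous_map_componentwise)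
    show "g \<in> points X \<rightarrow> Y" by (simp add: Y_def)
  qed
  have contk: "continuous_map (subtopology (ptop P) Y) (ptop X) k"
  proof (rule continuous_map_inverse[OF contg])
    show "compact_space (ptop X)" using X by (simp add: boolean_struct_def)
    show "Hausdorff_space (subtopology (ptop P) Y)"
      by (intro Hausdorff_space_subtopology) (simp add: P_def struct_power_def Hausdorff_space_product_topology)
    show "k (g x) = x" if "x \<in> points X" for x by (rule kg[OF that])
    show "k y \<in> points X \<and> g (k y) = y" if "y \<in> topspace (subtopology (ptop P) Y)" for y
      using that by (intro kY) auto
  qed
  have gz: "g \<in> zhom E X (substruct P Y)"
    unfolding zhom_def mem_Collect_eq ptsY
  proof (intro conjI ballI allI impI)
    show "g \<in> points X \<rightarrow>\<^sub>E Y" by (auto simp: Y_def g_def)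
    show "continuous_map (ptop X) (ptop (substruct P Y)) g" using contg by (simp add: substruct_def)
  next
    fix r xs assume r: "r \<in> erels E" "xs \<in> prel X r"
    then have xs: "set xs \<subseteq> points X" by (rule pstruct_prel[OF X'])
    have "map u xs \<in> r" if "u \<in> K" for u using Kz[OF that] r by (auto simp: zhom_def)
    then have "\<forall>u\<in>K. map (\<lambda>y. y u) (map g xs) \<in> r" using gm[OF xs] by (simp del: map_map)
    then show "map g xs \<in> prel (substruct P Y) r"
      using gS[OF xs] by (simp add: substruct_def P_def struct_power_def del: PiE_iff map_map set_map)
  next
    fix h xs b assume h: "h \<in> eops E" "pfun X h xs = Some b"
    then have xs: "set xs \<subseteq> points X" using X' unfolding is_pstruct_def tuples_def dom_def by blast
    show "pfun (substruct P Y) h (map g xs) = Some (g b)"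
      using gfun[OF h] gS(1)[OF xs] by (simp add: substruct_def)
  qed
  have kz: "k \<in> zhom E (substruct P Y) X"
  proof (rule inverse_zhom[OF K(1) X' _ gz])
    show "is_pstruct E (substruct P Y)"
      using K(2) pstruct_sub_power[OF E _ cl[unfolded P_def]] unfolding P_def by blast
    show "k \<in> points (substruct P Y) \<rightarrow>\<^sub>E points X" using kY by (auto simp: k_def ptsY)
    show "continuous_map (ptop (substruct P Y)) (ptop X) k" using contk by (simp add: substruct_def)
    show "k (g x) = x" if "x \<in> points X" for x by (rule kg[OF that])
    show "g (k y) = y" if "y \<in> points (substruct P Y)" for y using that kY by (simp add: ptsY)
    fix u assume u: "u \<in> K"
    have "(\<lambda>y\<in>Y. y u) \<in> zhom E (substruct P Y) (ego_struct M)"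
      using embeds_sub_power[OF cl[unfolded P_def]] u unfolding P_def embeds_def by blast
    moreover have "g x \<in> Y" if "x \<in> points X" for x using that by (simp add: Y_def)
    ultimately show "\<exists>v\<in>zhom E (substruct P Y) (ego_struct M). \<forall>x\<in>points X. v (g x) = u x"
      using u gx by (intro bexI[of _ "\<lambda>y\<in>Y. y u"]) auto
  qed
  have "ziso E X (substruct P Y) g"
    unfolding ziso_def ptsY using gz
  proof (intro conjI bexI[OF _ kz] ballI)
    show "k (g x) = x" if "x \<in> points X" for x using that by (rule kg)
    show "g (k y) = y" if "y \<in> Y" for y using kY that by blast
  qed
  then show ?thesis using in_IScP_I[OF X K(2)] cl unfolding P_def by blast
qed

text \<open>The method of diagrams: an assignment over \<open>M\<close> that satisfies all atomic
  facts of \<open>X\<close> yields a morphism. The diagram may be infinite, as the language may be,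
  but only finitely many assignments violate it, and one violated fact for each of them makes a
  finite premise.\<close>

lemma finite_model_embeds:
  fixes M :: "('f, 'm) alg" and X :: "('m, 'x) pstruct"
  assumes M: "finite (carr M)" and X: "boolean_struct E X" "finite (points X)"
    and model: "\<And>\<sigma>. \<sigma> \<in> Th_uH M E \<Longrightarrow> sat_uh X \<sigma>"
  shows "embeds E M X (zhom E X (ego_struct M))" "zhom E X (ego_struct M) \<noteq> {}"
proof -
  have X': "is_pstruct E X" using X by (simp add: boolean_struct_def)
  have disc: "ptop X = discrete_topology (points X)"
    using X by (intro finite_topspace_imp_discrete_topology) (simp_all add: boolean_struct_def)
  obtain ps where ps: "set ps = points X" using finite_list[OF X(2)] by blast
  define N where "N = length ps"
  have "\<exists>i. i < N \<and> ps ! i = x" if "x \<in> points X" for x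
    using that unfolding ps[symmetric] N_def by (auto simp: in_set_conv_nth)
  then obtain ix where ix: "\<And>x. x \<in> points X \<Longrightarrow> ix x < N \<and> ps ! ix x = x" by metis

  define v where "v = (\<lambda>a::'m list. \<lambda>x\<in>points X. a ! ix x)"
  define FF where "FF = {Rel r (map Var js) | r js. r \<in> erels E \<and> set js \<subseteq> {..<N} \<and> map ((!) ps) js \<in> prel X r} \<union>
    {Eq (App h (map Var js)) (Var i) | h js i. h \<in> eops E \<and> set js \<subseteq> {..<N} \<and> i < N \<and>
      pfun X h (map ((!) ps) js) = Some (ps ! i)}"
  have pst: "ps \<in> tuples N (points X)" using ps by (simp add: tuples_def N_def)
  have wfF: "wf_atomic E N \<alpha>" and hF: "holds X ps \<alpha>" if "\<alpha> \<in> FF" for \<alpha>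
  proof -
    have ar: "length js = rel_arity r" if "map ((!) ps) js \<in> prel X r" "r \<in> erels E" for r js
    proof -
      have "map ((!) ps) js \<in> tuples (rel_arity r) (points X)" using X' that unfolding is_pstruct_def by blast
      then show ?thesis by (simp add: tuples_def)
    qed
    have aq: "length js = op_arity h" if "pfun X h (map ((!) ps) js) = Some b" "h \<in> eops E" for h js b
    proof -
      have "map ((!) ps) js \<in> tuples (op_arity h) (points X)" using X' that unfolding is_pstruct_def by blast
      then show ?thesis by (simp add: tuples_def)
    qed
    show "wf_atomic E N \<alpha>" using that ar aq by (auto simp: FF_def list_all_iff)
    show "holds X ps \<alpha>" using that by (auto simp: FF_def holds_Rel_Var eval_App_Var simp del: map_map)
  qed
  have jsix: "map ((!) ps) (map ix xs) = xs" "set (map ix xs) \<subseteq> {..<N}" if "set xs \<subseteq> points X" for xs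
    using that ix by (auto simp: subset_iff intro!: map_idI)
  have vmap: "map (v a) xs = map ((!) a) (map ix xs)" if "set xs \<subseteq> points X" for a xs
    using that by (auto simp: v_def)
  have vz: "v a \<in> zhom E X (ego_struct M)"
    if a: "a \<in> tuples N (carr M)" "\<And>\<alpha>. \<alpha> \<in> FF \<Longrightarrow> holds (ego_struct M) a \<alpha>" for a
    unfolding zhom_def mem_Collect_eq ego_struct_simps topspace_discrete_topology
  proof (intro conjI ballI allI impI)
    show v: "v a \<in> points X \<rightarrow>\<^sub>E carr M" using a(1) ix by (auto simp: v_def intro: tuples_nth)
    then show "continuous_map (ptop X) (discrete_topology (carr M)) (v a)"
      by (subst disc) (auto simp: PiE_def)
  next
    fix r xs assume r: "r \<in> erels E" "xs \<in> prel X r"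
    then have xs: "set xs \<subseteq> points X" by (rule pstruct_prel[OF X'])
    have "Rel r (map Var (map ix xs)) \<in> FF"
      unfolding FF_def using r
      by (intro UnI1 CollectI exI[of _ r] exI[of _ "map ix xs"] conjI refl) (simp_all only: jsix[OF xs])
    from a(2)[OF this] show "map (v a) xs \<in> r" unfolding holds_Rel_Var vmap[OF xs] by simp
  next
    fix h xs b assume h: "h \<in> eops E" "pfun X h xs = Some b"
    then have xs: "set xs \<subseteq> points X" and b: "b \<in> points X"
      using X' unfolding is_pstruct_def tuples_def dom_def ran_def by blast+
    have "pfun X h (map ((!) ps) (map ix xs)) = Some (ps ! ix b)" using h(2) jsix(1)[OF xs] ix[OF b] by simp
    then have "Eq (App h (map Var (map ix xs))) (Var (ix b)) \<in> FF"
      unfolding FF_def using h(1) jsix(2)[OF xs] ix[OF b]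
      by (intro UnI2 CollectI exI[of _ h] exI[of _ "map ix xs"] exI[of _ "ix b"] conjI refl) simp_all
    from a(2)[OF this] show "h (map (v a) xs) = Some (v a b)"
      unfolding holds.simps eval_App_Var vmap[OF xs] using b by (auto simp: v_def)
  qed
  have main: "holds_uh_concl X ps \<gamma>"
    if wf: "wf_uh_concl E N \<gamma>" and \<gamma>: "\<And>a. a \<in> tuples N (carr M) \<Longrightarrow> v a \<in> zhom E X (ego_struct M) \<Longrightarrow>
      holds_uh_concl (ego_struct M) a \<gamma>" for \<gamma>
  proof -
    define bad where "bad = {a \<in> tuples N (carr M). \<exists>\<alpha>\<in>FF. \<not> holds (ego_struct M) a \<alpha>}"
    have "\<exists>\<alpha>. \<alpha> \<in> FF \<and> \<not> holds (ego_struct M) a \<alpha>" if "a \<in> bad" for a using that by (auto simp: bad_def)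
    then obtain w where w: "\<And>a. a \<in> bad \<Longrightarrow> w a \<in> FF \<and> \<not> holds (ego_struct M) a (w a)" by metis
    have "finite bad" using finite_tuples[OF M] by (auto simp: bad_def)
    then obtain bs where bs: "set bs = bad" using finite_list by blast
    let ?\<sigma> = "\<lparr>nvars = N, prem = map w bs, concl = \<gamma>\<rparr>"
    have "?\<sigma> \<in> Th_uH M E"
      unfolding Th_uH_def mem_Collect_eq
    proof
      show "wf_uh E ?\<sigma>" using wf w wfF bs by (auto simp: wf_uh_def wf_ca_def)
      show "sat_uh (ego_struct M) ?\<sigma>"
        unfolding sat_uh_def
      proof
        fix a assume "a \<in> pr (ego_struct M) ?\<sigma>"
        then have a: "a \<in> tuples N (carr M)" "\<And>b. b \<in> bad \<Longrightarrow> holds (ego_struct M) a (w b)"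
          using bs by (auto simp: pr_def defined_rel_def)
        then have "a \<notin> bad" using w by blast
        then have "v a \<in> zhom E X (ego_struct M)" using a(1) by (intro vz) (auto simp: bad_def)
        then show "holds_uh_concl (ego_struct M) a (concl ?\<sigma>)" using \<gamma> a(1) by simp
      qed
    qed
    from model[OF this] have "\<forall>xs\<in>pr X ?\<sigma>. holds_uh_concl X xs \<gamma>" by (simp add: sat_uh_def)
    moreover have "ps \<in> pr X ?\<sigma>" using pst hF w bs by (auto simp: pr_def defined_rel_def)
    ultimately show ?thesis by blast
  qed
  \<comment> \<open>Without any morphism every assignment would be refuted, and \<open>Bot\<close>
    would follow from the diagram.\<close>
  show "zhom E X (ego_struct M) \<noteq> {}" using main[of Bot] by auto
  show "embeds E M X (zhom E X (ego_struct M))"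
    unfolding embeds_def
  proof (intro conjI ballI impI)
    fix x y assume x: "x \<in> points X" and y: "y \<in> points X" and eq: "\<forall>u\<in>zhom E X (ego_struct M). u x = u y"
    have "holds_uh_concl X ps (At (Eq (Var (ix x)) (Var (ix y))))"
    proof (rule main)
      fix a assume "v a \<in> zhom E X (ego_struct M)"
      then have "v a x = v a y" using eq by blast
      then show "holds_uh_concl (ego_struct M) a (At (Eq (Var (ix x)) (Var (ix y))))"
        using x y by (simp add: v_def)
    qed (use x y ix in simp)
    then show "x = y" using x y ix by simp
  next
    fix r xs assume r: "r \<in> erels E" "xs \<in> tuples (rel_arity r) (points X)"
      and u: "\<forall>u\<in>zhom E X (ego_struct M). map u xs \<in> r"
    then have xs: "set xs \<subseteq> points X" "length xs = rel_arity r" by (simp_all add: tuples_def)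
    have "holds_uh_concl X ps (At (Rel r (map Var (map ix xs))))"
    proof (rule main)
      show "wf_uh_concl E N (At (Rel r (map Var (map ix xs))))"
        using r(1) xs jsix(2)[OF xs(1)] by (auto simp: list_all_iff)
      fix a assume "v a \<in> zhom E X (ego_struct M)"
      then have "map (v a) xs \<in> r" using u by blast
      then show "holds_uh_concl (ego_struct M) a (At (Rel r (map Var (map ix xs))))"
        unfolding holds_uh_concl.simps holds_Rel_Var vmap[OF xs(1)] by simp
    qed
    then show "xs \<in> prel X r" unfolding holds_uh_concl.simps holds_Rel_Var jsix(1)[OF xs(1)] .
  next
    fix h xs assume h: "h \<in> eops E" "xs \<in> tuples (op_arity h) (points X)"
      and u: "\<forall>u\<in>zhom E X (ego_struct M). map u xs \<in> dom h"
    then have xs: "set xs \<subseteq> points X" "length xs = op_arity h" by (simp_all add: tuples_def)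
    let ?t = "App h (map Var (map ix xs))"
    have "holds_uh_concl X ps (At (Eq ?t ?t))"
    proof (rule main)
      show "wf_uh_concl E N (At (Eq ?t ?t))"
        using h(1) xs jsix(2)[OF xs(1)] by (auto simp: list_all_iff)
      fix a assume "v a \<in> zhom E X (ego_struct M)"
      then have "map (v a) xs \<in> dom h" using u by blast
      then show "holds_uh_concl (ego_struct M) a (At (Eq ?t ?t))"
        unfolding holds_uh_concl.simps holds.simps eval_App_Var vmap[OF xs(1)] by auto
    qed
    then show "xs \<in> dom (pfun X h)"
      unfolding holds_uh_concl.simps holds.simps eval_App_Var jsix(1)[OF xs(1)] by auto
  qed simp
qed

section \<open>Hom-minimal relations under duality at the finite level\<close>

text \<open>
  The dual of a hom-minimal relation \<open>s\<close> consists of projections, so a tuple satisfying all atomic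
  facts about the coordinates of \<open>s\<close> is a morphism from that dual, hence an evaluation.
\<close>

lemma hom_minimal_separation:
  fixes M :: "('f, 'm) alg" and E :: "'m alter_ego"
  assumes inf: "infinite (UNIV :: 'a set)" and M: "is_alg sig M" "finite (carr M)"
    and E: "is_alter_ego sig M E"
    and dual: "\<And>A :: ('f, 'a) alg. in_ISP sig M A \<Longrightarrow> finite (carr A) \<Longrightarrow> eta_iso sig M E A"
    and s: "hom_minimal sig M n s" and a: "a \<in> tuples n (carr M)" "a \<notin> s"
  shows "\<exists>\<alpha>. wf_atomic E n \<alpha> \<and> (pure_prem \<alpha> \<or> (\<exists>i j. \<alpha> = Eq (Var i) (Var j))) \<and>
    (\<forall>b\<in>s. holds (ego_struct M) b \<alpha>) \<and> \<not> holds (ego_struct M) a \<alpha>"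
proof (rule ccontr)
  assume "\<not> ?thesis"
  \<comment> \<open>By contradiction \<open>a\<close> satisfies every fact of the given form that is
    valid on \<open>s\<close>; the aim is to recognise \<open>a\<close> as an element of
    \<open>s\<close>.\<close>
  then have fact: "holds (ego_struct M) a \<alpha>"
    if "wf_atomic E n \<alpha>" "pure_prem \<alpha> \<or> (\<exists>i j. \<alpha> = Eq (Var i) (Var j))"
      "\<forall>b\<in>s. holds (ego_struct M) b \<alpha>" for \<alpha>
    using that by blast
  have sc: "compatible_rel sig M n s" using s by (simp add: hom_minimal_def)
  note sD = compatible_relD[OF sc]
  have fs: "finite s" using finite_subset[OF sD(2) finite_tuples[OF M(2)]] .
  \<comment> \<open>Duality is assumed for algebras carried by subsets of \<open>'a\<close>, so
    \<open>s\<close> is copied into that type.\<close>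
  obtain T :: "'a set" where T: "finite T" "card T = card s" using infinite_arbitrarily_large[OF inf] by blast
  obtain c where c: "bij_betw c s T" using finite_same_card_bij[OF fs T(1)] T(2) by metis
  define d where "d = inv_into s c"
  have cT: "c b \<in> T" and dc: "d (c b) = b" if "b \<in> s" for b
    using c that by (auto simp: bij_betw_def d_def)
  have ds: "d t \<in> s" and cd: "c (d t) = t" if "t \<in> T" for t
    using c that by (auto simp: bij_betw_def d_def inv_into_into f_inv_into_f)
  have dn: "d t ! i \<in> carr M" if "t \<in> T" "i < n" for t i
    using ds[OF that(1)] sD(2) that(2) by (blast intro: tuples_nth)
  define A where "A = \<lparr>carr = T, fop = (\<lambda>F ts. c (fop (tuple_power M n) F (map d ts)))\<rparr>"
  have carrA: "carr A = T" by (simp add: A_def)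
  have dtup: "map d ts \<in> tuples q s" if "ts \<in> tuples q T" for q ts
    using that ds by (auto simp: tuples_def)
  have op: "fop A F ts \<in> T" "d (fop A F ts) = fop (tuple_power M n) F (map d ts)"
    if "sig F = Some q" "ts \<in> tuples q T" for F q ts
    using sD(3)[OF that(1) dtup[OF that(2)]] cT dc by (simp_all add: A_def)
  have A: "is_alg sig A" using op(1) sD(1) cT by (auto simp: is_alg_def carrA)
  define pr where "pr = (\<lambda>i. \<lambda>t\<in>T. d t ! i)"
  have prhom: "pr i \<in> alg_hom sig A M" if i: "i < n" for i
    unfolding alg_hom_def mem_Collect_eq carrA
  proof (intro conjI allI impI)
    show "pr i \<in> T \<rightarrow>\<^sub>E carr M" using dn i by (auto simp: pr_def)
    fix F q ts assume F: "sig F = Some q" "ts \<in> tuples q T"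
    have "map (\<lambda>x. x ! i) (map d ts) = map (pr i) ts" using F(2) by (auto simp: pr_def tuples_def)
    then show "pr i (fop A F ts) = fop M F (map (pr i) ts)"
      using op[OF F] i by (simp add: pr_def tuple_power_def del: map_map)
  qed
  have "\<exists>i<n. g = pr i" if g: "g \<in> alg_hom sig A M" for g
  proof -
    have "restrict (\<lambda>b. g (c b)) s \<in> alg_hom sig (rel_alg M n s) M"
    proof (rule restrict_alg_hom[OF sc], unfold hom_on_def, intro conjI allI impI)
      show "(\<lambda>b. g (c b)) ` s \<subseteq> carr M" using g cT by (auto simp: alg_hom_def carrA)
      fix F q bs assume F: "sig F = Some q" "bs \<in> tuples q s"
      have "map c bs \<in> tuples q T" using F(2) cT by (auto simp: tuples_def)
      then have "g (fop A F (map c bs)) = fop M F (map g (map c bs))"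
        using g F(1) by (auto simp: alg_hom_def carrA)
      moreover have "map d (map c bs) = bs" using F(2) dc by (auto simp: tuples_def subset_iff intro!: map_idI)
      ultimately show "g (c (fop (tuple_power M n) F bs)) = fop M F (map (\<lambda>b. g (c b)) bs)"
        by (simp add: A_def comp_def)
    qed
    then obtain i where i: "i < n" "\<forall>b\<in>s. restrict (\<lambda>b. g (c b)) s b = b ! i"
      using s unfolding hom_minimal_def by blast
    have "g = pr i"
    proof (rule extensionalityI[of _ T])
      show "g \<in> extensional T" using g by (auto simp: alg_hom_def carrA PiE_def)
      show "g t = pr i t" if "t \<in> T" for t using i(2) ds[OF that] cd[OF that] that by (auto simp: pr_def)
    qed (simp add: pr_def)
    then show ?thesis using i(1) by blast
  qed
  then obtain ix where ix: "\<And>g. g \<in> alg_hom sig A M \<Longrightarrow> ix g < n \<and> g = pr (ix g)" by metis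
  have homA: "alg_hom sig A M = pr ` {..<n}" using ix prhom by blast
  have ISP: "in_ISP sig M A"
  proof (rule in_ISP_I[OF A])
    define e where "e = (\<lambda>t\<in>T. \<lambda>i\<in>{..<n}. d t ! i)"
    have eP: "e t \<in> {..<n} \<rightarrow>\<^sub>E carr M" if "t \<in> T" for t using that dn by (auto simp: e_def)
    have eop: "e (fop A F ts) = fop (alg_power M {..<n}) F (map e ts)"
      if F: "sig F = Some q" "ts \<in> tuples q T" for F q ts
    proof (rule extensionalityI[of _ "{..<n}"])
      show "e (fop A F ts) \<in> extensional {..<n}" using eP[OF op(1)[OF F]] by (simp add: PiE_def)
      show "fop (alg_power M {..<n}) F (map e ts) \<in> extensional {..<n}" by (simp add: alg_power_def)
      fix i assume i: "i \<in> {..<n}"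
      have "map (\<lambda>x. x ! i) (map d ts) = map (\<lambda>x. x i) (map e ts)"
        using F(2) i by (auto simp: e_def tuples_def)
      then show "e (fop A F ts) i = fop (alg_power M {..<n}) F (map e ts) i"
        using op[OF F] i by (simp add: e_def tuple_power_def alg_power_def del: map_map)
    qed
    have inj: "inj_on e T"
    proof (rule inj_onI)
      fix t t' assume t: "t \<in> T" "t' \<in> T" "e t = e t'"
      have "d t ! i = d t' ! i" if "i < n" for i
        using fun_cong[OF t(3), of i] t(1,2) that by (simp add: e_def)
      moreover have "length (d t) = n" "length (d t') = n" using ds t sD(2) by (auto simp: tuples_def)
      ultimately have "d t = d t'" by (intro nth_equalityI) auto
      then show "t = t'" using cd t by metis
    qed
    show "subuniverse sig (alg_power M {..<n}) (e ` T)"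
      unfolding subuniverse_def
    proof (intro conjI allI impI)
      show "e ` T \<noteq> {}" using A by (simp add: is_alg_def carrA)
      show "e ` T \<subseteq> carr (alg_power M {..<n})" using eP by (auto simp: alg_power_def simp del: PiE_iff)
      fix F q xs assume F: "sig F = Some q" "xs \<in> tuples q (e ` T)"
      then obtain ts where ts: "ts \<in> tuples q T" "xs = map e ts" by (auto elim: tuples_image)
      show "fop (alg_power M {..<n}) F xs \<in> e ` T"
        unfolding ts(2) eop[OF F(1) ts(1), symmetric] using op(1)[OF F(1) ts(1)] by (rule imageI)
    qed
    show "alg_iso sig A (subalg (alg_power M {..<n}) (e ` T)) e"
      using eop inj by (auto simp: alg_iso_def alg_hom_def subalg_def carrA bij_betw_def e_def)
  qed
  let ?D = "dual_D sig M A"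
  \<comment> \<open>Read \<open>a\<close> as a function on the dual, which consists of projections.
    If coordinates coincide on \<open>s\<close>, \<open>ix\<close> selects one of them; that
    \<open>a\<close> has equal entries there is secured later by the equations of variables.\<close>
  define u where "u = (\<lambda>g\<in>alg_hom sig A M. a ! ix g)"
  have js: "set (map ix xs) \<subseteq> {..<n}" "map u xs = map ((!) a) (map ix xs)"
    "\<And>b. b \<in> s \<Longrightarrow> map (\<lambda>x. x (c b)) xs = map ((!) b) (map ix xs)"
    if xs: "set xs \<subseteq> alg_hom sig A M" for xs
  proof -
    show "set (map ix xs) \<subseteq> {..<n}" using xs ix by auto
    show "map u xs = map ((!) a) (map ix xs)" using xs by (auto simp: u_def)
    fix b assume b: "b \<in> s"
    have "x (c b) = b ! ix x" if "x \<in> alg_hom sig A M" for x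
    proof -
      have "x = pr (ix x)" using ix[OF that] by blast
      then have "x (c b) = pr (ix x) (c b)" by simp
      then show ?thesis using cT[OF b] dc[OF b] by (simp add: pr_def)
    qed
    then show "map (\<lambda>x. x (c b)) xs = map ((!) b) (map ix xs)" using xs by auto
  qed
  have "u \<in> zhom E ?D (ego_struct M)"
    unfolding zhom_def mem_Collect_eq ego_struct_simps points_dual_D topspace_discrete_topology
  proof (intro conjI ballI allI impI)
    show uM: "u \<in> alg_hom sig A M \<rightarrow>\<^sub>E carr M" using ix a(1) by (auto simp: u_def intro: tuples_nth)
    have "ptop ?D = discrete_topology (alg_hom sig A M)"
    proof (rule finite_topspace_imp_discrete_topology)
      show "points ?D = alg_hom sig A M" by (rule points_dual_D)
      show "finite (alg_hom sig A M)" by (simp add: homA)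
      show "Hausdorff_space (ptop ?D)" unfolding ptop_dual_D
        by (intro Hausdorff_space_subtopology) (simp add: Hausdorff_space_product_topology)
    qed
    then show "continuous_map (ptop ?D) (discrete_topology (carr M)) u" using uM by (auto simp: PiE_def)
  next
    fix r xs assume r: "r \<in> erels E" "xs \<in> prel ?D r"
    have rn: "xs \<in> tuples (rel_arity r) (alg_hom sig A M)"
      using pstruct_dual_D[OF A E] r unfolding is_pstruct_def points_dual_D by blast
    have xs: "set xs \<subseteq> alg_hom sig A M" "\<forall>t\<in>T. map (\<lambda>x. x t) xs \<in> r"
      using r(2) by (simp_all add: prel_dual_D carrA)
    have "holds (ego_struct M) a (Rel r (map Var (map ix xs)))"
    proof (rule fact)
      show "wf_atomic E n (Rel r (map Var (map ix xs)))"
        using r(1) js(1)[OF xs(1)] rn by (auto simp: list_all_iff tuples_def)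
      show "pure_prem (Rel r (map Var (map ix xs))) \<or> (\<exists>i j. Rel r (map Var (map ix xs)) = Eq (Var i) (Var j))"
        unfolding pure_prem_def by blast
      show "\<forall>b\<in>s. holds (ego_struct M) b (Rel r (map Var (map ix xs)))"
      proof
        fix b assume b: "b \<in> s"
        show "holds (ego_struct M) b (Rel r (map Var (map ix xs)))"
          unfolding holds_Rel_Var js(3)[OF xs(1) b, symmetric] using xs(2) cT[OF b] by simp
      qed
    qed
    then show "map u xs \<in> r" unfolding holds_Rel_Var js(2)[OF xs(1)] by simp
  next
    fix h xs b assume h: "h \<in> eops E" "pfun ?D h xs = Some b"
    then obtain k where k: "compatible_op sig M k h" using E unfolding is_alter_ego_def by blast
    note k' = dual_D_op_hom[OF A k h(2)]
    have xs: "set xs \<subseteq> alg_hom sig A M" "\<forall>t\<in>T. h (map (\<lambda>x. x t) xs) = Some (b t)"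
      using h(2) unfolding pfun_dual_D carrA by blast+
    let ?\<alpha> = "Eq (App h (map Var (map ix xs))) (Var (ix b))"
    have bix: "ix b < n" "b = pr (ix b)" using ix[OF k'(2)] by blast+
    have "holds (ego_struct M) a ?\<alpha>"
    proof (rule fact)
      show "wf_atomic E n ?\<alpha>"
        using h(1) js(1)[OF xs(1)] k'(1) compatible_opD(4)[OF k] bix(1) by (auto simp: list_all_iff)
      show "pure_prem ?\<alpha> \<or> (\<exists>i j. ?\<alpha> = Eq (Var i) (Var j))"
        unfolding pure_prem_def by blast
      show "\<forall>b\<in>s. holds (ego_struct M) b ?\<alpha>"
      proof
        fix b' assume b': "b' \<in> s"
        have "h (map (\<lambda>x. x (c b')) xs) = Some (b (c b'))" using xs(2) cT[OF b'] by blast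
        moreover have "b (c b') = b' ! ix b" using js(3)[of "[b]", OF _ b'] k'(2) by simp
        ultimately show "holds (ego_struct M) b' ?\<alpha>"
          unfolding holds.simps eval_App_Var js(3)[OF xs(1) b'] by simp
      qed
    qed
    then show "h (map u xs) = Some (u b)"
      unfolding holds.simps eval_App_Var js(2)[OF xs(1)] using k'(2) by (simp add: u_def)
  qed
  \<comment> \<open>Surjectivity of \<open>eta\<close> turns the morphism \<open>u\<close> into
    evaluation at some \<open>t\<close>, and \<open>a\<close> is then the tuple for which
    \<open>t\<close> stands.\<close>
  moreover have "bij_betw (eta sig M A) T (zhom E ?D (ego_struct M))"
    using dual[OF ISP] T(1) by (simp add: carrA eta_iso_def alg_iso_def)
  ultimately have "u \<in> eta sig M A ` T" by (simp add: bij_betw_def)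
  then obtain t where t: "t \<in> T" "u = eta sig M A t" by blast
  have "a = d t"
  proof (rule nth_equalityI)
    show "length a = length (d t)" using a(1) ds[OF t(1)] sD(2) by (auto simp: tuples_def)
    fix i assume "i < length a"
    then have i: "i < n" using a(1) by (simp add: tuples_def)
    have "u (pr i) = d t ! i" using t prhom[OF i] by (simp add: eta_def carrA pr_def)
    moreover have "a ! ix (pr i) = a ! i"
    proof -
      have x: "ix (pr i) < n" "pr i = pr (ix (pr i))" using ix[OF prhom[OF i]] by blast+
      have "holds (ego_struct M) a (Eq (Var (ix (pr i))) (Var i))"
      proof (rule fact)
        show "\<forall>b\<in>s. holds (ego_struct M) b (Eq (Var (ix (pr i))) (Var i))"
        proof
          fix b assume b: "b \<in> s"
          have "pr i (c b) = pr (ix (pr i)) (c b)" using x(2) by simp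
          then show "holds (ego_struct M) b (Eq (Var (ix (pr i))) (Var i))"
            using cT[OF b] dc[OF b] by (simp add: pr_def)
        qed
      qed (use x i in auto)
      then show ?thesis by simp
    qed
    ultimately show "a ! i = d t ! i" using prhom[OF i] by (simp add: u_def)
  qed
  then show False using ds[OF t(1)] a(2) by simp
qed

section \<open>Extended relations \<open>hat r\<close>, and transfer of the isomorphism
  \<open>eta\<close>\<close>

context hat_ego
begin

text \<open>A homomorphism on \<open>hat r\<close>, composed with the bijection from
  \<open>r\<close>, is a homomorphism on \<open>r\<close>; hence it occurs in \<open>fs r\<close>
  and is one of the appended coordinates.\<close>

lemma hom_minimal_hat:
  assumes r: "compatible_rel sig M n r"
  shows "hom_minimal sig M (n + length (fs r)) (hat r (fs r))"
proof -
  let ?m = "length (fs r)"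
  define e where "e = (\<lambda>i a. if i < n then a ! i else (fs r ! (i - n)) a)"
  have len: "length a = n" if "a \<in> r" for a using that compatible_relD(2)[OF r] by (auto simp: tuples_def)
  have E: "map (\<lambda>i. e i a) [0..<n + ?m] = a @ map (\<lambda>f. f a) (fs r)" if "a \<in> r" for a
    using len[OF that] by (auto simp: e_def nth_append intro!: nth_equalityI)
  have ehom: "hom_on sig M n r (e i)" if "i < n + ?m" for i
  proof (cases "i < n")
    case True
    then show ?thesis using hom_on_nth[OF r True] by (simp add: e_def)
  next
    case False
    then have "hom_on sig M n r (fs r ! (i - n))" using that by (intro fs_hom_on[OF r] nth_mem) auto
    then show ?thesis using False by (simp add: e_def)
  qed
  have ne: "hat r (fs r) \<noteq> {}" using compatible_relD(1)[OF r] by (auto simp: hat_def)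
  \<comment> \<open>Compatibility is read off from definability by
    \<open>\<beta>h r\<close>.\<close>
  have comp: "compatible_rel sig M (n + ?m) (hat r (fs r))"
    using compatible_defined_rel[OF alg ego hatD(2)[OF r]] ne unfolding hatD(3)[OF r] by blast
  show ?thesis
    unfolding hom_minimal_def
  proof (intro conjI ballI)
    show "compatible_rel sig M (n + ?m) (hat r (fs r))" by (rule comp)
    fix g assume "g \<in> alg_hom sig (rel_alg M (n + ?m) (hat r (fs r))) M"
    then have g: "hom_on sig M (n + ?m) (hat r (fs r)) g" unfolding alg_hom_rel_alg by blast
    have "hom_on sig M n r (\<lambda>a. g (map (\<lambda>i. e i a) [0..<n + ?m]))"
      by (rule hom_on_comp[OF ehom _ g]) (use E in \<open>auto simp: hat_def simp del: upt_Suc\<close>)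
    then have "restrict (\<lambda>a. g (map (\<lambda>i. e i a) [0..<n + ?m])) r \<in> set (fs r)"
      using restrict_alg_hom[OF r] unfolding hatD(1)[OF r] by blast
    then obtain l where l: "l < ?m" "fs r ! l = restrict (\<lambda>a. g (map (\<lambda>i. e i a) [0..<n + ?m])) r"
      by (auto simp: in_set_conv_nth)
    have "g as = as ! (n + l)" if "as \<in> hat r (fs r)" for as
    proof -
      obtain a where a: "a \<in> r" "as = a @ map (\<lambda>f. f a) (fs r)"
        using \<open>as \<in> hat r (fs r)\<close> by (auto simp: hat_def)
      have "as ! (n + l) = (fs r ! l) a" using a len l(1) by (simp add: nth_append)
      also have "\<dots> = g as" unfolding l(2) a(2) E[OF a(1), symmetric] using a(1) by simp
      finally show ?thesis by simp
    qed
    then show "\<exists>i<n + ?m. \<forall>as\<in>hat r (fs r). g as = as ! i" using l(1) by (intro exI[of _ "n + l"]) auto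
  qed
qed

text \<open>Positive existential formulas are preserved: a morphism carries the witnesses
  along.\<close>

lemma beta_rel_zhom:
  assumes r: "compatible_rel sig M n r" and u: "u \<in> zhom E X Y" and xs: "xs \<in> beta_rel X r"
  shows "map u xs \<in> beta_rel Y r"
proof -
  obtain ws where ws: "xs \<in> tuples n (points X)" "xs @ ws \<in> defined_rel X (n + length (fs r)) (\<beta>h r)"
    using beta_relE[OF r xs] by blast
  from defined_rel_zhom[OF u hatD(2)[OF r] ws(2)]
  show ?thesis using ws(1) by (intro beta_relI[OF r, of _ "map u ws"]) (simp_all add: tuples_def)
qed

text \<open>The witnesses are obtained by applying each \<open>f\<close> pointwise to
  \<open>xs\<close>, which gives homomorphisms from \<open>A\<close> again. That the whole tuple
  satisfies \<open>\<beta>h r\<close> is checked coordinatewise in \<open>M\<close>.\<close>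

lemma beta_rel_dual_D:
  assumes A: "is_alg sig A" and r: "compatible_rel sig M n r"
    and xs: "set xs \<subseteq> alg_hom sig A M" "length xs = n" "\<And>t. t \<in> carr A \<Longrightarrow> map (\<lambda>x. x t) xs \<in> r"
  shows "xs \<in> beta_rel (dual_D sig M A) r"
proof -
  let ?w = "\<lambda>f. \<lambda>t\<in>carr A. f (map (\<lambda>x. x t) xs)"
  have w: "?w f \<in> alg_hom sig A M" if "f \<in> set (fs r)" for f
    by (rule alg_hom_comp[OF A r fs_hom_on[OF r that] xs(2,1,3)])
  let ?zs = "xs @ map ?w (fs r)"
  have zs: "set ?zs \<subseteq> alg_hom sig A M" using xs(1) w by auto
  have "?zs \<in> defined_rel (dual_D sig M A) (n + length (fs r)) (\<beta>h r)"
  proof (rule defined_rel_embeds[OF embeds_dual_D[OF A ego] pstruct_dual_D[OF A ego] _ hatD(2)[OF r]])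
    show "?zs \<in> tuples (n + length (fs r)) (points (dual_D sig M A))"
      using zs xs(2) by (simp add: tuples_def)
    fix u assume "u \<in> eval_at sig M A ` carr A"
    then obtain t where t: "t \<in> carr A" "u = eval_at sig M A t" by blast
    have "map u ?zs = map (\<lambda>x. x t) xs @ map (\<lambda>f. f (map (\<lambda>x. x t) xs)) (fs r)"
      unfolding t(2) map_eval_at[OF zs] using t(1) by simp
    then have "map u ?zs \<in> hat r (fs r)"
      unfolding hat_def mem_Collect_eq using xs(3)[OF t(1)] by (intro exI[of _ "map (\<lambda>x. x t) xs"] conjI)
    then show "map u ?zs \<in> defined_rel (ego_struct M) (n + length (fs r)) (\<beta>h r)"
      by (simp only: hatD(3)[OF r])
  qed
  then show ?thesis by (rule beta_relI[OF r xs(2)])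
qed

text \<open>On a dual structure the morphisms for \<open>E\<close> preserve every compatible
  relation, in whatever alter ego it is named, since all pointwise facts are
  \<open>\<beta>\<close>-facts there.\<close>

lemma zhom_dual_D_mono:
  assumes A: "is_alg sig A" and E': "is_alter_ego sig M E'"
  shows "zhom E (dual_D sig M A) (ego_struct M) \<subseteq> zhom E' (dual_D sig M A) (ego_struct M)"
proof
  let ?D = "dual_D sig M A"
  fix u assume u: "u \<in> zhom E ?D (ego_struct M)"
  have key: "map u xs \<in> r" if r: "compatible_rel sig M n r" and xs: "set xs \<subseteq> alg_hom sig A M" "length xs = n"
    "\<And>t. t \<in> carr A \<Longrightarrow> map (\<lambda>x. x t) xs \<in> r" for n r xs
    using beta_rel_zhom[OF r u beta_rel_dual_D[OF A r xs]] beta_rel_ego[OF r] by simp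
  have "map u xs \<in> r" if f: "(r, xs) \<in> facts E' ?D" for r xs
  proof -
    obtain n where n: "compatible_rel sig M n r" "xs \<in> tuples n (alg_hom sig A M)"
      using facts_compatible[OF E' pstruct_dual_D[OF A E'] f] by auto
    show ?thesis
      using facts_dual_D[OF A E' f] tuples_length[OF n(2)] by (intro key[OF n(1)])
  qed
  then show "u \<in> zhom E' ?D (ego_struct M)" using u unfolding zhom_ego_iff by blast
qed

text \<open>The morphisms for \<open>E\<close> lie between the evaluations and the morphisms for
  \<open>E'\<close>; when \<open>eta\<close> is an isomorphism for \<open>E'\<close>, the outer two
  sets coincide.\<close>

lemma eta_iso_transfer:
  assumes A: "is_alg sig A" and E': "is_alter_ego sig M E'" and iso: "eta_iso sig M E' A"
  shows "eta_iso sig M E A"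
proof -
  let ?D = "dual_D sig M A"
  have "zhom E' ?D (ego_struct M) = eta sig M A ` carr A"
    using iso by (simp add: eta_iso_def alg_iso_def bij_betw_def)
  also have "\<dots> = eval_at sig M A ` carr A" by (simp add: eta_def eval_at_def)
  also have "\<dots> \<subseteq> zhom E ?D (ego_struct M)" using eval_at_zhom[OF A ego] by blast
  finally have "zhom E' ?D (ego_struct M) = zhom E ?D (ego_struct M)"
    using zhom_dual_D_mono[OF A E'] by blast
  then have "dual_E M E' ?D = dual_E M E ?D" by (simp add: dual_E_def)
  then show ?thesis using iso by (simp add: eta_iso_def)
qed

end

text \<open>Evaluations embed the double dual of \<open>X\<close>; pulled back along
  \<open>epsilon\<close>, evaluation at \<open>u\<close> is \<open>u\<close> itself.\<close>

lemma embeds_of_epsilon_iso: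
  assumes M: "is_alg sig M" "finite (carr M)" and E: "is_alter_ego sig M E" and X: "is_pstruct E X"
    and iso: "epsilon_iso sig M E X" and ne: "zhom E X (ego_struct M) \<noteq> {}"
  shows "embeds E M X (zhom E X (ego_struct M))"
proof -
  let ?U = "zhom E X (ego_struct M)" and ?B = "dual_E M E X" and ?e = "epsilon M E X"
  have B: "is_alg sig ?B" by (rule is_alg_dual_E[OF M E X ne])
  obtain k where e: "?e \<in> zhom E X (dual_D sig M ?B)" and k: "k \<in> zhom E (dual_D sig M ?B) X"
    and ke: "\<And>x. x \<in> points X \<Longrightarrow> k (?e x) = x"
    using iso unfolding epsilon_iso_def ziso_def by blast
  have "embeds E M X ((\<lambda>v. \<lambda>x\<in>points X. v (?e x)) ` eval_at sig M ?B ` carr ?B)"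
    by (rule embeds_pullback[OF embeds_dual_D[OF B E] X e k]) (rule ke)
  moreover have "(\<lambda>x\<in>points X. eval_at sig M ?B u (?e x)) = u" if u: "u \<in> ?U" for u
  proof (rule extensionalityI[of _ "points X"])
    show "u \<in> extensional (points X)" using u by (simp add: zhom_def PiE_def)
    show "(\<lambda>x\<in>points X. eval_at sig M ?B u (?e x)) x = u x" if "x \<in> points X" for x
      using that u zhom_points[OF e that] by (simp add: eval_at_def epsilon_def)
  qed simp
  then have "(\<lambda>v. \<lambda>x\<in>points X. v (?e x)) ` eval_at sig M ?B ` carr ?B = ?U"
    unfolding carr_dual_E image_image by (simp cong: image_cong)
  ultimately show ?thesis by simp
qed

section \<open>Transfer of full duality\<close>

text \<open>The part of the duality hypothesis shared by both claims of the theorem; it is all that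
  \<open>hom_minimal_separation\<close> asks of \<open>M1\<close>.\<close>

definition finite_dualising :: "'a itself \<Rightarrow> 'f signature \<Rightarrow> ('f, 'm) alg \<Rightarrow> 'm alter_ego \<Rightarrow> bool" where
  "finite_dualising _ sig M E \<longleftrightarrow>
     (\<forall>A :: ('f, 'a) alg. in_ISP sig M A \<longrightarrow> finite (carr A) \<longrightarrow> eta_iso sig M E A)"

locale duality_transfer = uh_model sig M E fs \<beta>h X
  for sig :: "'f signature" and M :: "('f, 'm) alg" and E :: "'m alter_ego" and fs \<beta>h
    and X :: "('m, 'x) pstruct" +
  fixes E' :: "'m alter_ego" and univ :: "'a itself"
  assumes boolean: "boolean_struct E X"
    and op: "\<And>r. r \<in> erels E \<union> dom ` eops E \<Longrightarrow> op_rich_at sig M E r"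
    and ego': "is_alter_ego sig M E'"
    and inf: "infinite (UNIV :: 'a set)" and dual': "finite_dualising univ sig M E'"
begin

lemma separation:
  assumes "hom_minimal sig M n s" "a \<in> tuples n (carr M)" "a \<notin> s"
  shows "\<exists>\<alpha>. wf_atomic E' n \<alpha> \<and> (pure_prem \<alpha> \<or> (\<exists>i j. \<alpha> = Eq (Var i) (Var j))) \<and>
    (\<forall>b\<in>s. holds (ego_struct M) b \<alpha>) \<and> \<not> holds (ego_struct M) a \<alpha>"
  using hom_minimal_separation[OF inf alg fin ego' _ assms] dual' unfolding finite_dualising_def by blast

text \<open>Homomorphisms on the relation of a pure fact pull back to homomorphisms on
  \<open>hat r\<close>, which are projections. So variables witness \<open>\<beta>\<close>, and the
  fact passes from \<open>M\<close> to \<open>flat X\<close>. Equations of variables transfer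
  directly.\<close>

lemma flat_holds_of_hat:
  assumes r: "compatible_rel sig M n r" and N: "N = n + length (fs r)"
    and zs: "zs \<in> defined_rel X N (\<beta>h r)"
    and \<alpha>: "wf_atomic E' N \<alpha>" "pure_prem \<alpha> \<or> (\<exists>i j. \<alpha> = Eq (Var i) (Var j))"
    and true: "\<forall>b\<in>hat r (fs r). holds (ego_struct M) b \<alpha>"
  shows "holds (flat X) zs \<alpha>"
  using \<alpha>(2)
proof
  let ?s = "hat r (fs r)"
  have s: "defined_rel (ego_struct M) N (\<beta>h r) = ?s" and wf: "wf_ca E N (\<beta>h r)"
    using hatD[OF r] N by simp_all
  have hm: "hom_minimal sig M N ?s" using hom_minimal_hat[OF r] N by simp
  then have sc: "compatible_rel sig M N ?s" by (simp add: hom_minimal_def)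
  {
    assume pure: "pure_prem \<alpha>"
    let ?t = "prem_rel \<alpha>" and ?js = "prem_vars \<alpha>"
    note pp = pure_prem_iff[OF ego' \<alpha>(1) pure]
    have t: "compatible_rel sig M (length ?js) ?t" and js: "set ?js \<subseteq> {..<N}"
      using pp(1) by (auto simp: ok_prem_def)
    have st: "map ((!) b) ?js \<in> ?t" if "b \<in> ?s" for b using true that pp(3) by blast
    have "map ((!) zs) ?js \<in> beta_rel X ?t"
    proof (rule beta_rel_of_vars[OF wf zs t js, unfolded s])
      show "map ((!) b) ?js \<in> ?t" if "b \<in> ?s" for b by (rule st[OF that])
      fix f assume f: "f \<in> set (fs ?t)"
      have nth: "map (\<lambda>i. b ! (?js ! i)) [0..<length ?js] = map ((!) b) ?js" for b :: "'m list"
        by (intro nth_equalityI) simp_all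
      have "hom_on sig M N ?s (\<lambda>b. f (map (\<lambda>i. b ! (?js ! i)) [0..<length ?js]))"
      proof (rule hom_on_comp[OF _ _ fs_hom_on[OF t f]])
        show "hom_on sig M N ?s (\<lambda>b. b ! (?js ! i))" if "i < length ?js" for i
          using js that by (intro hom_on_nth[OF sc]) (auto simp: subset_iff)
        show "map (\<lambda>i. b ! (?js ! i)) [0..<length ?js] \<in> ?t" if "b \<in> ?s" for b
          unfolding nth by (rule st[OF that])
      qed
      then have "restrict (\<lambda>b. f (map ((!) b) ?js)) ?s \<in> alg_hom sig (rel_alg M N ?s) M"
        unfolding nth by (rule restrict_alg_hom[OF sc])
      then obtain i where i: "i < N" "\<forall>b\<in>?s. restrict (\<lambda>b. f (map ((!) b) ?js)) ?s b = b ! i"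
        using hm unfolding hom_minimal_def by blast
      then show "\<exists>u. wf_trm E N u \<and> (\<forall>a\<in>?s. eval (ego_struct M) a u = Some (f (map ((!) a) ?js)))"
        by (intro exI[of _ "Var i"]) simp
    qed
    then show ?thesis using pp(2) by blast
  next
    assume "\<exists>i j. \<alpha> = Eq (Var i) (Var j)"
    then obtain i j where ij: "\<alpha> = Eq (Var i) (Var j)" by blast
    have "holds_uh_concl X zs (At \<alpha>)"
      by (rule transfer[OF wf _ zs, unfolded s]) (use \<alpha>(1) true in \<open>simp_all add: ij\<close>)
    then show ?thesis by (simp add: ij)
  }
qed

text \<open>Suppose the image of a \<open>\<beta>\<close>-solution \<open>xs @ ws\<close> left
  \<open>hat r\<close>. A fact valid on \<open>hat r\<close> but false at the image holds in
  \<open>flat X\<close> at \<open>xs @ ws\<close>, hence is preserved by \<open>u\<close>, a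
  contradiction.\<close>

lemma flat_zhom_preserves:
  assumes r: "compatible_rel sig M n r" and u: "u \<in> zhom E' (flat X) (ego_struct M)" and xs: "xs \<in> beta_rel X r"
  shows "map u xs \<in> r"
proof -
  let ?N = "n + length (fs r)"
  obtain ws where ws: "xs \<in> tuples n (points X)" "xs @ ws \<in> defined_rel X ?N (\<beta>h r)"
    using beta_relE[OF r xs] by blast
  have zt: "xs @ ws \<in> tuples ?N (points X)" using ws(2) by (simp add: defined_rel_def)
  have uM: "u x \<in> carr M" if "x \<in> points X" for x using zhom_points[OF u] that by simp
  have at: "map u (xs @ ws) \<in> tuples ?N (carr M)" using zt uM by (auto simp: tuples_def)
  have "map u (xs @ ws) \<in> hat r (fs r)"
  proof (rule ccontr)
    assume "map u (xs @ ws) \<notin> hat r (fs r)"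
    then obtain \<alpha> where \<alpha>: "wf_atomic E' ?N \<alpha>" "pure_prem \<alpha> \<or> (\<exists>i j. \<alpha> = Eq (Var i) (Var j))"
      "\<forall>b\<in>hat r (fs r). holds (ego_struct M) b \<alpha>" "\<not> holds (ego_struct M) (map u (xs @ ws)) \<alpha>"
      using separation[OF hom_minimal_hat[OF r] at] by blast
    have "holds (flat X) (xs @ ws) \<alpha>" by (rule flat_holds_of_hat[OF r refl ws(2) \<alpha>(1-3)])
    then have "holds (ego_struct M) (map u (xs @ ws)) \<alpha>"
      by (rule holds_zhom[OF u tuples_length[OF zt] \<alpha>(1)])
    then show False using \<alpha>(4) by blast
  qed
  then have "map u xs @ map u ws \<in> defined_rel (ego_struct M) ?N (\<beta>h r)" by (simp add: hatD(3)[OF r])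
  then have "map u xs \<in> beta_rel (ego_struct M) r" using ws(1) by (intro beta_relI[OF r]) (simp_all add: tuples_def)
  then show ?thesis by (simp only: beta_rel_ego[OF r])
qed

text \<open>The atomic formula \<open>r(v)\<close> itself is the premise, and richness at
  \<open>r\<close> provides the terms for the witnesses.\<close>

lemma prel_beta_rel:
  assumes r: "r \<in> erels E" and xs: "xs \<in> prel X r"
  shows "xs \<in> beta_rel X r"
proof -
  obtain n where n: "compatible_rel sig M n r" using ego r unfolding is_alter_ego_def by blast
  have ar: "rel_arity r = n" by (rule compatible_rel_arity[OF n])
  have xt: "xs \<in> tuples n (points X)" using pstruct r xs ar unfolding is_pstruct_def by blast
  have nth: "map ((!) ys) [0..<n] = ys" if "length ys = n" for ys :: "'m list"
    using that map_nth[of ys] by simp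
  let ?\<Psi> = "[Rel r (map Var [0..<n])]"
  have p: "defined_rel (ego_struct M) n ?\<Psi> = r"
  proof (intro equalityI subsetI)
    fix a assume a: "a \<in> r"
    then have "a \<in> tuples n (carr M)" using compatible_relD(2)[OF n] by blast
    then show "a \<in> defined_rel (ego_struct M) n ?\<Psi>"
      using a nth[OF tuples_length] by (simp add: defined_rel_def holds_Rel_Var)
  next
    fix a assume "a \<in> defined_rel (ego_struct M) n ?\<Psi>"
    then have a: "a \<in> tuples n (carr M)" "map ((!) a) [0..<n] \<in> r"
      by (simp_all add: defined_rel_def holds_Rel_Var)
    show "a \<in> r" using a(2) unfolding nth[OF tuples_length[OF a(1)]] .
  qed
  have "map ((!) xs) [0..<n] \<in> beta_rel X r"
  proof (rule beta_rel_of_vars[where N = n and \<Psi> = ?\<Psi>, unfolded p])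
    show "wf_ca E n ?\<Psi>" using r ar by (simp add: wf_ca_def list_all_iff)
    show "xs \<in> defined_rel X n ?\<Psi>"
      using xt xs map_nth[of xs] by (simp add: defined_rel_def holds_Rel_Var tuples_def)
    show "compatible_rel sig M (length [0..<n]) r" using n by simp
    show *: "map ((!) a) [0..<n] \<in> r" if "a \<in> r" for a
      unfolding nth[OF tuples_length[OF subsetD[OF compatible_relD(2)[OF n] that]]] by (rule that)
    fix f assume f: "f \<in> set (fs r)"
    have "op_rich_at sig M E r" using op r by blast
    then show "\<exists>u. wf_trm E n u \<and> (\<forall>a\<in>r. eval (ego_struct M) a u = Some (f (map ((!) a) [0..<n])))"
      by (intro term_pull[OF n n _ _ _ * fs_hom_on[OF n f]]) auto
  qed auto
  then show ?thesis using map_nth[of xs] tuples_length[OF xt] by simp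
qed

text \<open>As for relations, except that richness is available at \<open>dom h\<close>; the last
  coordinate of the graph is determined by the others, so \<open>hom_on_op_graph\<close> removes
  it.\<close>

lemma pfun_beta_rel:
  assumes h: "h \<in> eops E" and b: "pfun X h xs = Some b"
  shows "xs @ [b] \<in> beta_rel X (op_graph h)"
proof -
  obtain n where n: "compatible_op sig M n h" using ego h unfolding is_alter_ego_def by blast
  have g: "compatible_rel sig M (Suc n) (op_graph h)" using n by (simp add: compatible_op_def)
  note d = compatible_dom[OF n]
  have ar: "op_arity h = n" by (rule compatible_opD(4)[OF n])
  have xt: "xs \<in> tuples n (points X)" "b \<in> points X"
    using pstruct h b ar unfolding is_pstruct_def ran_def by blast+
  let ?\<Psi> = "[Eq (App h (map Var [0..<n])) (Var n)]"
  let ?p = "defined_rel (ego_struct M) (Suc n) ?\<Psi>"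
  have wf: "wf_ca E (Suc n) ?\<Psi>" using h ar by (simp add: wf_ca_def list_all_iff)
  have pg: "map ((!) a) [0..<n] \<in> dom h" "map ((!) a) [0..<n] @ [the (h (map ((!) a) [0..<n]))] = a"
    "a \<in> op_graph h" if "a \<in> ?p" for a
  proof -
    have a: "length a = Suc n" "h (map ((!) a) [0..<n]) = Some (a ! n)"
      using that unfolding defined_rel_def mem_Collect_eq tuples_def by (auto simp: eval_App_Var)
    have e: "map ((!) a) [0..<n] @ [a ! n] = a" using a(1) map_nth[of a] by simp
    show "map ((!) a) [0..<n] \<in> dom h" using a(2) by blast
    show "map ((!) a) [0..<n] @ [the (h (map ((!) a) [0..<n]))] = a" using a(2) e by simp
    show "a \<in> op_graph h" using a(2) e op_graph_iff by metis
  qed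
  have xp: "xs @ [b] \<in> defined_rel X (Suc n) ?\<Psi>"
  proof -
    have "map ((!) (xs @ [b])) [0..<n] = xs"
      using tuples_length[OF xt(1)] by (intro nth_equalityI) (simp_all add: nth_append)
    moreover have "(xs @ [b]) ! n = b" using tuples_length[OF xt(1)] by (simp add: nth_append)
    ultimately show ?thesis
      using xt b unfolding defined_rel_def by (auto simp: eval_App_Var tuples_def)
  qed
  have pc: "compatible_rel sig M (Suc n) ?p"
  proof (rule compatible_defined_rel[OF alg ego wf])
    obtain as where "as \<in> dom h" using compatible_opD(1)[OF n] by blast
    then obtain c where c: "h as = Some c" by blast
    have as: "as \<in> tuples n (carr M)" "c \<in> carr M" using compatible_opD(3)[OF n c] by blast+
    have "map ((!) (as @ [c])) [0..<n] = as"
      using tuples_length[OF as(1)] by (intro nth_equalityI) (simp_all add: nth_append)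
    moreover have "(as @ [c]) ! n = c" using tuples_length[OF as(1)] by (simp add: nth_append)
    ultimately have "as @ [c] \<in> ?p"
      using as c unfolding defined_rel_def by (auto simp: eval_App_Var tuples_def)
    then show "?p \<noteq> {}" by blast
  qed
  have "map ((!) (xs @ [b])) [0..<Suc n] \<in> beta_rel X (op_graph h)"
  proof (rule beta_rel_of_vars[OF wf xp])
    show "compatible_rel sig M (length [0..<Suc n]) (op_graph h)" using g by simp
    show "set [0..<Suc n] \<subseteq> {..<Suc n}" by auto
    have nth: "map ((!) a) [0..<Suc n] = a" if "a \<in> ?p" for a
      using that map_nth[of a] by (auto simp: defined_rel_def tuples_def simp del: upt_Suc)
    show "map ((!) a) [0..<Suc n] \<in> op_graph h" if "a \<in> ?p" for a unfolding nth[OF that] by (rule pg(3)[OF that])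
    fix f assume f: "f \<in> set (fs (op_graph h))"
    have rich: "op_rich_at sig M E (dom h)" using op h by blast
    have "\<exists>u. wf_trm E (Suc n) u \<and> (\<forall>a\<in>?p. eval (ego_struct M) a u =
        Some (f (map ((!) a) [0..<n] @ [the (h (map ((!) a) [0..<n]))])))"
      by (rule term_pull[OF pc d(1) disjI2[OF rich] _ _ pg(1) hom_on_op_graph[OF n fs_hom_on[OF g f]]]) auto
    then show "\<exists>u. wf_trm E (Suc n) u \<and> (\<forall>a\<in>?p. eval (ego_struct M) a u = Some (f (map ((!) a) [0..<Suc n])))"
      by (simp only: pg(2) nth cong: ball_cong)
  qed
  moreover have "map ((!) (xs @ [b])) [0..<Suc n] = xs @ [b]"
    using map_nth[of "xs @ [b]"] tuples_length[OF xt(1)] by simp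
  ultimately show ?thesis by simp
qed

lemma facts_flat:
  assumes "(r, xs) \<in> facts E' (flat X)"
  shows "xs \<in> beta_rel X r"
  using assms unfolding facts_def
proof (elim UnE CollectE exE conjE case_prodE)
  fix h ys b assume h: "(r, xs) = (op_graph h, ys @ [b])" "h \<in> eops E'" "pfun (flat X) h ys = Some b"
  then obtain n where n: "compatible_op sig M n h" using ego' unfolding is_alter_ego_def by blast
  show ?thesis using h(1,3) unfolding flat_fun[OF n] by simp
qed simp

text \<open>Morphisms from \<open>X\<close> preserve the positive formulas \<open>\<beta>\<close>;
  morphisms from \<open>flat X\<close> preserve all \<open>\<beta>\<close>-relations, and the facts
  of \<open>X\<close> are among them.\<close>

lemma zhom_flat: "zhom E' (flat X) (ego_struct M) = zhom E X (ego_struct M)"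
proof (intro equalityI subsetI)
  fix u assume u: "u \<in> zhom E X (ego_struct M)"
  have "map u xs \<in> r" if f: "(r, xs) \<in> facts E' (flat X)" for r xs
  proof -
    obtain n where n: "compatible_rel sig M n r"
      using facts_compatible[OF ego' pstruct_flat[OF ego'] f] by blast
    show ?thesis using beta_rel_zhom[OF n u facts_flat[OF f]] beta_rel_ego[OF n] by simp
  qed
  then show "u \<in> zhom E' (flat X) (ego_struct M)" using u by (simp add: zhom_ego_iff)
next
  fix u assume u: "u \<in> zhom E' (flat X) (ego_struct M)"
  have "map u xs \<in> r" if f: "(r, xs) \<in> facts E X" for r xs
  proof -
    obtain n where n: "compatible_rel sig M n r" using facts_compatible[OF ego pstruct f] by blast
    have "xs \<in> beta_rel X r" using f prel_beta_rel pfun_beta_rel by (auto simp: facts_def)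
    then show ?thesis by (rule flat_zhom_preserves[OF n u])
  qed
  then show "u \<in> zhom E X (ego_struct M)" using u by (simp add: zhom_ego_iff)
qed

section \<open>From an isomorphism \<open>epsilon\<close> for \<open>flat X\<close> to one for
  \<open>X\<close>\<close>

context
  assumes iso': "epsilon_iso sig M E' (flat X)" and in': "in_IScP M E' (flat X)"
begin

lemma zhom_nonempty: "zhom E X (ego_struct M) \<noteq> {}"
  using in_IScP_embeds[OF in'] unfolding embeds_def zhom_flat by blast

lemma flat_embeds: "embeds E' M (flat X) (zhom E X (ego_struct M))"
  using embeds_of_epsilon_iso[OF alg fin ego' pstruct_flat[OF ego'] iso'] zhom_nonempty
  unfolding zhom_flat by blast

lemma dual_E_flat: "dual_E M E' (flat X) = dual_E M E X"
  by (simp add: dual_E_def zhom_flat)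

lemma epsilon_flat: "epsilon M E' (flat X) = epsilon M E X"
  by (simp add: epsilon_def zhom_flat)

lemma is_alg_dual: "is_alg sig (dual_E M E X)"
  by (rule is_alg_dual_E[OF alg fin ego pstruct zhom_nonempty])

text \<open>Witnesses exist inside \<open>X\<close> because \<open>epsilon\<close> for
  \<open>flat X\<close> is onto: applying \<open>f\<close> pointwise to \<open>xs\<close> gives a
  homomorphism from the dual algebra to \<open>M\<close>, and every such homomorphism is represented
  by a point.\<close>

lemma hat_extension:
  assumes r: "compatible_rel sig M n r" and xs: "xs \<in> tuples n (points X)"
    and u: "\<And>u. u \<in> zhom E X (ego_struct M) \<Longrightarrow> map u xs \<in> r"
  obtains ys where "ys \<in> tuples (length (fs r)) (points X)"
    "\<And>u. u \<in> zhom E X (ego_struct M) \<Longrightarrow> map u (xs @ ys) \<in> hat r (fs r)"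
proof -
  let ?U = "zhom E X (ego_struct M)" and ?B = "dual_E M E X" and ?e = "epsilon M E X"
  obtain k where e: "?e \<in> zhom E' (flat X) (dual_D sig M ?B)" and k: "k \<in> zhom E' (dual_D sig M ?B) (flat X)"
    and ek: "\<And>y. y \<in> alg_hom sig ?B M \<Longrightarrow> ?e (k y) = y"
    using iso' unfolding epsilon_iso_def ziso_def dual_E_flat epsilon_flat points_dual_D by blast
  have xsp: "set xs \<subseteq> points X" using xs by (simp add: tuples_def)
  have em: "map (\<lambda>y. y u) (map ?e xs) = map u xs" if "u \<in> ?U" for u
    using xsp that by (auto simp: epsilon_def)
  have es: "set (map ?e xs) \<subseteq> alg_hom sig ?B M"
    using xsp zhom_points[OF e] by auto
  define w where "w = (\<lambda>f :: 'm list \<Rightarrow> 'm. \<lambda>u\<in>?U. f (map (\<lambda>y. y u) (map ?e xs)))"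
  have w: "w f \<in> alg_hom sig ?B M" if f: "f \<in> set (fs r)" for f
  proof -
    have "(\<lambda>u\<in>carr ?B. f (map (\<lambda>y. y u) (map ?e xs))) \<in> alg_hom sig ?B M"
    proof (rule alg_hom_comp[OF is_alg_dual r fs_hom_on[OF r f] _ es])
      show "length (map ?e xs) = n" using xs by (simp add: tuples_def)
      show "map (\<lambda>y. y t) (map ?e xs) \<in> r" if "t \<in> carr ?B" for t
        using that u em[of t] by (simp del: map_map)
    qed
    then show ?thesis by (simp add: w_def del: map_map)
  qed
  have kw: "k (w f) \<in> points X" if "f \<in> set (fs r)" for f using zhom_points[OF k] w[OF that] by simp
  have ukw: "v (k (w f)) = f (map v xs)" if "f \<in> set (fs r)" "v \<in> ?U" for f v
  proof -
    have "v (k (w f)) = ?e (k (w f)) v" using kw[OF that(1)] that(2) by (simp add: epsilon_def)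
    also have "\<dots> = w f v" by (simp only: ek[OF w[OF that(1)]])
    also have "\<dots> = f (map v xs)" using that(2) em[OF that(2)] by (simp add: w_def del: map_map)
    finally show ?thesis .
  qed
  show thesis
  proof
    show "map (\<lambda>f. k (w f)) (fs r) \<in> tuples (length (fs r)) (points X)" using kw by (auto simp: tuples_def)
    fix v assume v: "v \<in> ?U"
    have "map v (xs @ map (\<lambda>f. k (w f)) (fs r)) = map v xs @ map (\<lambda>f. f (map v xs)) (fs r)"
      using ukw[OF _ v] by simp
    then show "map v (xs @ map (\<lambda>f. k (w f)) (fs r)) \<in> hat r (fs r)"
      unfolding hat_def mem_Collect_eq using u[OF v] by (intro exI[of _ "map v xs"] conjI)
  qed
qed

text \<open>Over \<open>M\<close>, membership in \<open>hat r\<close> is equivalent to finitely many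
  facts of \<open>E'\<close>, one for each tuple outside. They hold at \<open>zs\<close> in
  \<open>flat X\<close> by reflection, and the implication from them to \<open>\<gamma>\<close> is a
  Horn statement about \<open>X\<close> with \<open>\<beta>\<close> in its premise.\<close>

lemma hat_entails:
  assumes r: "compatible_rel sig M n r" and N: "N = n + length (fs r)" and zs: "zs \<in> tuples N (points X)"
    and u: "\<And>u. u \<in> zhom E X (ego_struct M) \<Longrightarrow> map u zs \<in> hat r (fs r)"
    and \<gamma>: "wf_atomic E N \<gamma>" "\<And>b. b \<in> hat r (fs r) \<Longrightarrow> holds (ego_struct M) b \<gamma>"
  shows "holds X zs \<gamma>"
proof -
  let ?s = "hat r (fs r)"
  have hm: "hom_minimal sig M N ?s" using hom_minimal_hat[OF r] N by simp
  define bad where "bad = tuples N (carr M) - ?s"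
  have "finite bad" unfolding bad_def using finite_tuples[OF fin] by blast
  then obtain bs where bs: "set bs = bad" using finite_list by blast
  have "\<exists>\<alpha>. wf_atomic E' N \<alpha> \<and> (pure_prem \<alpha> \<or> (\<exists>i j. \<alpha> = Eq (Var i) (Var j))) \<and>
    (\<forall>b\<in>?s. holds (ego_struct M) b \<alpha>) \<and> \<not> holds (ego_struct M) a \<alpha>" if "a \<in> bad" for a
    using separation[OF hm, of a] that by (auto simp: bad_def)
  then obtain w where w: "\<And>a. a \<in> bad \<Longrightarrow> wf_atomic E' N (w a) \<and>
    (pure_prem (w a) \<or> (\<exists>i j. w a = Eq (Var i) (Var j))) \<and>
    (\<forall>b\<in>?s. holds (ego_struct M) b (w a)) \<and> \<not> holds (ego_struct M) a (w a)" by metis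
  have flat: "holds (flat X) zs (w a)" if "a \<in> bad" for a
  proof (rule holds_embeds[OF flat_embeds pstruct_flat[OF ego']])
    show "zs \<in> tuples N (points (flat X))" using zs by simp
    show "wf_atomic E' N (w a)" using w[OF that] by blast
    show "holds (ego_struct M) (map v zs) (w a)" if "v \<in> zhom E X (ego_struct M)" for v
      using w[OF \<open>a \<in> bad\<close>] u[OF that] by blast
  qed
  \<comment> \<open>Pure facts enter through \<open>\<beta>\<close>, whereas equations of variables
    are atomic over \<open>E\<close> as they stand.\<close>
  let ?\<Phi> = "filter pure_prem (map w bs)" and ?\<Theta> = "filter (\<lambda>\<alpha>. \<not> pure_prem \<alpha>) (map w bs)"
  have \<Phi>: "wf_atomic E' N \<alpha> \<and> pure_prem \<alpha> \<and> holds (flat X) zs \<alpha>" if "\<alpha> \<in> set ?\<Phi>" for \<alpha>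
    using that w flat bs by auto
  have \<Theta>: "\<exists>i j. \<alpha> = Eq (Var i) (Var j) \<and> i < N \<and> j < N \<and> zs ! i = zs ! j" if "\<alpha> \<in> set ?\<Theta>" for \<alpha>
  proof -
    obtain a where a: "a \<in> bad" "\<alpha> = w a" "\<not> pure_prem \<alpha>" using \<open>\<alpha> \<in> set ?\<Theta>\<close> bs by auto
    then obtain i j where "\<alpha> = Eq (Var i) (Var j)" using w[OF a(1)] by blast
    then show ?thesis using w[OF a(1)] flat[OF a(1)] a(2) by auto
  qed
  have "holds_uh_concl X zs (At \<gamma>)"
  proof (rule concl_of_beta_rel[where \<Phi> = ?\<Phi> and \<Theta> = ?\<Theta> and N = N])
    show "ok_prem N \<alpha> \<and> map ((!) zs) (prem_vars \<alpha>) \<in> beta_rel X (prem_rel \<alpha>)" if "\<alpha> \<in> set ?\<Phi>" for \<alpha>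
      using pure_prem_iff(1,2)[OF ego'] \<Phi>[OF that] by blast
    show "wf_ca E N ?\<Theta>" unfolding wf_ca_def using \<Theta> by fastforce
    have "holds X zs \<alpha>" if "\<alpha> \<in> set ?\<Theta>" for \<alpha> using \<Theta>[OF that] by auto
    then show "zs \<in> defined_rel X N ?\<Theta>" using zs by (simp add: defined_rel_def)
    show "wf_uh_concl E N (At \<gamma>)" using \<gamma>(1) by simp
    fix a assume a: "a \<in> defined_rel (ego_struct M) N ?\<Theta>"
      and p: "\<And>\<alpha>. \<alpha> \<in> set ?\<Phi> \<Longrightarrow> map ((!) a) (prem_vars \<alpha>) \<in> prem_rel \<alpha>"
    have "holds (ego_struct M) a (w b)" if "b \<in> bad" for b
    proof (cases "pure_prem (w b)")
      case True
      then show ?thesis using p[of "w b"] w[OF that] that bs pure_prem_iff(3)[OF ego' _ True] by auto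
    next
      case False
      then show ?thesis using a that bs by (auto simp: defined_rel_def)
    qed
    then have "a \<notin> bad" using w by blast
    then have "a \<in> ?s" using a by (simp add: bad_def defined_rel_def)
    then show "holds_uh_concl (ego_struct M) a (At \<gamma>)" using \<gamma>(2) by simp
  qed
  then show ?thesis by simp
qed

text \<open>The witnesses from \<open>hat_extension\<close> reduce \<open>r\<close> to
  \<open>hat r\<close>; \<open>\<gamma>\<close> does not mention the new variables.\<close>

lemma zhom_entails:
  assumes r: "compatible_rel sig M n r" and xs: "xs \<in> tuples n (points X)"
    and u: "\<And>u. u \<in> zhom E X (ego_struct M) \<Longrightarrow> map u xs \<in> r"
    and \<gamma>: "wf_atomic E n \<gamma>" "\<And>b. b \<in> r \<Longrightarrow> holds (ego_struct M) b \<gamma>"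
  shows "holds X xs \<gamma>"
proof -
  obtain ys where ys: "ys \<in> tuples (length (fs r)) (points X)"
    "\<And>u. u \<in> zhom E X (ego_struct M) \<Longrightarrow> map u (xs @ ys) \<in> hat r (fs r)"
    using hat_extension[OF r xs u] by blast
  have "holds X (xs @ ys) \<gamma>"
  proof (rule hat_entails[OF r refl tuples_append[OF xs ys(1)] ys(2)])
    show "wf_atomic E (n + length (fs r)) \<gamma>" by (rule wf_atomic_mono[OF \<gamma>(1)]) simp
    fix b assume "b \<in> hat r (fs r)"
    then obtain a where a: "a \<in> r" "b = a @ map (\<lambda>f. f a) (fs r)" by (auto simp: hat_def)
    have "length a = n" using compatible_relD(2)[OF r] a(1) by (auto simp: tuples_def)
    then show "holds (ego_struct M) b \<gamma>" unfolding a(2) using holds_append[of E a \<gamma>] \<gamma>(1) \<gamma>(2)[OF a(1)] by simp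
  qed
  then show ?thesis using holds_append[of E xs \<gamma>] \<gamma>(1) tuples_length[OF xs] by simp
qed

text \<open>Reflection is entailment of the atom \<open>r(v)\<close>, or of
  \<open>h(v) = h(v)\<close> for domains. Separation of points is inherited, since \<open>X\<close>
  and \<open>flat X\<close> share points and morphisms to \<open>M\<close>.\<close>

lemma zhom_embeds: "embeds E M X (zhom E X (ego_struct M))"
  unfolding embeds_def
proof (intro conjI ballI impI)
  show "x = y" if "x \<in> points X" "y \<in> points X" "\<forall>u\<in>zhom E X (ego_struct M). u x = u y" for x y
    using flat_embeds that unfolding embeds_def flat_simps by blast
next
  fix r xs assume r: "r \<in> erels E" "xs \<in> tuples (rel_arity r) (points X)"
    and u: "\<forall>u\<in>zhom E X (ego_struct M). map u xs \<in> r"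
  obtain n where n: "compatible_rel sig M n r" using ego r(1) unfolding is_alter_ego_def by blast
  have ar: "rel_arity r = n" by (rule compatible_rel_arity[OF n])
  have xt: "xs \<in> tuples n (points X)" using r(2) by (simp only: ar)
  have "holds X xs (Rel r (map Var [0..<n]))"
  proof (rule zhom_entails[OF n xt])
    show "map u xs \<in> r" if "u \<in> zhom E X (ego_struct M)" for u using u that by blast
    show "wf_atomic E n (Rel r (map Var [0..<n]))" using r(1) ar by (simp add: list_all_iff)
    fix b assume b: "b \<in> r"
    then have "length b = n" using compatible_relD(2)[OF n] by (auto simp: tuples_def)
    then show "holds (ego_struct M) b (Rel r (map Var [0..<n]))"
      unfolding holds_Rel_Var using b map_nth[of b] by simp
  qed
  then show "xs \<in> prel X r" unfolding holds_Rel_Var using map_nth[of xs] tuples_length[OF xt] by simp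
next
  fix h xs assume h: "h \<in> eops E" "xs \<in> tuples (op_arity h) (points X)"
    and u: "\<forall>u\<in>zhom E X (ego_struct M). map u xs \<in> dom h"
  obtain n where n: "compatible_op sig M n h" using ego h(1) unfolding is_alter_ego_def by blast
  have ar: "op_arity h = n" by (rule compatible_opD(4)[OF n])
  have xt: "xs \<in> tuples n (points X)" using h(2) by (simp only: ar)
  let ?t = "App h (map Var [0..<n])"
  have "holds X xs (Eq ?t ?t)"
  proof (rule zhom_entails[OF compatible_dom(1)[OF n] xt])
    show "map u xs \<in> dom h" if "u \<in> zhom E X (ego_struct M)" for u using u that by blast
    show "wf_atomic E n (Eq ?t ?t)" using h(1) ar by (simp add: list_all_iff)
    fix b assume b: "b \<in> dom h"
    then have "length b = n" using compatible_opD(2)[OF n] by (auto simp: tuples_def)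
    then show "holds (ego_struct M) b (Eq ?t ?t)"
      unfolding holds.simps eval_App_Var using b map_nth[of b] by auto
  qed
  then show "xs \<in> dom (pfun X h)"
    unfolding holds.simps eval_App_Var using map_nth[of xs] tuples_length[OF xt] by auto
qed simp

lemma in_IScP: "in_IScP M E X"
  by (rule embeds_in_IScP[OF ego boolean zhom_embeds zhom_nonempty])

text \<open>The map and its inverse are those for \<open>flat X\<close>, so bijectivity and
  continuity are known. The inverse preserves the structure by \<open>inverse_zhom\<close>:
  morphisms to \<open>M\<close> reflect the structure of \<open>X\<close>, and each factors through
  an evaluation.\<close>

lemma epsilon_iso: "epsilon_iso sig M E X"
proof -
  let ?U = "zhom E X (ego_struct M)" and ?B = "dual_E M E X" and ?e = "epsilon M E X"
  let ?D = "dual_D sig M ?B"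
  obtain k where e: "?e \<in> zhom E' (flat X) ?D" and k: "k \<in> zhom E' ?D (flat X)"
    and ke: "\<And>x. x \<in> points X \<Longrightarrow> k (?e x) = x" and ek: "\<And>y. y \<in> alg_hom sig ?B M \<Longrightarrow> ?e (k y) = y"
    using iso' unfolding epsilon_iso_def ziso_def dual_E_flat epsilon_flat points_dual_D flat_simps by blast
  have em: "map (\<lambda>y. y u) (map ?e xs) = map u xs" if "set xs \<subseteq> points X" "u \<in> ?U" for xs u
    using that by (auto simp: epsilon_def)
  have es: "set (map ?e xs) \<subseteq> alg_hom sig ?B M" if "set xs \<subseteq> points X" for xs
    using that zhom_points[OF e] by auto
  have e': "?e \<in> zhom E X ?D"
    unfolding zhom_def mem_Collect_eq
  proof (intro conjI ballI allI impI)
    show "?e \<in> points X \<rightarrow>\<^sub>E points ?D" "continuous_map (ptop X) (ptop ?D) ?e"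
      using e by (simp_all add: zhom_def)
  next
    fix r xs assume r: "r \<in> erels E" "xs \<in> prel X r"
    then have xs: "set xs \<subseteq> points X" by (rule pstruct_prel[OF pstruct])
    have "map u xs \<in> r" if "u \<in> ?U" for u using that r by (auto simp: zhom_def)
    then show "map ?e xs \<in> prel ?D r"
      unfolding prel_dual_D carr_dual_E using es[OF xs] em[OF xs] by (simp del: map_map)
  next
    fix h xs b assume h: "h \<in> eops E" "pfun X h xs = Some b"
    then have xs: "set xs \<subseteq> points X" and b: "b \<in> points X"
      using pstruct unfolding is_pstruct_def tuples_def dom_def ran_def by blast+
    have "h (map u xs) = Some (u b)" if "u \<in> ?U" for u using that h by (auto simp: zhom_def)
    then show "pfun ?D h (map ?e xs) = Some (?e b)"
      unfolding pfun_dual_D carr_dual_E using es[OF xs] em[OF xs] b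
      by (auto simp: epsilon_def simp del: map_map)
  qed
  have k': "k \<in> zhom E ?D X"
  proof (rule inverse_zhom[OF zhom_embeds pstruct pstruct_dual_D[OF is_alg_dual ego] e'])
    show "k \<in> points ?D \<rightarrow>\<^sub>E points X" "continuous_map (ptop ?D) (ptop X) k"
      using k by (simp_all add: zhom_def)
    show "\<exists>v\<in>zhom E ?D (ego_struct M). \<forall>x\<in>points X. v (?e x) = u x" if u: "u \<in> ?U" for u
      using eval_at_zhom[OF is_alg_dual ego, of u] u zhom_points[OF e]
      by (intro bexI[of _ "eval_at sig M ?B u"]) (auto simp: eval_at_def epsilon_def)
  qed (use ke ek in simp_all)
  show ?thesis
    unfolding epsilon_iso_def ziso_def using e' k' ke ek by auto
qed

end

end

section \<open>Both claims: duality at the finite level, and standardness together with full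
  duality\<close>

theorem mainTheorem1:
  fixes sig :: "'f signature" and M :: "('f, 'm) alg"
    and M1 M2 :: "'m alter_ego"
    and \<Sigma>1 :: "'m uh_sentence set"
    and fs :: "'m frel \<Rightarrow> ('m list \<Rightarrow> 'm) list" and \<beta>h :: "'m frel \<Rightarrow> 'm ca_formula"
  assumes universes: "infinite (UNIV :: 'a set)" "infinite (UNIV :: 'x set)"
    and M: "is_alg sig M" "finite (carr M)"
    and egos: "is_alter_ego sig M M1" "is_alter_ego sig M M2"
    and hm: "\<forall>n r. hom_minimal sig M n r \<longrightarrow> r \<in> Rel_ca M M2"
    and op: "\<forall>r \<in> erels M2 \<union> dom ` eops M2. op_rich_at sig M M2 r"
    and choice: "hat_choice sig M M2 fs \<beta>h"
    and basis: "uH_basis TYPE('x) M M1 \<Sigma>1"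
    and pure: "\<forall>\<phi>\<in>\<Sigma>1. pure_uh \<phi>"
    and ax: "\<forall>\<phi>\<in>\<Sigma>1. \<not> concl_in_language M2 (concl \<phi>) \<longrightarrow>
               op_rich_at sig M M2 (pr (ego_struct M) (natural fs \<beta>h \<phi>))"
  shows "(fully_dualises_finite TYPE('a) TYPE('x) sig M M1 \<longrightarrow>
            fully_dualises_finite TYPE('a) TYPE('x) sig M M2) \<and>
         (standard TYPE('x) M M1 \<and> fully_dualises TYPE('a) TYPE('x) sig M M1 \<longrightarrow>
            standard TYPE('x) M M2 \<and> fully_dualises TYPE('a) TYPE('x) sig M M2)"
proof -
  interpret hat_ego sig M M2 fs \<beta>h by unfold_locales (use M egos choice in simp_all)
  have boolean_of: "boolean_struct M2 X \<and> (\<forall>\<sigma>\<in>Th_uH M M2. sat_uh X \<sigma>)"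
    if "in_IScP M M2 X" for X :: "('m, 'x) pstruct"
  proof -
    have X: "boolean_struct M2 X" using that by (simp add: in_IScP_def)
    obtain K where "K \<noteq> {}" "embeds M2 M X K" using in_IScP_embeds[OF \<open>in_IScP M M2 X\<close>] by blast
    then show ?thesis using X sat_uh_embeds[of M2 M X K] by (auto simp: boolean_struct_def)
  qed
  have eta: "eta_iso sig M M2 A" if "in_ISP sig M A" "eta_iso sig M M1 A" for A :: "('f, 'a) alg"
    using that by (intro eta_iso_transfer[OF _ egos(1)]) (auto simp: in_ISP_def)
  have model: "boolean_struct M1 (flat X) \<and> (\<forall>\<sigma>\<in>Th_uH M M1. sat_uh (flat X) \<sigma>)"
    and transfer: "finite_dualising TYPE('a) sig M M1 \<Longrightarrow> in_IScP M M1 (flat X) \<Longrightarrow>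
      epsilon_iso sig M M1 (flat X) \<Longrightarrow> in_IScP M M2 X \<and> epsilon_iso sig M M2 X"
    if X: "boolean_struct M2 X" "\<forall>\<sigma>\<in>Th_uH M M2. sat_uh X \<sigma>" for X :: "('m, 'x) pstruct"
  proof -
    interpret uh_model sig M M2 fs \<beta>h X
      by unfold_locales (use X in \<open>simp_all add: boolean_struct_def\<close>)
    \<comment> \<open>It suffices to verify the axioms; the basis property is then applied to
      \<open>flat X\<close> as a structure over \<open>'x\<close>.\<close>
    have "sat_uh (flat X) \<sigma>" if "\<sigma> \<in> \<Sigma>1" for \<sigma>
      using basis that pure op ax by (intro flat_sat[OF egos(1)]) (auto simp: uH_basis_def)
    then show "boolean_struct M1 (flat X) \<and> (\<forall>\<sigma>\<in>Th_uH M M1. sat_uh (flat X) \<sigma>)"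
      using boolean_flat[OF X(1) egos(1)] pstruct_flat[OF egos(1)] basis unfolding uH_basis_def by blast
    assume d: "finite_dualising TYPE('a) sig M M1" and i: "in_IScP M M1 (flat X)" "epsilon_iso sig M M1 (flat X)"
    interpret duality_transfer sig M M2 fs \<beta>h X M1 "TYPE('a)"
      by unfold_locales (use X egos op universes d in simp_all)
    show "in_IScP M M2 X \<and> epsilon_iso sig M M2 X" using in_IScP epsilon_iso i by blast
  qed
  \<comment> \<open>In the finite case \<open>finite_model_embeds\<close> plays the role of
    standardness of \<open>M1\<close>: it places the finite model \<open>flat X\<close> in the class
    \<open>in_IScP\<close> for \<open>M1\<close>.\<close>
  have finite: "fully_dualises_finite TYPE('a) TYPE('x) sig M M2"
    if dual: "fully_dualises_finite TYPE('a) TYPE('x) sig M M1"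
    unfolding fully_dualises_finite_def
  proof (intro conjI allI impI)
    show "eta_iso sig M M2 A" if "in_ISP sig M A" "finite (carr A)" for A :: "('f, 'a) alg"
      using dual eta that unfolding fully_dualises_finite_def by blast
    fix X :: "('m, 'x) pstruct" assume X: "in_IScP M M2 X" "finite (points X)"
    note b = boolean_of[OF X(1)]
    have f: "boolean_struct M1 (flat X)" "\<And>\<sigma>. \<sigma> \<in> Th_uH M M1 \<Longrightarrow> sat_uh (flat X) \<sigma>"
      using model b by blast+
    have fX: "finite (points (flat X))" using X(2) by simp
    have i: "in_IScP M M1 (flat X)"
      by (rule embeds_in_IScP[OF egos(1) f(1) finite_model_embeds[OF M(2) f(1) fX f(2)]])
    moreover have "epsilon_iso sig M M1 (flat X)"
      using dual i fX unfolding fully_dualises_finite_def by blast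
    moreover have "finite_dualising TYPE('a) sig M M1"
      using dual unfolding fully_dualises_finite_def finite_dualising_def by blast
    ultimately show "epsilon_iso sig M M2 X" using transfer b by blast
  qed
  have "standard TYPE('x) M M2 \<and> fully_dualises TYPE('a) TYPE('x) sig M M2"
    if std: "standard TYPE('x) M M1" and dual: "fully_dualises TYPE('a) TYPE('x) sig M M1"
  proof -
    \<comment> \<open>Stated for Boolean models rather than members of the class, so that it yields
      standardness of \<open>M2\<close> together with the isomorphism.\<close>
    have key: "in_IScP M M2 X \<and> epsilon_iso sig M M2 X"
      if X: "boolean_struct M2 X" "\<forall>\<sigma>\<in>Th_uH M M2. sat_uh X \<sigma>" for X :: "('m, 'x) pstruct"
    proof -
      have i: "in_IScP M M1 (flat X)" using std model[OF X] unfolding standard_def by blast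
      moreover have "epsilon_iso sig M M1 (flat X)" using dual i unfolding fully_dualises_def by blast
      moreover have "finite_dualising TYPE('a) sig M M1"
        using dual unfolding fully_dualises_def finite_dualising_def by blast
      ultimately show ?thesis using transfer[OF X] by blast
    qed
    have "standard TYPE('x) M M2" unfolding standard_def using key boolean_of by blast
    moreover have "fully_dualises TYPE('a) TYPE('x) sig M M2"
      using dual eta key boolean_of unfolding fully_dualises_def by blast
    ultimately show ?thesis by blast
  qed
  then show ?thesis using finite by blast
qed

end
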